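(* Let $p\ge 2$, $\alpha=p-1$, $0<R<\infty$ and $\theta\ge\alpha$. Then for every $\nu$ with $0\le\nu<\lambda_{\alpha,\theta}$, $$S(p,\nu,\theta,R)=\sup_{u\in X^{1,p}_R(\alpha,\theta),\ H_\nu(u)\le 1}\int_0^R e^{\mu_{\alpha,\theta}|u|^{\frac{p}{p-1}}}\,\mathrm d\lambda_\theta<\infty .$$
   Context: For $s\ge 0$ let $\omega_s=\frac{2\pi^{s/2}}{\Gamma(s/2)}$ and let $\mathrm d\lambda_s=\omega_s r^s\,\mathrm dr$ on $(0,R)$; $L^q_s=L^q((0,R),\mathrm d\lambda_s)$. The space $X^{1,p}_R(\alpha,\theta)$ is the completion of the set of all $u\in AC_{loc}(0,R)$ with $\lim_{r\to R}u(r)=0$, $u\in L^p_\theta$, $u'\in L^p_\alpha$, with respect to the norm $\|u\|=(\|u\|^p_{L^p_\theta}+\|u'\|^p_{L^p_\alpha})^{1/p}$. Set $\mu_{\alpha,\theta}=(\theta+1)\omega_\alpha^{1/\alpha}$, $\lambda_{\alpha,\theta}=\inf_{u\in X^{1,p}_R(\alpha,\theta)\setminus\{0\}}\|u'\|^p_{L^p_\alpha}/\|u\|^p_{L^p_\theta}$, and $H_\nu(u)=(\|u'\|^p_{L^p_\alpha}-\nu\|u\|^p_{L^p_\theta})^{1/p}$. *)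

theory Defs
  imports "HOL-Analysis.Analysis"
begin

definition omega :: "real \<Rightarrow> real" where
  "omega s = 2 * pi powr (s / 2) * rGamma (s / 2)"

definition lam_int :: "real \<Rightarrow> real \<Rightarrow> (real \<Rightarrow> ennreal) \<Rightarrow> ennreal" where
  "lam_int s R f = (\<integral>\<^sup>+ r. indicator {0<..<R} r * ennreal (omega s * r powr s) * f r \<partial>lborel)"

definition Lpn :: "real \<Rightarrow> real \<Rightarrow> real \<Rightarrow> (real \<Rightarrow> real) \<Rightarrow> ennreal" where
  "Lpn s p R g = lam_int s R (\<lambda>r. ennreal (\<bar>g r\<bar> powr p))"

definition inLp :: "real \<Rightarrow> real \<Rightarrow> real \<Rightarrow> (real \<Rightarrow> real) \<Rightarrow> bool" where
  "inLp s p R g \<longleftrightarrow> g \<in> borel_measurable lborel \<and> Lpn s p R g < \<infinity>"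

definition abs_cont_on :: "real \<Rightarrow> real \<Rightarrow> (real \<Rightarrow> real) \<Rightarrow> bool" where
  "abs_cont_on a b f \<longleftrightarrow>
    (\<forall>\<epsilon>>0. \<exists>\<delta>>0. \<forall>n (xs::nat \<Rightarrow> real) ys.
       (\<forall>i<n. a \<le> xs i \<and> xs i \<le> ys i \<and> ys i \<le> b) \<and>
       (\<forall>i<n. \<forall>j<n. i \<noteq> j \<longrightarrow> ys i \<le> xs j \<or> ys j \<le> xs i) \<and>
       (\<Sum>i<n. ys i - xs i) < \<delta>
       \<longrightarrow> (\<Sum>i<n. \<bar>f (ys i) - f (xs i)\<bar>) < \<epsilon>)"

definition AC_loc :: "real \<Rightarrow> (real \<Rightarrow> real) \<Rightarrow> bool" where
  "AC_loc R f \<longleftrightarrow> (\<forall>a b. 0 < a \<and> a \<le> b \<and> b < R \<longrightarrow> abs_cont_on a b f)"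

definition Xgen :: "real \<Rightarrow> real \<Rightarrow> real \<Rightarrow> real \<Rightarrow> ((real \<Rightarrow> real) \<times> (real \<Rightarrow> real)) set" where
  "Xgen p R \<alpha> \<theta> = {(u, v). AC_loc R u \<and> (u \<longlongrightarrow> 0) (at_left R) \<and>
      (AE r in lborel. r \<in> {0<..<R} \<longrightarrow> (u has_real_derivative v r) (at r)) \<and>
      inLp \<theta> p R u \<and> inLp \<alpha> p R v}"

text \<open>The completion X^{1,p}_R(alpha,theta), realised as the closure of the graph
  {(u,u')} in L^p_theta x L^p_alpha: an element is a pair (u, u') of L^p functions
  approximable in the norm by generating pairs.\<close>
definition Xsp :: "real \<Rightarrow> real \<Rightarrow> real \<Rightarrow> real \<Rightarrow> ((real \<Rightarrow> real) \<times> (real \<Rightarrow> real)) set" where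
  "Xsp p R \<alpha> \<theta> = {(u, v). inLp \<theta> p R u \<and> inLp \<alpha> p R v \<and>
      (\<exists>w :: nat \<Rightarrow> (real \<Rightarrow> real) \<times> (real \<Rightarrow> real).
         (\<forall>n. w n \<in> Xgen p R \<alpha> \<theta>) \<and>
         (\<lambda>n. Lpn \<theta> p R (\<lambda>r. fst (w n) r - u r)) \<longlonglongrightarrow> 0 \<and>
         (\<lambda>n. Lpn \<alpha> p R (\<lambda>r. snd (w n) r - v r)) \<longlonglongrightarrow> 0)}"

definition mu :: "real \<Rightarrow> real \<Rightarrow> real" where
  "mu \<alpha> \<theta> = (\<theta> + 1) * omega \<alpha> powr (1 / \<alpha>)"

definition lambda1 :: "real \<Rightarrow> real \<Rightarrow> real \<Rightarrow> real \<Rightarrow> ennreal" where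
  "lambda1 p R \<alpha> \<theta> = (INF uv \<in> {uv \<in> Xsp p R \<alpha> \<theta>.
       Lpn \<theta> p R (fst uv) + Lpn \<alpha> p R (snd uv) \<noteq> 0}.
       Lpn \<alpha> p R (snd uv) / Lpn \<theta> p R (fst uv))"

definition Hnu :: "real \<Rightarrow> real \<Rightarrow> real \<Rightarrow> real \<Rightarrow> real \<Rightarrow> (real \<Rightarrow> real) \<Rightarrow> (real \<Rightarrow> real) \<Rightarrow> real" where
  "Hnu p R \<alpha> \<theta> \<nu> u v =
     (enn2real (Lpn \<alpha> p R v) - \<nu> * enn2real (Lpn \<theta> p R u)) powr (1 / p)"

end

theory Submission
  imports Defs
begin

text \<open>
The idea is to remove the potential term by a ground state substitution and then to run Moser's
argument. Since \<open>\<nu> < \<lambda>\<close>, the equation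
\<open>(r powr (p - 1) * (- \<phi>') powr (p - 1))' = c * r powr \<theta> * \<phi> powr (p - 1)\<close> with \<open>c = \<nu> * \<omega>_\<theta> / \<omega>_\<alpha>\<close>
has a bounded decreasing solution with \<open>\<phi> \<ge> 1\<close> and \<open>\<phi> R = 1\<close>, obtained by monotone
iteration. An element \<open>(u, u')\<close> satisfies \<open>\<bar>u r\<bar> \<le> U r\<close> with \<open>U r\<close> the integral of \<open>\<bar>u'\<bar>\<close> over
\<open>(r, R)\<close>, and passing from \<open>u\<close> to \<open>U\<close> only decreases \<open>H_\<nu>\<close>. For the monotone function
\<open>U = \<phi> * z\<close> and \<open>p \<ge> 2\<close> Picone's identity becomes an inequality with constant one, which bounds
the weighted energy of \<open>z\<close>, that is the integral of \<open>r powr (p - 1) * \<phi> powr p * \<bar>z'\<bar> powr p\<close>,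
by that of \<open>r powr (p - 1) * \<bar>U'\<bar> powr p - c * r powr \<theta> * U powr p\<close>.
In the time variable with density \<open>\<phi> powr (- q) / r\<close>, \<open>q = p / (p - 1)\<close>, this is the
unweighted energy, so Moser's inequality applies to \<open>z\<close>; since \<open>\<phi> 0 - \<phi> r\<close> is \<open>O(r)\<close>, this time
differs from a multiple of \<open>ln (R / r)\<close> by a bounded amount only.
\<close>

section \<open>Elementary inequalities\<close>

text \<open>The constant \<open>mu\<close> is critical, so no factor may be lost in the leading term
  of the exponent. Two facts secure this. The function \<phi> is largest at 0, where concentration
  happens: the factor \<open>\<phi> 0\<close> lost in \<open>U \<le> \<phi> 0 * z\<close> is
  returned by the time variable, whose density near 0 is close to
  \<open>\<phi> 0 powr (- q) / r\<close>. And Picone's remainder has constant one because the power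
  \<open>p - 1\<close> is superadditive, which uses \<open>p \<ge> 2\<close>. The obstacle at the
  origin is that nothing is known there in advance about the boundary terms of Picone's identity.
  All estimates are therefore made on intervals with left end \<open>r > 0\<close>, with the
  boundary terms kept inside \<open>excess\<close>; this quantity is nonnegative and additive, and
  its term at the left end has the favourable sign as \<open>r\<close> tends to 0. Hoelder's
  inequality is replaced by Young's with a free parameter, since that form is linear in the energy
  and survives limits. The strict gap between \<nu> and the eigenvalue is spent on bounding the
  iteration.\<close>

lemma powr_superadditive:
  fixes x y a :: real
  assumes "1 \<le> a" "0 \<le> x" "0 \<le> y"
  shows "x powr a + y powr a \<le> (x + y) powr a"
proof -
  have *: "z powr a \<le> z * (x + y) powr (a - 1)" if "0 \<le> z" "z \<le> x + y" for z
  proof -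
    have "z powr a = z * z powr (a - 1)"
      using that by (cases "z = 0") (auto simp: powr_mult_base)
    also have "\<dots> \<le> z * (x + y) powr (a - 1)"
      using that assms by (intro mult_left_mono powr_mono2) auto
    finally show ?thesis .
  qed
  have "x powr a + y powr a \<le> (x + y) * (x + y) powr (a - 1)"
    using *[of x] *[of y] assms by (simp add: distrib_right)
  also have "\<dots> = (x + y) powr a"
    using assms by (cases "x + y = 0") (auto simp: powr_mult_base)
  finally show ?thesis .
qed

text \<open>With \<open>b = \<bar>g - x\<bar>\<close> the difference of the two sides vanishes at
  \<open>b = 0\<close>, and its derivative in \<open>b\<close> is \<open>p\<close> times a
  superadditivity defect of the power \<open>p - 1\<close>, for the sum \<open>x + b\<close> in one
  case and for \<open>x = (x - b) + b\<close> in the other.\<close>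

lemma picone_pointwise:
  fixes x g p :: real
  assumes p: "2 \<le> p" and x: "0 \<le> x" and g: "0 \<le> g"
  shows "x powr p + p * x powr (p - 1) * (g - x) + \<bar>g - x\<bar> powr p \<le> g powr p"
proof (cases "x \<le> g")
  case True
  let ?h = "\<lambda>b. (x + b) powr p - p * x powr (p - 1) * b - b powr p"
  have "?h 0 \<le> ?h (g - x)"
  proof (rule DERIV_nonneg_imp_increasing_open[where f = ?h])
    show "0 \<le> g - x" using True by simp
    fix b :: real assume b: "0 < b" "b < g - x"
    have "(?h has_real_derivative p * (x + b) powr (p - 1) - p * x powr (p - 1) - p * b powr (p - 1)) (at b)"
      using b x by (auto intro!: derivative_eq_intros)
    moreover have "0 \<le> p * (x + b) powr (p - 1) - p * x powr (p - 1) - p * b powr (p - 1)"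
      using powr_superadditive[of "p - 1" x b] p x b
      by (simp flip: right_diff_distrib)
    ultimately show "\<exists>y. (?h has_real_derivative y) (at b) \<and> 0 \<le> y" by blast
  next
    show "continuous_on {0..g - x} ?h"
      using p x by (intro continuous_intros continuous_on_powr') auto
  qed
  then show ?thesis using True by simp
next
  case False
  let ?h = "\<lambda>b. (x - b) powr p + p * x powr (p - 1) * b - b powr p"
  have "?h 0 \<le> ?h (x - g)"
  proof (rule DERIV_nonneg_imp_increasing_open[where f = ?h])
    show "0 \<le> x - g" using False by simp
    fix b :: real assume b: "0 < b" "b < x - g"
    have "(?h has_real_derivative - (p * (x - b) powr (p - 1)) + p * x powr (p - 1) - p * b powr (p - 1)) (at b)"
      using b g by (auto intro!: derivative_eq_intros)
    moreover have "p * ((x - b) powr (p - 1) + b powr (p - 1)) \<le> p * x powr (p - 1)"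
      using powr_superadditive[of "p - 1" "x - b" b] p g b
      by (intro mult_left_mono) auto
    then have "0 \<le> - (p * (x - b) powr (p - 1)) + p * x powr (p - 1) - p * b powr (p - 1)"
      by (simp add: distrib_left)
    ultimately show "\<exists>y. (?h has_real_derivative y) (at b) \<and> 0 \<le> y" by blast
  next
    show "continuous_on {0..x - g} ?h"
      using p x g by (intro continuous_intros continuous_on_powr') auto
  qed
  then show ?thesis using False by (simp add: algebra_simps)
qed

text \<open>Convexity of the power at \<open>x / (1 - t)\<close> and \<open>y / t\<close>. The free
  weight keeps the coefficient of \<open>x powr q\<close> close to one at the price of a large
  coefficient of \<open>y powr q\<close>.\<close>

lemma powr_add_le_weighted:
  fixes x y q t :: real
  assumes q: "1 \<le> q" and xy: "0 \<le> x" "0 \<le> y" and t: "0 < t" "t < 1"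
  shows "(x + y) powr q \<le> (1 - t) powr (1 - q) * x powr q + t powr (1 - q) * y powr q"
proof (cases "x = 0 \<or> y = 0")
  case True
  have "1 \<le> (1 - t) powr (1 - q)" "1 \<le> t powr (1 - q)"
    using powr_mono'[of "1 - q" 0 "1 - t"] powr_mono'[of "1 - q" 0 t] t q by auto
  then show ?thesis
    using True mult_right_mono[of 1 _ "x powr q"] mult_right_mono[of 1 _ "y powr q"] by auto
next
  case False
  then have xy: "0 < x" "0 < y"
    using xy by auto
  have c: "convex_on {0<..} (\<lambda>x::real. x powr q)"
    by (rule powr_convex[OF q])
  have *: "s * (z / s) powr q = s powr (1 - q) * z powr q" if "0 < s" "0 \<le> z" for s z :: real
    using that by (simp add: powr_divide powr_diff)
  have "((1 - t) * (x / (1 - t)) + t * (y / t)) powr q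
      \<le> (1 - t) * (x / (1 - t)) powr q + t * (y / t) powr q"
    using convex_onD[OF c, of t "x / (1 - t)" "y / t"] xy t by simp
  then show ?thesis
    using *[of "1 - t" x] *[of t y] t xy by simp
qed

text \<open>The core of Moser's proof. Here \<open>s1\<close> and \<open>s2\<close> are times,
  \<open>P1\<close> is the energy spent up to \<open>s1\<close> and \<open>P2\<close> the energy
  spent between them. If \<open>s1 - z1 powr q \<le> lam\<close>, then \<open>z1\<close> nearly
  saturates Hoelder, which forces \<open>P1 \<ge> 1 - (p - 1) * lam / s1\<close>. With so little
  energy left, the deficit can stay below \<open>lam\<close> only for a time of order
  \<open>lam\<close>.\<close>

lemma moser_two_points:
  fixes p lam s1 s2 z1 z2 P1 P2 :: real
  defines "q \<equiv> p / (p - 1)" and "M \<equiv> (p - 1) * 2 powr (p - 1)"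
  assumes p: "2 \<le> p" and lam: "0 < lam" and s: "s1 \<le> s2" and z: "0 \<le> z1" "0 \<le> z2"
    and P: "0 \<le> P1" "0 \<le> P2" "P1 + P2 \<le> 1"
    and z1: "z1 \<le> P1 powr (1 / p) * s1 powr (1 / q)"
    and z2: "z2 \<le> z1 + P2 powr (1 / p) * (s2 - s1) powr (1 / q)"
    and F: "s1 - z1 powr q \<le> lam" "s2 - z2 powr q \<le> lam"
    and big: "2 * M * lam \<le> s1"
  shows "s2 - s1 \<le> 4 * (1 + M) * lam"
proof -
  define al where "al = p - 1"
  have al: "1 \<le> al" "q = p / al" "1 - q = - (1 / al)" "p = al + 1"
    using p by (auto simp: al_def q_def field_simps)
  have "q = 1 + 1 / al" using al by (simp add: field_simps)
  moreover have "0 < 1 / al" using al by simp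
  ultimately have q: "1 \<le> q" "0 < q" by linarith+
  have q': "1 / p * q = 1 / al" using al by simp
  have M: "1 \<le> M"
  proof -
    have "1 \<le> (2::real) powr (p - 1)" using p by (intro ge_one_powr_ge_zero) auto
    then show ?thesis using p mult_mono[of 1 "p - 1" 1 "2 powr (p - 1)"] by (simp add: M_def)
  qed
  have "lam \<le> M * lam" "0 < M * lam" using M lam by auto
  then have s1: "0 < s1" "lam \<le> s1 / 2" using big by linarith+
  have "z1 powr q \<le> (P1 powr (1 / p) * s1 powr (1 / q)) powr q"
    using z z1 q by (intro powr_mono2) auto
  also have "\<dots> = P1 powr (1 / al) * s1"
    using q q' s1 P by (simp add: powr_mult powr_powr)
  finally have z1q: "z1 powr q \<le> P1 powr (1 / al) * s1" .
  then have "s1 - lam \<le> P1 powr (1 / al) * s1" using F by simp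
  then have "1 - lam / s1 \<le> P1 powr (1 / al)"
    using s1 by (simp add: field_simps)
  then have "(1 - lam / s1) powr al \<le> (P1 powr (1 / al)) powr al"
    using s1 al by (intro powr_mono2) (auto simp: field_simps)
  also have "\<dots> = P1" using al P by (simp add: powr_powr)
  finally have "(1 - lam / s1) powr al \<le> P1" .
  \<comment> \<open>Bernoulli's inequality, read off from Young's with weights \<open>1 / al\<close>
    and \<open>1 - 1 / al\<close>.\<close>
  moreover have "1 - al * (lam / s1) \<le> (1 - lam / s1) powr al"
  proof -
    let ?x = "lam / s1"
    have x: "0 < ?x" "?x \<le> 1 / 2" using s1 lam by (auto simp: field_simps)
    have "((1 - ?x) powr al) powr (1 / al) * 1 powr (1 - 1 / al)
        \<le> 1 / al * (1 - ?x) powr al + (1 - 1 / al) * 1"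
      using al x by (intro Youngs_inequality_0) auto
    then have "al * (1 - ?x) \<le> al * (1 / al * (1 - ?x) powr al + (1 - 1 / al))"
      using al x by (intro mult_left_mono) (auto simp: powr_powr)
    then show ?thesis using al by (simp add: algebra_simps)
  qed
  ultimately have P2: "P2 \<le> al * (lam / s1)" using P by simp
  define y where "y = P2 powr (1 / p) * (s2 - s1) powr (1 / q)"
  define t where "t = M * lam / s1" \<comment> \<open>with this weight the second term below is at most \<open>(s2 - s1) / 2\<close> and is absorbed\<close>
  have t: "0 < t" "t \<le> 1 / 2" using s1 lam M big by (auto simp: t_def field_simps)
  have "s2 - lam \<le> z2 powr q" using F by simp
  also have "\<dots> \<le> (z1 + y) powr q"
    using z2 z q by (intro powr_mono2) (auto simp: y_def)
  also have "\<dots> \<le> (1 - t) powr (1 - q) * z1 powr q + t powr (1 - q) * y powr q"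
    using t z q by (intro powr_add_le_weighted) (auto simp: y_def)
  also have "(1 - t) powr (1 - q) * z1 powr q \<le> (1 + 2 * t) * s1"
  proof (intro mult_mono)
    have "(1 - t) powr (1 - q) \<le> (1 - t) powr (-1)"
    proof (rule powr_mono')
      have "1 / al \<le> 1" using al(1) by simp
      then show "- 1 \<le> 1 - q" using al(3) by linarith
    qed (use t in auto)
    also have "\<dots> \<le> 1 + 2 * t"
      using t by (simp add: powr_minus_divide field_simps)
    finally show "(1 - t) powr (1 - q) \<le> 1 + 2 * t" .
    have "P1 powr (1 / al) \<le> 1" using P al by (intro powr_le1) auto
    then show "z1 powr q \<le> s1" using z1q s1 by (smt (verit) mult_left_le_one_le powr_ge_zero)
  qed (use t in auto)
  also have "t powr (1 - q) * y powr q \<le> (s2 - s1) / 2"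
  proof -
    have "y powr q = P2 powr (1 / al) * (s2 - s1)"
      using q q' s P by (simp add: y_def powr_mult powr_powr)
    also have "\<dots> \<le> (al * (lam / s1)) powr (1 / al) * (s2 - s1)"
      using P P2 al s by (intro mult_right_mono powr_mono2) auto
    finally have "t powr (1 - q) * y powr q \<le> t powr (1 - q) * ((al * (lam / s1)) powr (1 / al) * (s2 - s1))"
      by (intro mult_left_mono) auto
    also have "\<dots> = (al * (lam / s1) / t) powr (1 / al) * (s2 - s1)"
      using t al lam s1 by (simp add: powr_divide powr_mult powr_minus_divide)
    \<comment> \<open>This quotient fixes the choice \<open>M = al * 2 powr al\<close>: its power
      \<open>1 / al\<close> is exactly one half.\<close>
    also have "al * (lam / s1) / t = 2 powr (- al)"
      using lam s1 al M by (simp add: t_def M_def al_def[symmetric] powr_minus_divide)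
    also have "(2 powr (- al)) powr (1 / al) = (1 / 2 :: real)"
    proof -
      have "- al * (1 / al) = - 1" using al by simp
      then show ?thesis by (simp only: powr_powr) (simp add: powr_minus_divide)
    qed
    finally show ?thesis by simp
  qed
  finally have "s2 - lam \<le> (1 + 2 * t) * s1 + (s2 - s1) / 2" by simp
  moreover have "(1 + 2 * t) * s1 = s1 + 2 * M * lam"
    using s1 by (simp add: t_def field_simps)
  ultimately have *: "s2 - lam \<le> s1 + 2 * (M * lam) + (s2 - s1) / 2" by (simp add: mult.assoc)
  define m where "m = M * lam"
  have "s2 - s1 \<le> 2 * lam + 4 * m"
    using * unfolding m_def[symmetric] by (simp add: field_simps)
  also have "\<dots> \<le> 4 * (1 + M) * lam" using lam by (simp add: m_def algebra_simps)
  finally show ?thesis .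
qed

section \<open>The fundamental theorem of calculus for absolutely continuous functions\<close>

lemma tagged_division_intervalE:
  fixes a b :: real
  assumes "D tagged_division_of {a..b}" "(x, K) \<in> D"
  obtains l u where "K = {l..u}" "l \<le> x" "x \<le> u" "a \<le> l" "u \<le> b"
proof -
  obtain l u where "K = cbox l u"
    using tagged_division_ofD(4)[OF assms] by blast
  moreover have "x \<in> K" "K \<subseteq> {a..b}"
    using tagged_division_ofD(2,3)[OF assms] by auto
  ultimately show thesis
    using that[of l u] by (auto simp: box_real)
qed

text \<open>The intervals of a division meet only in end points, so their lengths add up to the
  measure of the union. This turns a thin open set around a null set into a bound for all intervals
  tagged in the null set.\<close>

lemma sum_content_tagged_subset_le:
  fixes a b :: real
  assumes D: "D tagged_division_of {a..b}" and sub: "E \<subseteq> D"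
    and G: "G \<in> lmeasurable" "\<And>x K. (x, K) \<in> E \<Longrightarrow> K \<subseteq> G"
  shows "(\<Sum>(x, K)\<in>E. measure lborel K) \<le> measure lebesgue G"
proof -
  have fin: "finite E"
    using D sub finite_subset by blast
  have meas: "snd e \<in> lmeasurable" if "e \<in> E" for e
  proof -
    have "(fst e, snd e) \<in> D" using that sub by auto
    then show ?thesis by (rule tagged_division_intervalE[OF D]) simp
  qed
  have "pairwise (\<lambda>e e'. negligible (snd e \<inter> snd e')) E"
  proof (rule pairwiseI)
    fix e e' assume e: "e \<in> E" "e' \<in> E" "e \<noteq> e'"
    obtain x K x' K' where ee: "e = (x, K)" "e' = (x', K')"
      by (cases e, cases e')
    have eD: "(x, K) \<in> D" "(x', K') \<in> D"
      using e ee sub by auto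
    obtain l u where K1: "K = {l..u}"
      by (rule tagged_division_intervalE[OF D eD(1)])
    obtain l' u' where K2: "K' = {l'..u'}"
      by (rule tagged_division_intervalE[OF D eD(2)])
    note K = K1 K2
    have "interior K \<inter> interior K' = {}"
      using tagged_division_ofD(5)[OF D, of x K x' K'] e ee sub by auto
    then have "{l<..<u} \<inter> {l'<..<u'} = {}"
      using K by (simp add: interior_atLeastAtMost_real)
    then have "K \<inter> K' \<subseteq> {l, u, l', u'}"
      using K by (auto simp: disjoint_iff order_le_less)
    then show "negligible (snd e \<inter> snd e')"
      using ee by (auto intro: negligible_subset[of "{l, u, l', u'}"])
  qed
  then have "measure lebesgue (\<Union>(snd ` E)) = (\<Sum>e\<in>E. measure lebesgue (snd e))"
    using fin meas by (intro measure_negligible_finite_Union_image)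
  moreover have "measure lebesgue (\<Union>(snd ` E)) \<le> measure lebesgue G"
  proof (rule measure_mono_fmeasurable[OF _ _ G(1)])
    show "\<Union>(snd ` E) \<subseteq> G" using G(2) by force
    show "\<Union>(snd ` E) \<in> sets lebesgue"
      using fin meas by (intro sets.finite_UN) auto
  qed
  ultimately have "(\<Sum>e\<in>E. measure lebesgue (snd e)) \<le> measure lebesgue G"
    by simp
  moreover have "measure lebesgue (snd e) = measure lborel (snd e)" if "e \<in> E" for e
  proof -
    have "(fst e, snd e) \<in> D" using that sub by auto
    then show ?thesis by (rule tagged_division_intervalE[OF D]) simp
  qed
  ultimately show ?thesis
    by (simp add: case_prod_unfold)
qed

lemma abs_cont_on_tagged_sum:
  fixes a b :: real
  assumes ac: "abs_cont_on a b f" and e: "0 < e"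
  obtains \<delta> where "0 < \<delta>"
    "\<And>D E. D tagged_division_of {a..b} \<Longrightarrow> E \<subseteq> D \<Longrightarrow> (\<Sum>(x, K)\<in>E. measure lborel K) < \<delta> \<Longrightarrow>
       (\<Sum>(x, K)\<in>E. \<bar>f (Sup K) - f (Inf K)\<bar>) < e"
proof -
  from ac[unfolded abs_cont_on_def, rule_format, OF e]
  obtain \<delta> where \<delta>: "0 < \<delta>"
    "\<forall>(n::nat) xs ys. (\<forall>i<n. a \<le> xs i \<and> xs i \<le> ys i \<and> ys i \<le> b) \<and>
       (\<forall>i<n. \<forall>j<n. i \<noteq> j \<longrightarrow> ys i \<le> xs j \<or> ys j \<le> xs i) \<and>
       (\<Sum>i<n. ys i - xs i) < \<delta> \<longrightarrow> (\<Sum>i<n. \<bar>f (ys i) - f (xs i)\<bar>) < e"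
    by (elim exE conjE) (rule that)
  show thesis
  proof (rule that[OF \<delta>(1)])
    fix D E assume D: "D tagged_division_of {a..b}" and sub: "E \<subseteq> D"
      and small: "(\<Sum>(x, K)\<in>E. measure lborel K) < \<delta>"
    \<comment> \<open>Degenerate intervals are dropped before enumerating: their interior is empty,
      so disjoint interiors would not give the ordering demanded by \<open>abs_cont_on\<close>. They
      contribute zero to both sums.\<close>
    define E' where "E' = {e \<in> E. measure lborel (snd e) \<noteq> 0}"
    have fin: "finite E" "finite E'"
      using D sub finite_subset[of E D] unfolding E'_def by auto
    have int: "\<exists>l u. snd e = {l..u} \<and> a \<le> l \<and> l < u \<and> u \<le> b" if "e \<in> E'" for e
    proof -
      have "(fst e, snd e) \<in> D" "measure lborel (snd e) \<noteq> 0"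
        using that sub by (auto simp: E'_def)
      with tagged_division_intervalE[OF D this(1)] show ?thesis
        by (metis content_real_eq_0 linorder_not_le)
    qed
    obtain h where h: "bij_betw h {0..<card E'} E'"
      using ex_bij_betw_nat_finite[OF fin(2)] by blast
    have hE: "h i \<in> E'" if "i < card E'" for i
      using h that by (auto simp: bij_betw_def)
    define xs ys where "xs = (\<lambda>i. Inf (snd (h i)))" and "ys = (\<lambda>i. Sup (snd (h i)))"
    have hi: "snd (h i) = {xs i..ys i} \<and> a \<le> xs i \<and> xs i < ys i \<and> ys i \<le> b" if i: "i < card E'" for i
    proof -
      obtain l u where lu: "snd (h i) = {l..u}" "a \<le> l" "l < u" "u \<le> b"
        using int[OF hE[OF i]] by blast
      then have "xs i = l" "ys i = u" by (simp_all add: xs_def ys_def)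
      with lu show ?thesis by simp
    qed
    have "(\<Sum>i<card E'. \<bar>f (ys i) - f (xs i)\<bar>) < e"
    proof (rule \<delta>(2)[rule_format], intro conjI)
      show "\<forall>i<card E'. a \<le> xs i \<and> xs i \<le> ys i \<and> ys i \<le> b"
        using hi less_imp_le by auto
      show "\<forall>i<card E'. \<forall>j<card E'. i \<noteq> j \<longrightarrow> ys i \<le> xs j \<or> ys j \<le> xs i"
      proof (intro allI impI)
        fix i j assume ij: "i < card E'" "j < card E'" "i \<noteq> j"
        then have "h i \<noteq> h j"
          using h by (auto simp: bij_betw_def inj_on_def)
        then have "interior (snd (h i)) \<inter> interior (snd (h j)) = {}"
          using tagged_division_ofD(5)[OF D, of "fst (h i)" "snd (h i)" "fst (h j)" "snd (h j)"]
            hE ij sub by (auto simp: E'_def)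
        then have "{xs i<..<ys i} \<inter> {xs j<..<ys j} = {}"
          using hi ij by (simp add: interior_atLeastAtMost_real)
        moreover have "xs i < ys i" "xs j < ys j" using hi ij by auto
        ultimately show "ys i \<le> xs j \<or> ys j \<le> xs i"
          using dense[of "max (xs i) (xs j)" "min (ys i) (ys j)"]
          by (force simp: disjoint_iff)
      qed
      have "(\<Sum>i<card E'. ys i - xs i) = (\<Sum>i<card E'. measure lborel (snd (h i)))"
      proof (rule sum.cong)
        fix i assume "i \<in> {..<card E'}"
        then show "ys i - xs i = measure lborel (snd (h i))"
          using hi[of i] by simp
      qed simp
      also have "\<dots> = (\<Sum>e\<in>E'. measure lborel (snd e))"
        using sum.reindex_bij_betw[OF h, of "\<lambda>e. measure lborel (snd e)"] by (simp add: atLeast0LessThan)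
      also have "\<dots> \<le> (\<Sum>e\<in>E. measure lborel (snd e))"
        using fin by (intro sum_mono2) (auto simp: E'_def)
      finally show "(\<Sum>i<card E'. ys i - xs i) < \<delta>"
        using small by (simp add: case_prod_unfold)
    qed
    also have "(\<Sum>i<card E'. \<bar>f (ys i) - f (xs i)\<bar>) = (\<Sum>e\<in>E'. \<bar>f (Sup (snd e)) - f (Inf (snd e))\<bar>)"
      using sum.reindex_bij_betw[OF h, of "\<lambda>e. \<bar>f (Sup (snd e)) - f (Inf (snd e))\<bar>"]
      by (simp add: atLeast0LessThan xs_def ys_def)
    also have "\<dots> = (\<Sum>e\<in>E. \<bar>f (Sup (snd e)) - f (Inf (snd e))\<bar>)"
    proof (rule sum.mono_neutral_left[OF fin(1)])
      show "\<forall>e\<in>E - E'. \<bar>f (Sup (snd e)) - f (Inf (snd e))\<bar> = 0"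
      proof
        fix e assume e: "e \<in> E - E'"
        then have "(fst e, snd e) \<in> D" "measure lborel (snd e) = 0"
          using sub by (auto simp: E'_def)
        moreover obtain l u where "snd e = {l..u}" "l \<le> fst e" "fst e \<le> u"
          by (rule tagged_division_intervalE[OF D \<open>(fst e, snd e) \<in> D\<close>])
        ultimately show "\<bar>f (Sup (snd e)) - f (Inf (snd e))\<bar> = 0"
          by simp
      qed
    qed (auto simp: E'_def)
    finally show "(\<Sum>(x, K)\<in>E. \<bar>f (Sup K) - f (Inf K)\<bar>) < e"
      by (simp add: case_prod_unfold)
  qed
qed

text \<open>A direct gauge argument, so that integrability of \<open>v\<close> is a conclusion. Tags
  outside the null set are handled by the straddle estimate that differentiability gives; intervals
  tagged inside it are forced into a thin open set, where absolute continuity controls the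
  increments of \<open>f\<close>.\<close>

theorem abs_cont_on_has_integral:
  fixes f v :: "real \<Rightarrow> real"
  assumes ab: "a \<le> b" and ac: "abs_cont_on a b f" and N: "negligible N"
    and der: "\<And>x. x \<in> {a<..<b} - N \<Longrightarrow> (f has_real_derivative v x) (at x)"
  shows "(v has_integral f b - f a) {a..b}"
proof -
  \<comment> \<open>The end points join the exceptional set because differentiability is given only
    in the open interval.\<close>
  define M where "M = N \<union> {a, b}"
  define v' where "v' = (\<lambda>x. if x \<in> M then 0 else v x)"
  have M: "negligible M"
    using N by (simp add: M_def)
  have "(v' has_integral f b - f a) {a..b}"
    unfolding has_integral_real
  proof (intro allI impI)
    fix e :: real assume e: "0 < e"
    define \<epsilon> where "\<epsilon> = e / (2 * (b - a + 1))"
    have \<epsilon>: "0 < \<epsilon>" "\<epsilon> * (b - a) < e / 2"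
      using e ab by (auto simp: \<epsilon>_def field_simps)
    obtain \<delta> where \<delta>: "0 < \<delta>"
      "\<And>D E. D tagged_division_of {a..b} \<Longrightarrow> E \<subseteq> D \<Longrightarrow> (\<Sum>(x, K)\<in>E. measure lborel K) < \<delta> \<Longrightarrow>
         (\<Sum>(x, K)\<in>E. \<bar>f (Sup K) - f (Inf K)\<bar>) < e / 2"
      using abs_cont_on_tagged_sum[OF ac, of "e / 2"] e by auto
    obtain G where G: "open G" "M \<subseteq> G" "G \<in> lmeasurable" "measure lebesgue G < \<delta>"
    proof -
      obtain G where G: "open G" "M \<subseteq> G" "G - M \<in> lmeasurable" "emeasure lebesgue (G - M) < ennreal \<delta>"
        using sets_lebesgue_outer_open[of M \<delta>] negligible_imp_sets[OF M] \<delta>(1) by blast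
      have Gu: "(G - M) \<union> M = G" using G(2) by blast
      have "G \<in> lmeasurable"
        using fmeasurable.Un[OF G(3) negligible_imp_measurable[OF M]] Gu by simp
      moreover have "measure lebesgue G = measure lebesgue (G - M)"
        by (rule measure_negligible_symdiff) (use M G(3) in \<open>auto intro: negligible_subset[OF M]\<close>)
      moreover have "measure lebesgue (G - M) < \<delta>"
        using G(3,4) \<delta>(1) by (simp add: emeasure_eq_measure2 ennreal_less_iff)
      ultimately show ?thesis using that G by simp
    qed
    have "\<exists>d>0. \<forall>y. \<bar>y - x\<bar> < d \<longrightarrow> \<bar>f y - f x - v x * (y - x)\<bar> \<le> \<epsilon> * \<bar>y - x\<bar>"
      if "x \<in> {a..b} - M" for x
    proof -
      have "(f has_real_derivative v x) (at x)"
        using that by (intro der) (auto simp: M_def)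
      then show ?thesis
        using \<epsilon>(1) by (auto simp: has_field_derivative_def has_derivative_at_alt mult.commute)
    qed
    then obtain d where d: "\<And>x. x \<in> {a..b} - M \<Longrightarrow> 0 < d x"
      "\<And>x y. x \<in> {a..b} - M \<Longrightarrow> \<bar>y - x\<bar> < d x \<Longrightarrow> \<bar>f y - f x - v x * (y - x)\<bar> \<le> \<epsilon> * \<bar>y - x\<bar>"
      by metis
    define \<gamma> where "\<gamma> = (\<lambda>x. if x \<in> M then G else if x \<in> {a..b} then ball x (d x) else ball x 1)"
    have "gauge \<gamma>"
      using G d(1) by (auto simp: gauge_def \<gamma>_def)
    moreover have "norm ((\<Sum>(x, K)\<in>D. measure lborel K *\<^sub>R v' x) - (f b - f a)) < e"
      if D: "D tagged_division_of {a..b}" and fine: "\<gamma> fine D" for D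
    proof -
      define E where "E = {e \<in> D. fst e \<in> M}"
      have fin: "finite D" using D by blast
      have "(\<Sum>(x, K)\<in>D. f (Sup K) - f (Inf K)) = f b - f a"
        by (rule additive_tagged_division_1[OF ab D])
      then have "\<bar>(\<Sum>(x, K)\<in>D. measure lborel K *\<^sub>R v' x) - (f b - f a)\<bar>
          = \<bar>\<Sum>e\<in>D. measure lborel (snd e) * v' (fst e) - (f (Sup (snd e)) - f (Inf (snd e)))\<bar>"
        by (simp add: case_prod_unfold sum_subtractf)
      also have "\<dots> \<le> (\<Sum>e\<in>D. \<bar>measure lborel (snd e) * v' (fst e) - (f (Sup (snd e)) - f (Inf (snd e)))\<bar>)"
        by (rule sum_abs)
      also have "\<dots> \<le> (\<Sum>e\<in>D. \<epsilon> * measure lborel (snd e) + (if e \<in> E then \<bar>f (Sup (snd e)) - f (Inf (snd e))\<bar> else 0))"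
      proof (rule sum_mono)
        fix e assume eD: "e \<in> D"
        obtain x K where xK: "e = (x, K)" by (cases e)
        obtain l u where K: "K = {l..u}" "l \<le> x" "x \<le> u" "a \<le> l" "u \<le> b"
          using tagged_division_intervalE[OF D, of x K] eD xK by auto
        have K\<gamma>: "K \<subseteq> \<gamma> x"
          using fine eD xK by (auto simp: fine_def)
        show "\<bar>measure lborel (snd e) * v' (fst e) - (f (Sup (snd e)) - f (Inf (snd e)))\<bar>
          \<le> \<epsilon> * measure lborel (snd e) + (if e \<in> E then \<bar>f (Sup (snd e)) - f (Inf (snd e))\<bar> else 0)"
        proof (cases "x \<in> M")
          case True
          then show ?thesis
            using eD xK K \<epsilon>(1) by (simp add: E_def v'_def abs_minus_commute)
        next
          case False
          then have x: "x \<in> {a..b} - M" using K by auto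
          have "l \<in> \<gamma> x" "u \<in> \<gamma> x" using K\<gamma> K by auto
          then have "\<bar>l - x\<bar> < d x" "\<bar>u - x\<bar> < d x"
            using x by (auto simp: \<gamma>_def dist_real_def abs_minus_commute split: if_splits)
          from d(2)[OF x this(1)] d(2)[OF x this(2)]
          have "\<bar>f l - f x - v x * (l - x)\<bar> \<le> \<epsilon> * (x - l)" "\<bar>f u - f x - v x * (u - x)\<bar> \<le> \<epsilon> * (u - x)"
            using K by auto
          then have "\<bar>(u - l) * v x - (f u - f l)\<bar> \<le> \<epsilon> * (u - l)"
            by (simp add: algebra_simps abs_le_iff)
          then show ?thesis
            using xK K False by (simp add: v'_def E_def)
        qed
      qed
      also have "\<dots> = \<epsilon> * (\<Sum>e\<in>D. measure lborel (snd e)) + (\<Sum>e\<in>E. \<bar>f (Sup (snd e)) - f (Inf (snd e))\<bar>)"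
      proof -
        have "D \<inter> {e. e \<in> E} = E" by (auto simp: E_def)
        then show ?thesis
          using fin by (simp add: sum.distrib sum_distrib_left sum.If_cases)
      qed
      also have "(\<Sum>e\<in>D. measure lborel (snd e)) = b - a"
        using additive_content_tagged_division[of D a b] D ab by (simp add: case_prod_unfold box_real)
      also have "(\<Sum>e\<in>E. \<bar>f (Sup (snd e)) - f (Inf (snd e))\<bar>) < e / 2"
      proof -
        have "(\<Sum>(x, K)\<in>E. measure lborel K) \<le> measure lebesgue G"
        proof (rule sum_content_tagged_subset_le[OF D _ G(3)])
          fix x K assume "(x, K) \<in> E"
          then have "K \<subseteq> \<gamma> x" "x \<in> M"
            using fine by (auto simp: E_def fine_def)
          then show "K \<subseteq> G"
            by (simp add: \<gamma>_def)
        qed (auto simp: E_def)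
        then show ?thesis
          using \<delta>(2)[OF D, of E] G(4) by (auto simp: E_def case_prod_unfold)
      qed
      finally show ?thesis
        using \<epsilon>(2) by simp
    qed
    ultimately show "\<exists>\<gamma>. gauge \<gamma> \<and> (\<forall>D. D tagged_division_of {a..b} \<and> \<gamma> fine D \<longrightarrow>
        norm ((\<Sum>(x, K)\<in>D. measure lborel K *\<^sub>R v' x) - (f b - f a)) < e)"
      by (intro exI[of _ \<gamma>]) simp
  qed
  then show ?thesis
    by (rule has_integral_spike[OF M, rotated]) (auto simp: v'_def)
qed

section \<open>The ground state\<close>

text \<open>\<open>c\<close> and \<open>\<kappa>\<close> stand for \<nu> and a number between \<nu>
  and the eigenvalue, both rescaled by the ratio of the two \<open>omega\<close> constants. The
  Poincare inequality is stated for tails of continuous nonnegative slopes, the functions that the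
  iteration produces.\<close>

locale subcritical_weight =
  fixes p R \<theta> c \<kappa> :: real
  assumes p: "2 \<le> p" and R: "0 < R" and \<theta>: "p - 1 \<le> \<theta>" and c: "0 \<le> c" and c_less: "c < \<kappa>"
    and poincare: "\<And>\<psi>. continuous_on {0..R} \<psi> \<Longrightarrow> (\<And>r. r \<in> {0..R} \<Longrightarrow> 0 \<le> \<psi> r) \<Longrightarrow>
      \<kappa> * integral {0..R} (\<lambda>r. r powr \<theta> * integral {r..R} \<psi> powr p)
        \<le> integral {0..R} (\<lambda>r. r powr (p - 1) * \<psi> r powr p)"
begin

text \<open>The flux. For a solution, integrating the equation from the origin, where the flux
  vanishes, gives \<open>mass \<phi> r\<close> as the value of
  \<open>r powr (p - 1) * (- \<phi>') powr (p - 1)\<close>.\<close>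

definition mass :: "(real \<Rightarrow> real) \<Rightarrow> real \<Rightarrow> real" where
  "mass f r = c * integral {0..r} (\<lambda>t. t powr \<theta> * f t powr (p - 1))"

definition slope :: "(real \<Rightarrow> real) \<Rightarrow> real \<Rightarrow> real" where
  "slope f r = mass f r powr (1 / (p - 1)) / r" \<comment> \<open>zero at \<open>r = 0\<close>, where it is in fact continuous\<close>

lemma p_pos: "0 < p" "1 \<le> p - 1" "0 < \<theta>" "0 < p - 1"
  using p \<theta> by auto

lemma exponent_pos: "0 < (\<theta> + 1) / (p - 1) - 1"
  using p_pos \<theta> by (simp add: field_simps)

lemma continuous_on_powr_times:
  assumes "continuous_on S f" "\<And>r. r \<in> S \<Longrightarrow> 0 \<le> f r" "S \<subseteq> {0..}" "0 < a"
  shows "continuous_on S (\<lambda>t. t powr \<theta> * f t powr a)"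
  using assms p_pos
  by (intro continuous_intros continuous_on_powr') auto

context
  fixes f :: "real \<Rightarrow> real"
  assumes f: "continuous_on {0..R} f" "\<And>r. r \<in> {0..R} \<Longrightarrow> 0 \<le> f r"
begin

lemma mass_integrand_continuous: "continuous_on {0..R} (\<lambda>t. t powr \<theta> * f t powr (p - 1))"
  using f p_pos by (intro continuous_on_powr_times) auto

lemma mass_integrand_integrable:
  assumes "{a..b} \<subseteq> {0..R}"
  shows "(\<lambda>t. t powr \<theta> * f t powr (p - 1)) integrable_on {a..b}"
  using continuous_on_subset[OF mass_integrand_continuous assms]
  by (rule integrable_continuous_real)

lemma mass_nonneg:
  assumes "r \<le> R"
  shows "0 \<le> mass f r"
proof -
  have "0 \<le> integral {0..r} (\<lambda>t. t powr \<theta> * f t powr (p - 1))"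
    using assms by (intro integral_nonneg mass_integrand_integrable) auto
  then show ?thesis using c by (simp add: mass_def)
qed

lemma mass_continuous: "continuous_on {0..R} (mass f)"
  unfolding mass_def
  by (intro continuous_intros indefinite_integral_continuous_1 mass_integrand_integrable) auto

lemma mass_deriv:
  assumes "r \<in> {0<..<R}"
  shows "(mass f has_real_derivative c * (r powr \<theta> * f r powr (p - 1))) (at r)"
proof -
  have "((\<lambda>x. integral {0..x} (\<lambda>t. t powr \<theta> * f t powr (p - 1))) has_real_derivative
      r powr \<theta> * f r powr (p - 1)) (at r within {0..R})"
    using assms by (intro integral_has_real_derivative mass_integrand_continuous) auto
  then have "((\<lambda>x. integral {0..x} (\<lambda>t. t powr \<theta> * f t powr (p - 1))) has_real_derivative
      r powr \<theta> * f r powr (p - 1)) (at r)"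
    using at_within_Icc_at[of 0 r R] assms by simp
  from DERIV_cmult[OF this, of c] show ?thesis
    by (simp add: mass_def[abs_def])
qed

lemma slope_nonneg: "0 \<le> r \<Longrightarrow> 0 \<le> slope f r"
  by (simp add: slope_def)

lemma mass_eq: "r \<in> {0<..R} \<Longrightarrow> mass f r = r powr (p - 1) * slope f r powr (p - 1)"
  using mass_nonneg[of r] p_pos by (simp add: slope_def powr_divide powr_powr)

text \<open>The exponent \<open>a\<close> is arbitrary because the bound serves twice: with
  \<open>a = \<theta> + 1\<close> for bounded functions, and with a smaller exponent for functions
  controlled only through an integral.\<close>

lemma slope_bound:
  assumes r: "r \<in> {0..R}" and B: "0 \<le> B" "mass f r \<le> B * r powr a"
  shows "slope f r \<le> B powr (1 / (p - 1)) * r powr (a / (p - 1) - 1)"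
proof (cases "r = 0")
  case False
  then have r': "0 < r" using r by simp
  have "mass f r powr (1 / (p - 1)) \<le> (B * r powr a) powr (1 / (p - 1))"
    using r B mass_nonneg[of r] p_pos by (intro powr_mono2) auto
  also have "\<dots> = B powr (1 / (p - 1)) * r powr (a / (p - 1))"
    using B by (simp add: powr_mult powr_powr)
  finally show ?thesis
    using r' by (simp add: slope_def powr_diff divide_right_mono)
qed (simp add: slope_def)

lemma mass_le_powr:
  assumes B: "\<And>r. r \<in> {0..R} \<Longrightarrow> f r \<le> B" and r: "r \<in> {0..R}"
  shows "mass f r \<le> c * B powr (p - 1) * r powr (\<theta> + 1)"
proof -
  have "integral {0..r} (\<lambda>t. t powr \<theta> * f t powr (p - 1)) \<le> integral {0..r} (\<lambda>t. r powr \<theta> * B powr (p - 1))"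
    using r B f p_pos
    by (intro integral_le mass_integrand_integrable mult_mono powr_mono2) auto
  also have "\<dots> = B powr (p - 1) * r powr (\<theta> + 1)"
    using r by (cases "r = 0") (auto simp: powr_add)
  finally show ?thesis
    using c mult_left_mono[of _ _ c] by (fastforce simp: mass_def mult.assoc)
qed

lemma slope_le:
  assumes B: "\<And>r. r \<in> {0..R} \<Longrightarrow> f r \<le> B" and r: "r \<in> {0..R}"
  shows "slope f r \<le> (c * B powr (p - 1)) powr (1 / (p - 1)) * r powr ((\<theta> + 1) / (p - 1) - 1)"
  using c by (intro slope_bound mass_le_powr B r) auto

lemma slope_continuous: "continuous_on {0..R} (slope f)"
proof -
  obtain B where B: "\<And>r. r \<in> {0..R} \<Longrightarrow> f r \<le> B"
  proof -
    have "bounded (f ` {0..R})"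
      using f(1) by (intro compact_imp_bounded compact_continuous_image) auto
    then show ?thesis
      using that by (fastforce simp: bounded_real abs_le_iff)
  qed
  define K where "K = (c * B powr (p - 1)) powr (1 / (p - 1))"
  have "continuous (at r within {0..R}) (slope f)" if r: "r \<in> {0..R}" for r
  proof (cases "r = 0")
    case True
    \<comment> \<open>The exponent is positive, so the majorant vanishes at 0, in agreement with the
      value that division by zero assigns to \<open>slope f 0\<close>.\<close>
    have lim: "((\<lambda>r. K * r powr ((\<theta> + 1) / (p - 1) - 1)) \<longlongrightarrow> K * 0 powr ((\<theta> + 1) / (p - 1) - 1)) (at 0 within {0..R})"
      using exponent_pos
      by (intro tendsto_intros tendsto_powr') (auto simp: eventually_at_filter)
    have "(slope f \<longlongrightarrow> 0) (at 0 within {0..R})"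
    proof (rule tendsto_sandwich[OF _ _ tendsto_const])
      show "\<forall>\<^sub>F r in at 0 within {0..R}. 0 \<le> slope f r"
        by (auto simp: eventually_at_filter slope_nonneg)
      show "\<forall>\<^sub>F r in at 0 within {0..R}. slope f r \<le> K * r powr ((\<theta> + 1) / (p - 1) - 1)"
        using slope_le[OF B] by (auto simp: eventually_at_filter K_def)
    qed (use lim in simp)
    then show ?thesis
      using True by (simp add: continuous_within slope_def)
  next
    case False
    have "continuous (at r within {0..R}) (mass f)"
      using mass_continuous r continuous_on_eq_continuous_within by blast
    moreover have "(mass f \<longlongrightarrow> mass f r) (at r within {0..R}) \<Longrightarrow>
      ((\<lambda>r. mass f r powr (1 / (p - 1))) \<longlongrightarrow> mass f r powr (1 / (p - 1))) (at r within {0..R})"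
      using p_pos
      by (intro tendsto_powr') (auto simp: eventually_at_filter mass_nonneg)
    ultimately show ?thesis
      using False unfolding continuous_within slope_def
      by (intro tendsto_divide) auto
  qed
  then show ?thesis
    by (simp add: continuous_on_eq_continuous_within)
qed

end

lemma tail_deriv:
  fixes g :: "real \<Rightarrow> real"
  assumes g: "continuous_on {a..R} g" and r: "r \<in> {a<..<R}"
  shows "((\<lambda>r. integral {r..R} g) has_real_derivative - g r) (at r)"
proof -
  have "((\<lambda>r. integral {r..R} g) has_real_derivative - g r) (at r within {a..R})"
    using integral_has_vector_derivative'[OF g, of r] r
    by (simp add: has_real_derivative_iff_has_vector_derivative)
  then show ?thesis
    using at_within_Icc_at[of a r R] r by simp
qed

text \<open>Integrate the derivative of flux times tail. The boundary terms vanish because the flux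
  is zero at 0 and the tail is zero at \<open>R\<close>.\<close>

lemma energy_identity:
  assumes f: "continuous_on {0..R} f" "\<And>r. r \<in> {0..R} \<Longrightarrow> 0 \<le> f r"
  shows "integral {0..R} (\<lambda>r. r powr (p - 1) * slope f r powr p)
    = c * integral {0..R} (\<lambda>r. r powr \<theta> * f r powr (p - 1) * integral {r..R} (slope f))"
proof -
  let ?w = "\<lambda>r. integral {r..R} (slope f)"
  note cs = slope_continuous[OF f]
  have cw: "continuous_on {0..R} ?w"
    by (intro indefinite_integral_continuous_1' integrable_continuous_real cs)
  have "((\<lambda>r. c * (r powr \<theta> * f r powr (p - 1)) * ?w r - slope f r * mass f r) has_integral
      mass f R * ?w R - mass f 0 * ?w 0) {0..R}"
  proof (rule fundamental_theorem_of_calculus_interior)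
    fix r assume r: "r \<in> {0<..<R}"
    have "((\<lambda>r. mass f r * ?w r) has_real_derivative
        mass f r * (- slope f r) + c * (r powr \<theta> * f r powr (p - 1)) * ?w r) (at r)"
      using r by (intro DERIV_mult' mass_deriv[OF f] tail_deriv[OF cs]) auto
    then show "((\<lambda>r. mass f r * ?w r) has_vector_derivative
        c * (r powr \<theta> * f r powr (p - 1)) * ?w r - slope f r * mass f r) (at r)"
      by (simp add: has_real_derivative_iff_has_vector_derivative algebra_simps)
  qed (use R in \<open>auto intro!: continuous_intros mass_continuous[OF f] cw\<close>)
  then have I0: "((\<lambda>r. c * (r powr \<theta> * f r powr (p - 1)) * ?w r - slope f r * mass f r) has_integral 0) {0..R}"
    by (simp add: mass_def)
  have I1: "(\<lambda>r. slope f r * mass f r) integrable_on {0..R}"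
    by (intro integrable_continuous_real continuous_intros cs mass_continuous[OF f])
  have I2: "((\<lambda>r. c * (r powr \<theta> * f r powr (p - 1)) * ?w r) has_integral
      integral {0..R} (\<lambda>r. slope f r * mass f r)) {0..R}"
    using has_integral_add[OF I0 integrable_integral[OF I1]] by simp
  have "slope f r * mass f r = r powr (p - 1) * slope f r powr p" if "r \<in> {0..R}" for r
  proof (cases "r = 0")
    case False
    then have "slope f r * mass f r = r powr (p - 1) * (slope f r * slope f r powr (p - 1))"
      using that mass_eq[OF f, of r] by simp
    also have "slope f r * slope f r powr (p - 1) = slope f r powr p"
      using slope_nonneg[OF f, of r] that
      by (cases "slope f r = 0") (auto simp: powr_mult_base)
    finally show ?thesis .
  qed (simp add: slope_def)
  then have "integral {0..R} (\<lambda>r. r powr (p - 1) * slope f r powr p) = integral {0..R} (\<lambda>r. slope f r * mass f r)"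
    by (intro integral_cong) simp
  also have "\<dots> = integral {0..R} (\<lambda>r. c * (r powr \<theta> * f r powr (p - 1)) * ?w r)"
    using I2 by (simp add: integral_unique)
  also have "\<dots> = c * integral {0..R} (\<lambda>r. r powr \<theta> * f r powr (p - 1) * ?w r)"
    by (simp add: mult.assoc)
  finally show ?thesis .
qed

end

text \<open>The coefficient of \<open>w powr p\<close> can be chosen as close to one as desired, so
  a strict inequality between constants survives the addition of 1. Either
  \<open>1 + w \<le> b * w\<close>, or \<open>w\<close> lies below a constant.\<close>

lemma powr_one_add_le:
  fixes w b p :: real
  assumes "1 < b" "0 \<le> w" "0 \<le> p"
  shows "(1 + w) powr p \<le> b powr p * w powr p + (1 + 1 / (b - 1)) powr p"
proof (cases "1 \<le> (b - 1) * w")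
  case True
  then have "1 + w \<le> b * w" by (simp add: algebra_simps)
  then have "(1 + w) powr p \<le> (b * w) powr p"
    using assms by (intro powr_mono2) auto
  also have "\<dots> = b powr p * w powr p" using assms by (simp add: powr_mult)
  finally show ?thesis by (simp add: add_increasing2)
next
  case False
  then have "w \<le> 1 / (b - 1)" using assms by (simp add: field_simps)
  then have "(1 + w) powr p \<le> (1 + 1 / (b - 1)) powr p"
    using assms by (intro powr_mono2) auto
  then show ?thesis by (simp add: add_increasing)
qed

lemma exists_powr_factor:
  fixes c \<kappa> p :: real
  assumes "0 \<le> c" "c < \<kappa>" "0 < p"
  obtains b where "1 < b" "c * b powr p < \<kappa>"
proof (cases "c = 0")
  case True
  then show ?thesis using that[of 2] assms by simp
next
  case False
  then have c: "0 < c" using assms by simp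
  define b where "b = ((c + \<kappa>) / (2 * c)) powr (1 / p)"
  have "1 < (c + \<kappa>) / (2 * c)" using c assms by (simp add: field_simps)
  then have "1 powr (1 / p) < b"
    unfolding b_def using assms by (intro powr_less_mono2) auto
  moreover have "c * b powr p < \<kappa>"
    using c assms by (simp add: b_def powr_powr field_simps)
  ultimately show ?thesis using that by simp
qed

section \<open>Monotone iteration for the ground state\<close>

context subcritical_weight
begin

text \<open>Picard iteration for the integral form of the equation, with the value 1 at
  \<open>R\<close> built in. The constant 1 is a subsolution, so the sequence increases.\<close>

primrec iterate :: "nat \<Rightarrow> real \<Rightarrow> real" where
  "iterate 0 = (\<lambda>r. 1)"
| "iterate (Suc n) = (\<lambda>r. 1 + integral {r..R} (slope (iterate n)))"

lemma slope_mono: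
  assumes f: "continuous_on {0..R} f" "\<And>r. r \<in> {0..R} \<Longrightarrow> 0 \<le> f r"
    and g: "continuous_on {0..R} g" "\<And>r. r \<in> {0..R} \<Longrightarrow> 0 \<le> g r"
    and le: "\<And>r. r \<in> {0..R} \<Longrightarrow> f r \<le> g r" and r: "r \<in> {0..R}"
  shows "slope f r \<le> slope g r"
proof -
  have "mass f r \<le> mass g r"
    unfolding mass_def using c r f g le p_pos
    by (intro mult_left_mono integral_le mass_integrand_integrable powr_mono2) auto
  then show ?thesis
    unfolding slope_def using r p_pos mass_nonneg[OF f, of r]
    by (intro divide_right_mono powr_mono2) auto
qed

lemma tail_slope:
  assumes f: "continuous_on {0..R} f" "\<And>r. r \<in> {0..R} \<Longrightarrow> 0 \<le> f r"
  shows "continuous_on {0..R} (\<lambda>r. integral {r..R} (slope f))"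
    and "r \<in> {0..R} \<Longrightarrow> 0 \<le> integral {r..R} (slope f)"
    and "r \<in> {0..R} \<Longrightarrow> slope f integrable_on {r..R}"
proof -
  show I: "slope f integrable_on {r..R}" if "r \<in> {0..R}" for r
    using that by (intro integrable_continuous_real continuous_on_subset[OF slope_continuous[OF f]]) auto
  show "continuous_on {0..R} (\<lambda>r. integral {r..R} (slope f))"
    using I[of 0] R by (intro indefinite_integral_continuous_1') auto
  show "0 \<le> integral {r..R} (slope f)" if "r \<in> {0..R}"
    using that I[OF that] by (intro integral_nonneg slope_nonneg[OF f]) auto
qed

lemma iterate_cont: "continuous_on {0..R} (iterate n)"
  and iterate_ge_1: "r \<in> {0..R} \<Longrightarrow> 1 \<le> iterate n r"
proof -
  have "continuous_on {0..R} (iterate n) \<and> (\<forall>r\<in>{0..R}. 1 \<le> iterate n r)"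
  proof (induction n)
    case (Suc n)
    then have "continuous_on {0..R} (iterate n)" "\<And>r. r \<in> {0..R} \<Longrightarrow> 0 \<le> iterate n r"
      by fastforce+
    from tail_slope[OF this] show ?case
      by (auto intro!: continuous_intros)
  qed simp
  then show "continuous_on {0..R} (iterate n)" "r \<in> {0..R} \<Longrightarrow> 1 \<le> iterate n r"
    by auto
qed

lemma iterate_nonneg: "r \<in> {0..R} \<Longrightarrow> 0 \<le> iterate n r"
  using iterate_ge_1[of r n] by simp

lemmas iterate_ok = iterate_cont iterate_nonneg

lemma iterate_slope_integrable:
  assumes "r \<in> {0..R}" shows "slope (iterate n) integrable_on {r..R}"
  by (rule tail_slope(3)[OF _ _ assms]) (simp_all only: iterate_ok)

lemma iterate_tail:
  shows "continuous_on {0..R} (\<lambda>r. integral {r..R} (slope (iterate n)))"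
    and "r \<in> {0..R} \<Longrightarrow> 0 \<le> integral {r..R} (slope (iterate n))"
  by (rule tail_slope; simp only: iterate_ok)+

lemma iterate_le_Suc: "r \<in> {0..R} \<Longrightarrow> iterate n r \<le> iterate (Suc n) r"
proof (induction n arbitrary: r)
  case 0
  then show ?case using iterate_tail(2)[of r 0] by simp
next
  case (Suc n)
  have "integral {r..R} (slope (iterate n)) \<le> integral {r..R} (slope (iterate (Suc n)))"
    using Suc iterate_slope_integrable[of r]
    by (intro integral_le slope_mono iterate_ok) (auto simp del: iterate.simps)
  then show ?case by simp
qed

text \<open>Let \<open>w\<close> be the next iterate minus 1. Poincare and the energy identity bound
  \<open>\<kappa>\<close> times the integral of \<open>r powr \<theta> * w powr p\<close> by
  \<open>c\<close> times that of \<open>r powr \<theta> * iterate n r powr (p - 1) * w\<close>. As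
  the iterates increase, the latter integrand is at most
  \<open>r powr \<theta> * (1 + w) powr p\<close>; hence the estimate closes for each
  \<open>n\<close> separately, and \<open>c * b powr p < \<kappa>\<close> absorbs the leading
  term.\<close>

lemma iterate_norm_bounded:
  obtains N where "0 \<le> N" "\<And>n. integral {0..R} (\<lambda>r. r powr \<theta> * iterate n r powr p) \<le> N"
proof -
  obtain b where b: "1 < b" "c * b powr p < \<kappa>"
    using exists_powr_factor[OF c c_less p_pos(1)] .
  define d where "d = (1 + 1 / (b - 1)) powr p"
  define T where "T = integral {0..R} (\<lambda>r. r powr \<theta>)"
  \<comment> \<open>What remains on the right for the integral of
    \<open>r powr \<theta> * w powr p\<close> after the absorption.\<close>
  define X where "X = c * (d * T) / (\<kappa> - c * b powr p)"
  have "continuous_on {0..R} (\<lambda>r. r powr \<theta>)"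
    using p_pos by (intro continuous_on_powr' continuous_on_id continuous_on_const) auto
  then have Ti: "(\<lambda>r. r powr \<theta>) integrable_on {0..R}"
    by (rule integrable_continuous_real)
  then have T: "0 \<le> T"
    unfolding T_def by (intro integral_nonneg) auto
  have d: "1 \<le> d" using b p_pos unfolding d_def by (intro ge_one_powr_ge_zero) auto
  have X0: "0 \<le> X" using b d T c by (simp add: X_def)
  have step: "integral {0..R} (\<lambda>r. r powr \<theta> * iterate (Suc n) r powr p) \<le> b powr p * X + d * T" for n
  proof -
    let ?w = "\<lambda>r. integral {r..R} (slope (iterate n))"
    note w = iterate_tail[where n = n]
    have I1: "(\<lambda>r. r powr \<theta> * ?w r powr p) integrable_on {0..R}"
      using w p_pos by (intro integrable_continuous_real continuous_on_powr_times) auto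
    have I2: "(\<lambda>r. r powr \<theta> * iterate (Suc n) r powr p) integrable_on {0..R}"
      using p_pos by (intro integrable_continuous_real continuous_on_powr_times iterate_ok) auto
    have I3: "(\<lambda>r. r powr \<theta> * iterate n r powr (p - 1) * ?w r) integrable_on {0..R}"
      using p_pos by (intro integrable_continuous_real continuous_intros w continuous_on_powr_times iterate_ok) auto
    have I4: "(\<lambda>r. b powr p * (r powr \<theta> * ?w r powr p) + d * r powr \<theta>) integrable_on {0..R}"
      using I1 Ti by (intro integrable_add integrable_on_mult_right) auto
    have "integral {0..R} (\<lambda>r. r powr \<theta> * iterate (Suc n) r powr p)
      \<le> integral {0..R} (\<lambda>r. b powr p * (r powr \<theta> * ?w r powr p) + d * r powr \<theta>)"
    proof (rule integral_le[OF I2 I4])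
      fix r assume r: "r \<in> {0..R}"
      have "r powr \<theta> * (1 + ?w r) powr p \<le> r powr \<theta> * (b powr p * ?w r powr p + d)"
        using powr_one_add_le[OF b(1), of "?w r" p] w(2)[OF r] p_pos
        by (intro mult_left_mono) (auto simp: d_def)
      then show "r powr \<theta> * iterate (Suc n) r powr p \<le> b powr p * (r powr \<theta> * ?w r powr p) + d * r powr \<theta>"
        by (simp add: algebra_simps)
    qed
    also have "\<dots> = b powr p * integral {0..R} (\<lambda>r. r powr \<theta> * ?w r powr p) + d * T"
      using I1 Ti by (simp add: integral_add integrable_on_mult_right T_def)
    finally have E: "integral {0..R} (\<lambda>r. r powr \<theta> * iterate (Suc n) r powr p) \<le> \<dots>" .
    have "\<kappa> * integral {0..R} (\<lambda>r. r powr \<theta> * ?w r powr p) \<le> integral {0..R} (\<lambda>r. r powr (p - 1) * slope (iterate n) r powr p)"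
      by (intro poincare slope_continuous slope_nonneg iterate_ok) auto
    also have "\<dots> = c * integral {0..R} (\<lambda>r. r powr \<theta> * iterate n r powr (p - 1) * ?w r)"
      by (rule energy_identity[OF iterate_ok])
    also have "\<dots> \<le> c * integral {0..R} (\<lambda>r. r powr \<theta> * iterate (Suc n) r powr p)"
    proof (intro mult_left_mono integral_le I2 I3 c)
      fix r assume r: "r \<in> {0..R}"
      have "iterate n r powr (p - 1) * ?w r \<le> iterate (Suc n) r powr (p - 1) * iterate (Suc n) r"
        using iterate_le_Suc[OF r, of n] iterate_nonneg[OF r] w(2)[OF r] p_pos
        by (intro mult_mono powr_mono2) auto
      also have "\<dots> = iterate (Suc n) r powr p"
        using iterate_ge_1[OF r, of "Suc n"] powr_mult_base[of "iterate (Suc n) r" "p - 1"]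
        by (simp add: mult.commute del: iterate.simps)
      finally show "r powr \<theta> * iterate n r powr (p - 1) * ?w r \<le> r powr \<theta> * iterate (Suc n) r powr p"
        by (simp add: mult.assoc mult_left_mono del: iterate.simps)
    qed
    also have "\<dots> \<le> c * (b powr p * integral {0..R} (\<lambda>r. r powr \<theta> * ?w r powr p) + d * T)"
      using E c by (intro mult_left_mono)
    finally have "(\<kappa> - c * b powr p) * integral {0..R} (\<lambda>r. r powr \<theta> * ?w r powr p) \<le> c * (d * T)"
      by (simp add: algebra_simps)
    then have "integral {0..R} (\<lambda>r. r powr \<theta> * ?w r powr p) \<le> X"
      using b by (simp add: X_def pos_le_divide_eq mult.commute)
    then have "b powr p * integral {0..R} (\<lambda>r. r powr \<theta> * ?w r powr p) \<le> b powr p * X"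
      by (intro mult_left_mono) auto
    with E show ?thesis by linarith
  qed
  show thesis
  proof (rule that)
    show "0 \<le> b powr p * X + d * T" using X0 d T by simp
    show "integral {0..R} (\<lambda>r. r powr \<theta> * iterate n r powr p) \<le> b powr p * X + d * T" for n
    proof (cases n)
      case 0
      have "T \<le> d * T" using d T mult_right_mono[of 1 d T] by simp
      moreover have "0 \<le> b powr p * X" using X0 by simp
      ultimately show ?thesis using 0 by (simp add: T_def)
    next
      case (Suc m)
      then show ?thesis using step[of m] by simp
    qed
  qed
qed

text \<open>One bootstrap from the integral bound to a supremum bound: the flux is at most a
  multiple of a positive power of \<open>r\<close>, hence the slope at most a multiple of an
  integrable one.\<close>

lemma iterate_bounded:
  obtains B where "1 \<le> B" "\<And>n r. r \<in> {0..R} \<Longrightarrow> iterate n r \<le> B"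
proof -
  obtain N where N: "0 \<le> N" "\<And>n. integral {0..R} (\<lambda>r. r powr \<theta> * iterate n r powr p) \<le> N"
    using iterate_norm_bounded by blast
  \<comment> \<open>The exponent that Hoelder would give. It satisfies
    \<open>\<theta> + 1 - \<gamma> * (p - 1) = \<gamma>\<close>, so both parts of the splitting
    below are of order \<open>r powr \<gamma>\<close>.\<close>
  define \<gamma> where "\<gamma> = (\<theta> + 1) / p"
  define A where "A = (c * (1 + N)) powr (1 / (p - 1))"
  define \<delta> where "\<delta> = \<gamma> / (p - 1)"
  have \<gamma>: "0 < \<gamma>" "\<theta> + 1 - \<gamma> * (p - 1) = \<gamma>"
    using p_pos by (auto simp: \<gamma>_def field_simps)
  have \<delta>: "0 < \<delta>" using \<gamma> p_pos by (simp add: \<delta>_def)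
  have mass_le: "mass (iterate n) r \<le> c * (1 + N) * r powr \<gamma>" if r: "r \<in> {0..R}" for n r
  proof (cases "r = 0")
    case False
    then have r0: "0 < r" using r by simp
    define K where "K = r powr (- \<gamma>)" \<comment> \<open>splitting at height \<open>K\<close> replaces Hoelder\<close>
    have K: "0 < K" using r0 by (simp add: K_def)
    have I1: "(\<lambda>t. t powr \<theta> * iterate n t powr p) integrable_on {0..r}"
      using p_pos r by (intro integrable_continuous_real continuous_on_powr_times
          continuous_on_subset[OF iterate_cont] iterate_nonneg) auto
    have I2: "(\<lambda>t. r powr \<theta> * K powr (p - 1) + (t powr \<theta> * iterate n t powr p) / K) integrable_on {0..r}"
      using integrable_on_divide[OF I1] by (intro integrable_add) auto
    have "integral {0..r} (\<lambda>t. t powr \<theta> * iterate n t powr (p - 1))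
      \<le> integral {0..r} (\<lambda>t. r powr \<theta> * K powr (p - 1) + (t powr \<theta> * iterate n t powr p) / K)"
    proof (rule integral_le[OF mass_integrand_integrable[OF iterate_ok] I2])
      fix t assume t: "t \<in> {0..r}"
      then have tR: "t \<in> {0..R}" using r by auto
      let ?f = "iterate n t"
      have f1: "0 < ?f" using iterate_ge_1[OF tR, of n] by simp
      have *: "?f powr (p - 1) \<le> K powr (p - 1) + ?f powr p / K"
      proof (cases "?f \<le> K")
        case True
        then have "?f powr (p - 1) \<le> K powr (p - 1)" using f1 p_pos by (intro powr_mono2) auto
        then show ?thesis using K by (simp add: add_increasing2)
      next
        case False
        have "?f powr (p - 1) * K \<le> ?f powr (p - 1) * ?f"
          using False by (intro mult_left_mono) auto
        also have "\<dots> = ?f powr p"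
          using f1 powr_mult_base[of ?f "p - 1"] by (simp add: mult.commute)
        finally show ?thesis using K by (simp add: pos_le_divide_eq add_increasing)
      qed
      have "t powr \<theta> * ?f powr (p - 1) \<le> t powr \<theta> * K powr (p - 1) + t powr \<theta> * (?f powr p / K)"
        using mult_left_mono[OF *, of "t powr \<theta>"] by (simp add: distrib_left)
      also have "\<dots> \<le> r powr \<theta> * K powr (p - 1) + t powr \<theta> * (?f powr p / K)"
        using t p_pos by (intro add_right_mono mult_right_mono powr_mono2) auto
      finally show "t powr \<theta> * ?f powr (p - 1) \<le> r powr \<theta> * K powr (p - 1) + (t powr \<theta> * ?f powr p) / K"
        by simp
    qed (use r in auto)
    also have "\<dots> = r * (r powr \<theta> * K powr (p - 1)) + integral {0..r} (\<lambda>t. t powr \<theta> * iterate n t powr p) / K"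
      using integrable_on_divide[OF I1, of K] r0 by (subst integral_add) auto
    also have "\<dots> \<le> r powr \<gamma> + N / K"
    proof (rule add_mono)
      have "r * (r powr \<theta> * K powr (p - 1)) = r powr 1 * (r powr \<theta> * r powr (- \<gamma> * (p - 1)))"
        unfolding K_def powr_powr using r0 by simp
      also have "\<dots> = r powr (1 + (\<theta> + - \<gamma> * (p - 1)))"
        by (simp only: powr_add)
      also have "1 + (\<theta> + - \<gamma> * (p - 1)) = \<gamma>"
        using \<gamma>(2) by simp
      finally show "r * (r powr \<theta> * K powr (p - 1)) \<le> r powr \<gamma>" by simp
      have I0: "(\<lambda>t. t powr \<theta> * iterate n t powr p) integrable_on {0..R}"
        using p_pos by (intro integrable_continuous_real continuous_on_powr_times iterate_ok) auto
      have "integral {0..r} (\<lambda>t. t powr \<theta> * iterate n t powr p) \<le> N"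
        using r by (intro order_trans[OF integral_subset_le N(2)] I1 I0) auto
      then show "integral {0..r} (\<lambda>t. t powr \<theta> * iterate n t powr p) / K \<le> N / K"
        using K by (intro divide_right_mono) auto
    qed
    also have "\<dots> = (1 + N) * r powr \<gamma>"
      using r0 by (simp add: K_def powr_minus_divide algebra_simps)
    finally show ?thesis
      using c mult_left_mono[of _ _ c] by (fastforce simp: mass_def mult.assoc)
  qed (simp add: mass_def)
  have slope_le': "slope (iterate n) r \<le> A * r powr (\<delta> - 1)" if r: "r \<in> {0..R}" for n r
    unfolding A_def \<delta>_def using c N by (intro slope_bound[OF iterate_ok] mass_le r) auto
  define B where "B = 1 + A * (R powr \<delta> / \<delta>)"
  have B: "1 \<le> B" using \<delta> by (simp add: B_def A_def)
  \<comment> \<open>The exponent \<open>\<delta> - 1\<close> may be negative but exceeds -1, so the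
    majorant is integrable up to the origin.\<close>
  have Ip: "((\<lambda>r. A * r powr (\<delta> - 1)) has_integral A * (R powr \<delta> / \<delta>)) {0..R}"
    using has_integral_mult_right[OF has_integral_powr_from_0[of "\<delta> - 1" R], of A] \<delta> R by simp
  have "iterate n r \<le> B" if r: "r \<in> {0..R}" for n r
  proof (cases n)
    case 0
    then show ?thesis using B by simp
  next
    case (Suc m)
    have "integral {r..R} (slope (iterate m)) \<le> integral {0..R} (slope (iterate m))"
      using iterate_slope_integrable[of r] iterate_slope_integrable[of 0] r R slope_nonneg[OF iterate_ok]
      by (intro integral_subset_le) auto
    also have "\<dots> \<le> integral {0..R} (\<lambda>r. A * r powr (\<delta> - 1))"
      using iterate_slope_integrable[of 0] R Ip slope_le'
      by (intro integral_le) auto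
    also have "\<dots> = A * (R powr \<delta> / \<delta>)"
      using Ip by (rule integral_unique)
    finally show ?thesis using Suc by (simp add: B_def)
  qed
  then show thesis using that B by blast
qed

theorem exists_ground_state:
  obtains \<phi> where "continuous_on {0..R} \<phi>" "\<And>r. r \<in> {0..R} \<Longrightarrow> 1 \<le> \<phi> r"
    "\<And>r. r \<in> {0..R} \<Longrightarrow> \<phi> r = 1 + integral {r..R} (slope \<phi>)"
proof -
  obtain B where B: "1 \<le> B" "\<And>n r. r \<in> {0..R} \<Longrightarrow> iterate n r \<le> B"
    using iterate_bounded by blast
  define \<phi> where "\<phi> = (\<lambda>r. SUP n. iterate n r)"
  have lim: "(\<lambda>n. iterate n r) \<longlonglongrightarrow> \<phi> r" if "r \<in> {0..R}" for r
    unfolding \<phi>_def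
  proof (rule LIMSEQ_incseq_SUP)
    show "bdd_above (range (\<lambda>n. iterate n r))" using B(2)[OF that] by (auto simp: bdd_above_def)
    show "incseq (\<lambda>n. iterate n r)" using iterate_le_Suc[OF that] by (intro incseq_SucI)
  qed
  have ge1: "1 \<le> \<phi> r" if "r \<in> {0..R}" for r
    using lim[OF that] iterate_ge_1[OF that] by (intro LIMSEQ_le_const) auto
  have lim_mass: "(\<lambda>n. mass (iterate n) r) \<longlonglongrightarrow> mass \<phi> r" if r: "r \<in> {0..R}" for r
  proof -
    have "(\<lambda>n. integral {0..r} (\<lambda>t. t powr \<theta> * iterate n t powr (p - 1)))
        \<longlonglongrightarrow> integral {0..r} (\<lambda>t. t powr \<theta> * \<phi> t powr (p - 1))"
    proof (rule dominated_convergence(2)[where h = "\<lambda>t. R powr \<theta> * B powr (p - 1)"])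
      fix n t assume t: "t \<in> {0..r}"
      then have tR: "t \<in> {0..R}" using r by simp
      show "norm (t powr \<theta> * iterate n t powr (p - 1)) \<le> R powr \<theta> * B powr (p - 1)"
        using t r p_pos B(2)[OF tR] iterate_nonneg[OF tR]
        by (auto simp: abs_mult intro!: mult_mono powr_mono2)
    next
      fix t assume t: "t \<in> {0..r}"
      then show "(\<lambda>n. t powr \<theta> * iterate n t powr (p - 1)) \<longlonglongrightarrow> t powr \<theta> * \<phi> t powr (p - 1)"
        using r ge1[of t] by (intro tendsto_intros lim) auto
    qed (use r in \<open>auto intro!: mass_integrand_integrable iterate_ok\<close>)
    then show ?thesis unfolding mass_def by (intro tendsto_intros)
  qed
  have lim_slope: "(\<lambda>n. slope (iterate n) r) \<longlonglongrightarrow> slope \<phi> r" if r: "r \<in> {0..R}" for r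
  proof (cases "r = 0")
    case False
    then show ?thesis
      unfolding slope_def using p_pos r mass_nonneg[OF iterate_ok]
      by (intro tendsto_divide tendsto_powr' lim_mass tendsto_const) auto
  qed (simp add: slope_def)
  define h where "h = (c * B powr (p - 1)) powr (1 / (p - 1)) * R powr ((\<theta> + 1) / (p - 1) - 1)"
  have le_h: "norm (slope (iterate n) r) \<le> h" if r: "r \<in> {0..R}" for n r
  proof -
    have "slope (iterate n) r \<le> (c * B powr (p - 1)) powr (1 / (p - 1)) * r powr ((\<theta> + 1) / (p - 1) - 1)"
      using B by (intro slope_le[OF iterate_ok] r) auto
    also have "\<dots> \<le> h"
      unfolding h_def using r exponent_pos by (intro mult_left_mono powr_mono2) auto
    finally show ?thesis using slope_nonneg[OF iterate_ok, of r n] r by simp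
  qed
  \<comment> \<open>The limit is not yet known to be continuous, so \<open>slope_continuous\<close>
    does not apply; dominated convergence supplies integrability together with the limit.\<close>
  have int: "slope \<phi> integrable_on {r..R}"
    and lim_tail: "(\<lambda>n. integral {r..R} (slope (iterate n))) \<longlonglongrightarrow> integral {r..R} (slope \<phi>)"
    if r: "r \<in> {0..R}" for r
  proof -
    have 1: "slope (iterate n) integrable_on {r..R}" for n
      using r by (rule iterate_slope_integrable)
    have 2: "(\<lambda>_. h) integrable_on {r..R}" by (rule integrable_const_ivl)
    have 3: "norm (slope (iterate n) t) \<le> h" if "t \<in> {r..R}" for n t
      using that r by (intro le_h) auto
    have 4: "(\<lambda>n. slope (iterate n) t) \<longlonglongrightarrow> slope \<phi> t" if "t \<in> {r..R}" for t
      using that r by (intro lim_slope) auto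
    show "slope \<phi> integrable_on {r..R}"
      by (rule dominated_convergence(1)[OF 1 2 3 4])
    show "(\<lambda>n. integral {r..R} (slope (iterate n))) \<longlonglongrightarrow> integral {r..R} (slope \<phi>)"
      by (rule dominated_convergence(2)[OF 1 2 3 4])
  qed
  have eq: "\<phi> r = 1 + integral {r..R} (slope \<phi>)" if r: "r \<in> {0..R}" for r
  proof (rule LIMSEQ_unique)
    show "(\<lambda>n. iterate (Suc n) r) \<longlonglongrightarrow> \<phi> r"
      using lim[OF r] by (rule LIMSEQ_Suc)
    show "(\<lambda>n. iterate (Suc n) r) \<longlonglongrightarrow> 1 + integral {r..R} (slope \<phi>)"
      using lim_tail[OF r] by (auto intro!: tendsto_intros)
  qed
  \<comment> \<open>Continuity of the limit comes from the fixed point equation, whose right-hand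
    side is an indefinite integral.\<close>
  have "continuous_on {0..R} (\<lambda>r. 1 + integral {r..R} (slope \<phi>))"
    using int[of 0] R by (intro continuous_intros indefinite_integral_continuous_1') auto
  then have "continuous_on {0..R} \<phi>"
    by (rule continuous_on_eq) (rule eq[symmetric])
  then show thesis using that ge1 eq by blast
qed

end

section \<open>Picone's inequality\<close>

text \<open>Optimising over \<open>k\<close> recovers Hoelder's product form from a family of Young
  inequalities. The family is the form that can be integrated and passed to limits, being linear in
  \<open>P\<close> and \<open>S\<close>.\<close>

lemma powr_product_le_of_young:
  fixes x P S p q :: real
  assumes p: "1 < p" and q: "1 / p + 1 / q = 1" and nn: "0 \<le> P" "0 < S"
    and le: "\<And>k. 0 < k \<Longrightarrow> x \<le> k powr p / p * P + k powr (- q) / q * S"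
  shows "x \<le> P powr (1 / p) * S powr (1 / q)"
proof (cases "P = 0")
  case True
  have q1: "1 < q"
  proof -
    have "0 < 1 / p" "1 / p < 1" using p by simp_all
    with q have "0 < 1 / q" "1 / q < 1" by linarith+
    then show ?thesis by (simp add: field_simps split: if_splits)
  qed
  have "x \<le> 0"
  proof (rule ccontr)
    assume "\<not> x \<le> 0"
    then have x: "0 < x" by simp
    \<comment> \<open>For \<open>P = 0\<close> there is no optimal \<open>k\<close>; this one leaves
      the bound \<open>x / q\<close>, which is smaller than a positive \<open>x\<close>.\<close>
    have "((S / x) powr (1 / q)) powr (- q) = x / S"
      using x nn q1 by (simp add: powr_powr powr_minus_divide)
    then have "x \<le> x / q"
      using le[of "(S / x) powr (1 / q)"] x nn True by simp
    then show False using x q1 by (simp add: field_simps)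
  qed
  then show ?thesis using True by simp
next
  case False
  then have P: "0 < P" using nn by simp
  have q0: "q \<noteq> 0" using q p by auto
  \<comment> \<open>The balancing choice: it makes \<open>k powr p * P\<close> equal to
    \<open>k powr (- q) * S\<close>, because \<open>p + q = p * q\<close>.\<close>
  define k where "k = (S / P) powr (1 / (p * q))"
  have k: "0 < k" using P nn by (simp add: k_def)
  have "k powr p = (S / P) powr (1 / q)" using p by (simp add: k_def powr_powr)
  then have "k powr p * P = S powr (1 / q) * (P powr (- 1 / q) * P powr 1)"
    using P nn by (simp add: powr_divide powr_minus_divide)
  also have "P powr (- 1 / q) * P powr 1 = P powr (1 / p)"
  proof -
    have "- 1 / q + 1 = 1 / p" using q by simp
    then show ?thesis by (simp only: powr_add[symmetric])
  qed
  finally have 1: "k powr p * P = P powr (1 / p) * S powr (1 / q)" by (simp only: mult.commute)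
  have "k powr (- q) = (S / P) powr (- (1 / p))" using q0 by (simp add: k_def powr_powr)
  then have "k powr (- q) * S = P powr (1 / p) * (S powr (- (1 / p)) * S powr 1)"
    using P nn by (simp add: powr_divide powr_minus_divide)
  also have "S powr (- (1 / p)) * S powr 1 = S powr (1 / q)"
  proof -
    have "- (1 / p) + 1 = 1 / q" using q by simp
    then show ?thesis by (simp only: powr_add[symmetric])
  qed
  finally have 2: "k powr (- q) * S = P powr (1 / p) * S powr (1 / q)" .
  have "x \<le> (k powr p * P) / p + (k powr (- q) * S) / q"
    using le[OF k] by simp
  also have "\<dots> = P powr (1 / p) * S powr (1 / q) * (1 / p + 1 / q)"
    unfolding 1 2 by (simp add: distrib_left)
  finally show ?thesis using q by simp
qed

locale ground_state = subcritical_weight +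
  fixes \<phi> :: "real \<Rightarrow> real"
  assumes \<phi>_cont: "continuous_on {0..R} \<phi>" and \<phi>_ge_1: "\<And>r. r \<in> {0..R} \<Longrightarrow> 1 \<le> \<phi> r"
    and \<phi>_eq: "\<And>r. r \<in> {0..R} \<Longrightarrow> \<phi> r = 1 + integral {r..R} (slope \<phi>)"
begin

abbreviation "q \<equiv> p / (p - 1)"

lemma q_props: "1 < q" "1 / p + 1 / q = 1" "0 < q" "(p - 1) / p * q = 1"
  using p_pos by (auto simp: field_simps)

lemma \<phi>_nonneg: "r \<in> {0..R} \<Longrightarrow> 0 \<le> \<phi> r"
  using \<phi>_ge_1[of r] by simp

lemmas \<phi>_ok = \<phi>_cont \<phi>_nonneg

lemma \<phi>_deriv:
  assumes r: "r \<in> {0<..<R}"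
  shows "(\<phi> has_real_derivative - slope \<phi> r) (at r)"
proof -
  have "((\<lambda>r. 1 + integral {r..R} (slope \<phi>)) has_real_derivative 0 + - slope \<phi> r) (at r)"
    by (intro DERIV_add DERIV_const tail_deriv[OF slope_continuous[OF \<phi>_ok] r])
  then have "(\<phi> has_real_derivative 0 + - slope \<phi> r) (at r)"
    by (rule has_field_derivative_transform_within_open[of _ _ _ "{0<..<R}"])
      (use r in \<open>auto intro!: \<phi>_eq[symmetric]\<close>)
  then show ?thesis by simp
qed

definition tail :: "(real \<Rightarrow> real) \<Rightarrow> real \<Rightarrow> real" where
  "tail g r = integral {r..R} g"

definition ratio :: "(real \<Rightarrow> real) \<Rightarrow> real \<Rightarrow> real" where
  "ratio g r = tail g r / \<phi> r"

text \<open>Picone's boundary term: the flux of \<phi> times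
  \<open>U powr p / \<phi> powr (p - 1)\<close>, written with \<open>z = U / \<phi>\<close>.\<close>

definition bdry :: "(real \<Rightarrow> real) \<Rightarrow> real \<Rightarrow> real" where
  "bdry g r = mass \<phi> r * \<phi> r * ratio g r powr p"

text \<open>The boundary terms are included so that the quantity dominates the weighted energy of
  \<open>z\<close> on every interval and is additive over adjacent ones.\<close>

definition excess :: "(real \<Rightarrow> real) \<Rightarrow> real \<Rightarrow> real \<Rightarrow> real" where
  "excess g r s = integral {r..s} (\<lambda>t. t powr (p - 1) * g t powr p)
     - c * integral {r..s} (\<lambda>t. t powr \<theta> * tail g t powr p) + (bdry g s - bdry g r)"

text \<open>The density is the power \<open>- 1 / (p - 1)\<close> of the energy weight
  \<open>t powr (p - 1) * \<phi> t powr p\<close>.\<close>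

definition clock :: "real \<Rightarrow> real \<Rightarrow> real" where
  "clock r s = integral {r..s} (\<lambda>t. \<phi> t powr (- q) / t)"

text \<open>\<open>\<zeta>\<close> is the value of \<open>- z'\<close>, and the bracket is the
  derivative of \<open>bdry\<close>. Apply \<open>picone_pointwise\<close> with
  \<open>x = slope \<phi> r * z\<close> and multiply by \<open>r powr (p - 1)\<close>: the flux
  identity turns the lower order terms into part of that derivative, and the equation for \<phi>
  makes its remaining term cancel the potential.\<close>

lemma picone_pointwise_weighted:
  assumes r: "r \<in> {0<..R}" and U: "0 \<le> U" and g: "0 \<le> g"
  defines "z \<equiv> U / \<phi> r" and "\<zeta> \<equiv> (g - slope \<phi> r * (U / \<phi> r)) / \<phi> r"
  shows "r powr (p - 1) * \<phi> r powr p * \<bar>\<zeta>\<bar> powr p \<le>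
    r powr (p - 1) * g powr p - c * (r powr \<theta> * U powr p)
    + (c * (r powr \<theta> * \<phi> r powr (p - 1)) * \<phi> r * z powr p - mass \<phi> r * slope \<phi> r * z powr p
       - mass \<phi> r * \<phi> r * (p * z powr (p - 1) * \<zeta>))"
proof -
  let ?x = "slope \<phi> r * z"
  have \<phi>: "0 < \<phi> r" using \<phi>_ge_1[of r] r by simp
  have z: "0 \<le> z" using U \<phi> by (simp add: z_def)
  have s: "0 \<le> slope \<phi> r" using slope_nonneg[OF \<phi>_ok, of r] r by simp
  have J: "mass \<phi> r = r powr (p - 1) * slope \<phi> r powr (p - 1)"
    using mass_eq[OF \<phi>_ok r] by simp
  have gz: "g - ?x = \<phi> r * \<zeta>" using \<phi> by (simp add: \<zeta>_def z_def)
  have U': "c * (r powr \<theta> * \<phi> r powr (p - 1)) * \<phi> r * z powr p = c * (r powr \<theta> * U powr p)"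
  proof -
    have "\<phi> r powr (p - 1) * \<phi> r * z powr p = \<phi> r powr p * z powr p"
      using \<phi> powr_mult_base[of "\<phi> r" "p - 1"] by (simp add: mult.commute)
    also have "\<dots> = U powr p" using \<phi> U by (simp add: z_def powr_divide)
    finally show ?thesis by (simp add: mult.assoc)
  qed
  have x1: "?x powr (p - 1) = slope \<phi> r powr (p - 1) * z powr (p - 1)"
    using s z by (simp add: powr_mult)
  have x2: "?x powr p = slope \<phi> r * slope \<phi> r powr (p - 1) * z powr p"
    using s z powr_mult_base[of "slope \<phi> r" "p - 1"] by (simp add: powr_mult)
  have "?x powr p + p * ?x powr (p - 1) * (g - ?x) + \<bar>g - ?x\<bar> powr p \<le> g powr p"
    using p s z g by (intro picone_pointwise) auto
  then have "r powr (p - 1) * (?x powr p + p * ?x powr (p - 1) * (g - ?x) + \<bar>g - ?x\<bar> powr p) \<le> r powr (p - 1) * g powr p"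
    by (intro mult_left_mono) auto
  moreover have "\<bar>g - ?x\<bar> powr p = \<phi> r powr p * \<bar>\<zeta>\<bar> powr p"
    using \<phi> by (simp add: gz abs_mult powr_mult)
  ultimately show ?thesis
    unfolding U' J x1 x2 gz by (simp add: algebra_simps)
qed

lemma young_weighted:
  assumes r: "r \<in> {0<..R}" and k: "0 < k"
  shows "\<zeta> \<le> k powr p / p * (r powr (p - 1) * \<phi> r powr p * \<bar>\<zeta>\<bar> powr p) + k powr (- q) / q * (\<phi> r powr (- q) / r)"
proof -
  have \<phi>: "0 < \<phi> r" using \<phi>_ge_1[of r] r by simp
  \<comment> \<open>\<open>m powr p\<close> is \<open>k powr p\<close> times the energy weight, and
    \<open>m powr (- q)\<close> is \<open>k powr (- q)\<close> times the clock density.\<close>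
  define m where "m = k * \<phi> r * r powr ((p - 1) / p)"
  have m: "0 < m" using k \<phi> r by (simp add: m_def)
  have "\<zeta> \<le> (m * \<bar>\<zeta>\<bar>) * (1 / m)" using m by simp
  also have "\<dots> \<le> (m * \<bar>\<zeta>\<bar>) powr p / p + (1 / m) powr q / q"
    using m q_props p_pos by (intro Youngs_inequality) auto
  also have "(m * \<bar>\<zeta>\<bar>) powr p = k powr p * (r powr (p - 1) * \<phi> r powr p * \<bar>\<zeta>\<bar> powr p)"
    using k \<phi> r p_pos by (simp add: m_def powr_mult powr_powr)
  also have "(1 / m) powr q = k powr (- q) * (\<phi> r powr (- q) / r)"
  proof -
    have "(1 / m) powr q = m powr (- q)" using m by (simp add: powr_divide powr_minus_divide)
    also have "\<dots> = k powr (- q) * \<phi> r powr (- q) * r powr ((p - 1) / p * (- q))"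
      using k \<phi> r by (simp only: m_def powr_mult powr_powr)
    also have "(p - 1) / p * (- q) = - 1" using q_props(4) by simp
    finally show ?thesis using r by (simp add: powr_minus_divide)
  qed
  finally show ?thesis by (simp add: mult_ac)
qed

lemma clock_integrand_continuous: "0 < a \<Longrightarrow> continuous_on {a..R} (\<lambda>t. \<phi> t powr (- q) / t)"
proof (intro continuous_on_divide continuous_on_powr continuous_on_const continuous_on_id ballI)
  assume a: "0 < a"
  then show "continuous_on {a..R} \<phi>"
    by (intro continuous_on_subset[OF \<phi>_cont]) auto
  show "\<phi> t \<noteq> 0" if "t \<in> {a..R}" for t
    using \<phi>_ge_1[of t] that a by auto
qed auto

text \<open>Integrate the pointwise Picone inequality, and combine it with Young for the second
  claim. Continuity of \<open>g\<close> gives classical derivatives inside the interval; positivity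
  keeps the tail positive there, as the power rule for \<open>ratio g powr p\<close>
  requires.\<close>

lemma increment_bound_continuous:
  assumes r: "0 < r" "r < s" "s \<le> R" and g: "continuous_on {r..R} g" "\<And>t. t \<in> {r..R} \<Longrightarrow> 0 < g t"
  shows "0 \<le> excess g r s"
    and "0 < k \<Longrightarrow> ratio g r - ratio g s \<le> k powr p / p * excess g r s + k powr (- q) / q * clock r s"
proof -
  have sub: "{r..s} \<subseteq> {r..R}" "{r..R} \<subseteq> {0..R}" using r by auto
  have sub0: "{r..s} \<subseteq> {0..R}" using r by auto
  note [continuous_intros] = continuous_on_subset[OF \<phi>_cont sub0]
    continuous_on_subset[OF mass_continuous[OF \<phi>_ok] sub0] continuous_on_subset[OF slope_continuous[OF \<phi>_ok] sub0]
    continuous_on_subset[OF g(1) sub(1)]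
  have gi: "g integrable_on {x..R}" if "r \<le> x" for x
    using that by (intro integrable_continuous_real continuous_on_subset[OF g(1)]) auto
  have tail_c: "continuous_on {r..s} (tail g)"
    using gi[of r] unfolding tail_def
    by (intro continuous_on_subset[OF indefinite_integral_continuous_1' sub(1)]) auto
  have \<phi>0: "0 < \<phi> t" if "t \<in> {r..s}" for t using \<phi>_ge_1[of t] that r by simp
  have tail0: "0 \<le> tail g t" if "t \<in> {r..s}" for t
    unfolding tail_def using gi that g(2) by (intro integral_nonneg) (auto intro: less_imp_le)
  have tail_pos: "0 < tail g t" if t: "t \<in> {r<..<s}" for t
  proof -
    have "tail g t \<noteq> 0"
    proof
      assume "tail g t = 0"
      then have "(g has_integral 0) (cbox t R)"
        using integrable_integral[OF gi[of t]] t by (simp add: tail_def box_real)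
      moreover have "continuous_on (cbox t R) g"
        using t by (intro continuous_on_subset[OF g(1)]) (auto simp: box_real)
      moreover have "0 \<le> g x" if "x \<in> cbox t R" for x
        using that g(2)[of x] t by (simp add: box_real)
      ultimately have "g t = 0"
        using t r by (intro has_integral_0_cbox_imp_0[of t R g t]) (auto simp: box_real)
      then show False using g(2)[of t] t r by simp
    qed
    then show ?thesis using tail0[of t] t by simp
  qed
  have ratio_c: "continuous_on {r..s} (ratio g)"
    unfolding ratio_def using \<phi>0 by (intro continuous_intros tail_c) force
  have ratio0: "0 \<le> ratio g t" if "t \<in> {r..s}" for t
    unfolding ratio_def using tail0[OF that] \<phi>0[OF that] by simp
  have bdry_c: "continuous_on {r..s} (bdry g)"
    unfolding bdry_def using ratio0 p_pos
    by (intro continuous_intros continuous_on_powr' ratio_c) auto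
  define \<zeta> where "\<zeta> = (\<lambda>t. (g t - slope \<phi> t * (tail g t / \<phi> t)) / \<phi> t)"
  define D where "D = (\<lambda>t. c * (t powr \<theta> * \<phi> t powr (p - 1)) * \<phi> t * ratio g t powr p
      - mass \<phi> t * slope \<phi> t * ratio g t powr p - mass \<phi> t * \<phi> t * (p * ratio g t powr (p - 1) * \<zeta> t))"
  have tail_d: "(tail g has_real_derivative - g t) (at t)" if "t \<in> {r<..<s}" for t
    unfolding tail_def using that r by (intro tail_deriv[OF g(1)]) auto
  have ratio_d: "(ratio g has_real_derivative - \<zeta> t) (at t)" if t: "t \<in> {r<..<s}" for t
  proof -
    have "((\<lambda>t. tail g t / \<phi> t) has_real_derivative (- g t * \<phi> t - tail g t * (- slope \<phi> t)) / (\<phi> t * \<phi> t)) (at t)"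
      using t r \<phi>0[of t] by (intro DERIV_divide tail_d \<phi>_deriv) auto
    moreover have "(- g t * \<phi> t - tail g t * (- slope \<phi> t)) / (\<phi> t * \<phi> t) = - \<zeta> t"
      using \<phi>0[of t] t by (simp add: \<zeta>_def field_simps)
    ultimately show ?thesis by (simp add: ratio_def[abs_def])
  qed
  have bdry_d: "(bdry g has_real_derivative D t) (at t)" if t: "t \<in> {r<..<s}" for t
  proof -
    have z: "0 < ratio g t" using tail_pos[OF t] \<phi>0[of t] t by (simp add: ratio_def)
    have "((\<lambda>t. ratio g t powr p) has_real_derivative p * ratio g t powr (p - 1) * (- \<zeta> t)) (at t)"
      using DERIV_fun_powr[OF ratio_d[OF t] z, of p] by simp
    then have "((\<lambda>t. mass \<phi> t * \<phi> t * ratio g t powr p) has_real_derivative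
       mass \<phi> t * \<phi> t * (p * ratio g t powr (p - 1) * (- \<zeta> t)) +
       (mass \<phi> t * (- slope \<phi> t) + c * (t powr \<theta> * \<phi> t powr (p - 1)) * \<phi> t) * ratio g t powr p) (at t)"
      using t r by (intro DERIV_mult' \<phi>_deriv mass_deriv[OF \<phi>_ok]) auto
    then show ?thesis
      by (simp add: bdry_def[abs_def] D_def algebra_simps)
  qed
  have ID: "(D has_integral bdry g s - bdry g r) {r..s}"
    using r bdry_d by (intro fundamental_theorem_of_calculus_interior bdry_c)
      (auto simp: has_real_derivative_iff_has_vector_derivative)
  have I\<zeta>: "(\<zeta> has_integral ratio g r - ratio g s) {r..s}"
  proof -
    have "((\<lambda>t. - \<zeta> t) has_integral ratio g s - ratio g r) {r..s}"
      using r ratio_d by (intro fundamental_theorem_of_calculus_interior ratio_c)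
        (auto simp: has_real_derivative_iff_has_vector_derivative)
    from has_integral_neg[OF this] show ?thesis by simp
  qed
  have I1: "(\<lambda>t. t powr (p - 1) * g t powr p) integrable_on {r..s}"
    using r g p_pos sub by (intro integrable_continuous_real continuous_intros continuous_on_powr') (auto intro: less_imp_le)
  have I2: "(\<lambda>t. t powr \<theta> * tail g t powr p) integrable_on {r..s}"
    using r tail0 p_pos by (intro integrable_continuous_real continuous_on_powr_times tail_c) auto
  have I3: "(\<lambda>t. \<phi> t powr (- q) / t) integrable_on {r..s}"
    using r by (intro integrable_continuous_real continuous_on_subset[OF clock_integrand_continuous[of r]]) auto
  let ?e = "\<lambda>t. t powr (p - 1) * g t powr p - c * (t powr \<theta> * tail g t powr p) + D t"
  have Ie: "(?e has_integral excess g r s) {r..s}"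
    unfolding excess_def
    by (intro has_integral_add has_integral_diff has_integral_mult_right integrable_integral I1 I2 ID)
  have le: "t powr (p - 1) * \<phi> t powr p * \<bar>\<zeta> t\<bar> powr p \<le> ?e t" if t: "t \<in> {r..s}" for t
    unfolding D_def \<zeta>_def ratio_def
    using t r tail0[OF t] g(2)[of t] by (intro picone_pointwise_weighted) auto
  show "0 \<le> excess g r s"
  proof (rule has_integral_nonneg[OF Ie])
    fix t assume t: "t \<in> {r..s}"
    have "0 \<le> t powr (p - 1) * \<phi> t powr p * \<bar>\<zeta> t\<bar> powr p" by simp
    with le[OF t] show "0 \<le> ?e t" by linarith
  qed
  show "ratio g r - ratio g s \<le> k powr p / p * excess g r s + k powr (- q) / q * clock r s" if k: "0 < k"
  proof (rule has_integral_le[OF I\<zeta>])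
    show "((\<lambda>t. k powr p / p * ?e t + k powr (- q) / q * (\<phi> t powr (- q) / t)) has_integral
        k powr p / p * excess g r s + k powr (- q) / q * clock r s) {r..s}"
      unfolding clock_def
      by (intro has_integral_add has_integral_mult_right integrable_integral I3 Ie)
    fix t assume t: "t \<in> {r..s}"
    have "\<zeta> t \<le> k powr p / p * (t powr (p - 1) * \<phi> t powr p * \<bar>\<zeta> t\<bar> powr p) + k powr (- q) / q * (\<phi> t powr (- q) / t)"
      using t r k by (intro young_weighted) auto
    also have "\<dots> \<le> k powr p / p * ?e t + k powr (- q) / q * (\<phi> t powr (- q) / t)"
      using le[OF t] p_pos by (intro add_right_mono mult_left_mono) auto
    finally show "\<zeta> t \<le> k powr p / p * ?e t + k powr (- q) / q * (\<phi> t powr (- q) / t)" .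
  qed
qed

end

section \<open>Extension of the increment estimate to measurable slopes\<close>

lemma dominated_convergence_negligible:
  fixes f :: "nat \<Rightarrow> real \<Rightarrow> real"
  assumes f: "\<And>k. f k integrable_on S" and h: "h integrable_on S" and N: "negligible N"
    and le: "\<And>k x. x \<in> S - N \<Longrightarrow> \<bar>f k x\<bar> \<le> h x"
    and conv: "\<And>x. x \<in> S - N \<Longrightarrow> (\<lambda>k. f k x) \<longlonglongrightarrow> g x"
  shows "g integrable_on S" "(\<lambda>k. integral S (f k)) \<longlonglongrightarrow> integral S g"
proof -
  let ?r = "\<lambda>f x. if x \<in> N then 0 else f x :: real"
  have 1: "?r (f k) integrable_on S" for k
    by (rule integrable_spike[OF f N]) auto
  have 2: "?r h integrable_on S"
    by (rule integrable_spike[OF h N]) auto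
  have 3: "norm (?r (f k) x) \<le> ?r h x" if "x \<in> S" for k x
    using le that by auto
  have 4: "(\<lambda>k. ?r (f k) x) \<longlonglongrightarrow> ?r g x" if "x \<in> S" for x
    using conv that by auto
  note dc = dominated_convergence[OF 1 2 3 4]
  show "g integrable_on S"
    by (rule integrable_spike[OF dc(1) N]) auto
  have "integral S (?r (f k)) = integral S (f k)" for k
    by (rule integral_spike[OF N]) auto
  moreover have "integral S (?r g) = integral S g"
    by (rule integral_spike[OF N]) auto
  ultimately show "(\<lambda>k. integral S (f k)) \<longlonglongrightarrow> integral S g"
    using dc(2) by simp
qed

lemma borel_integrable_on_bounded:
  fixes f h :: "real \<Rightarrow> real"
  assumes f: "f \<in> borel_measurable borel" and h: "h integrable_on {a..b}"
    and le: "\<And>x. x \<in> {a..b} \<Longrightarrow> \<bar>f x\<bar> \<le> h x"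
  shows "f integrable_on {a..b}"
proof -
  have "f \<in> borel_measurable (lebesgue_on {a..b})"
    using f by (intro measurable_restrict_space1 measurable_completion) simp
  then show ?thesis
    using h le by (intro measurable_bounded_by_integrable_imp_integrable_real[of f _ h]) auto
qed

context ground_state
begin

text \<open>Each inequality is affine in \<open>excess\<close>, so the property passes to limits.
  The product form is extracted only at the end.\<close>

definition increment_bound :: "(real \<Rightarrow> real) \<Rightarrow> real \<Rightarrow> real \<Rightarrow> bool" where
  "increment_bound g r s \<longleftrightarrow> 0 \<le> excess g r s \<and>
    (\<forall>k>0. ratio g r - ratio g s \<le> k powr p / p * excess g r s + k powr (- q) / q * clock r s)"

text \<open>Every ingredient of \<open>excess\<close> and \<open>ratio\<close> converges by
  dominated convergence: \<open>h\<close> dominates the slopes, and its integral over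
  \<open>{r..R}\<close> dominates all tails.\<close>

lemma increment_bound_limit:
  assumes r: "0 < r" "r < s" "s \<le> R" and bound: "\<And>n. increment_bound (f n) r s"
    and f: "\<And>n. f n integrable_on {r..R}"
    and fp: "\<And>n. (\<lambda>t. t powr (p - 1) * f n t powr p) integrable_on {r..R}"
    and h: "h integrable_on {r..R}" "(\<lambda>t. t powr (p - 1) * h t powr p) integrable_on {r..R}"
    and N: "negligible N"
    and le: "\<And>n t. t \<in> {r..R} - N \<Longrightarrow> 0 \<le> f n t \<and> f n t \<le> h t"
    and conv: "\<And>t. t \<in> {r..R} - N \<Longrightarrow> (\<lambda>n. f n t) \<longlonglongrightarrow> g t"
  shows "increment_bound g r s"
proof -
  have sub_int: "u integrable_on {a..b}" if "u integrable_on {r..R}" "r \<le> a" "b \<le> R" for u :: "real \<Rightarrow> real" and a b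
    by (rule integrable_subinterval_real[OF that(1)]) (use that(2,3) in auto)
  have tail_lim: "(\<lambda>n. tail (f n) t) \<longlonglongrightarrow> tail g t" if t: "t \<in> {r..R}" for t
    unfolding tail_def
  proof (rule dominated_convergence_negligible(2)[OF _ _ N])
    show "f n integrable_on {t..R}" for n using t by (intro sub_int[OF f]) auto
    show "h integrable_on {t..R}" using t by (intro sub_int[OF h(1)]) auto
    fix x assume "x \<in> {t..R} - N"
    then have x: "x \<in> {r..R} - N" using t by auto
    show "\<bar>f n x\<bar> \<le> h x" for n using le[OF x, of n] by simp
    show "(\<lambda>n. f n x) \<longlonglongrightarrow> g x" by (rule conv[OF x])
  qed
  have h_nonneg: "0 \<le> h t" if "t \<in> {r..R} - N" for t
    using le[OF that, of 0] by linarith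
  define M where "M = integral {r..R} h"
  have tail_nonneg: "0 \<le> tail (f n) t" if t: "t \<in> {r..R}" for n t
  proof -
    have "integral {t..R} (\<lambda>x. if x \<in> N then 0 else f n x) = tail (f n) t"
      unfolding tail_def by (rule integral_spike[OF N]) auto
    moreover have "(\<lambda>x. if x \<in> N then 0 else f n x) integrable_on {t..R}"
      using t by (intro integrable_spike[OF sub_int[OF f] N]) auto
    then have "0 \<le> integral {t..R} (\<lambda>x. if x \<in> N then 0 else f n x)"
      using t le by (intro integral_nonneg) auto
    ultimately show ?thesis by simp
  qed
  have tail_le: "tail (f n) t \<le> M" if t: "t \<in> {r..R}" for n t
  proof -
    have "integral {t..R} (\<lambda>x. if x \<in> N then 0 else f n x) = tail (f n) t"
      unfolding tail_def by (rule integral_spike[OF N]) auto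
    moreover have "integral {r..R} (\<lambda>x. if x \<in> N then 0 else h x) = M"
      unfolding M_def by (rule integral_spike[OF N]) auto
    moreover have "integral {t..R} (\<lambda>x. if x \<in> N then 0 else f n x) \<le> integral {t..R} (\<lambda>x. if x \<in> N then 0 else h x)"
      using t le by (intro integral_le integrable_spike[OF sub_int[OF f] N] integrable_spike[OF sub_int[OF h(1)] N]) auto
    moreover have "integral {t..R} (\<lambda>x. if x \<in> N then 0 else h x) \<le> integral {r..R} (\<lambda>x. if x \<in> N then 0 else h x)"
      using t h_nonneg
      by (intro integral_subset_le integrable_spike[OF sub_int[OF h(1)] N]) auto
    ultimately show ?thesis by simp
  qed
  have tail_cont: "continuous_on {r..R} (tail (f n))" for n
    unfolding tail_def by (intro indefinite_integral_continuous_1' f)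
  have "(\<lambda>n. integral {r..s} (\<lambda>t. t powr (p - 1) * f n t powr p)) \<longlonglongrightarrow> integral {r..s} (\<lambda>t. t powr (p - 1) * g t powr p)"
  proof (rule dominated_convergence_negligible(2)[OF _ _ N])
    show "(\<lambda>t. t powr (p - 1) * f n t powr p) integrable_on {r..s}" for n
      using r by (intro sub_int[OF fp]) auto
    show "(\<lambda>t. t powr (p - 1) * h t powr p) integrable_on {r..s}"
      using r by (intro sub_int[OF h(2)]) auto
    fix t assume "t \<in> {r..s} - N"
    then have t: "t \<in> {r..R} - N" using r by auto
    show "\<bar>t powr (p - 1) * f n t powr p\<bar> \<le> t powr (p - 1) * h t powr p" for n
      using le[OF t, of n] p_pos by (auto simp: abs_mult intro!: mult_left_mono powr_mono2)
    show "(\<lambda>n. t powr (p - 1) * f n t powr p) \<longlonglongrightarrow> t powr (p - 1) * g t powr p"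
      using le[OF t] p_pos by (intro tendsto_mult tendsto_const tendsto_powr' conv t) auto
  qed
  moreover have "(\<lambda>n. integral {r..s} (\<lambda>t. t powr \<theta> * tail (f n) t powr p)) \<longlonglongrightarrow> integral {r..s} (\<lambda>t. t powr \<theta> * tail g t powr p)"
  proof (rule dominated_convergence_negligible(2)[OF _ _ negligible_empty])
    show "(\<lambda>t. t powr \<theta> * tail (f n) t powr p) integrable_on {r..s}" for n
      using r p_pos tail_nonneg
      by (intro integrable_continuous_real continuous_on_powr_times continuous_on_subset[OF tail_cont]) auto
    show "(\<lambda>t. R powr \<theta> * M powr p) integrable_on {r..s}" by (rule integrable_const_ivl)
    fix t assume "t \<in> {r..s} - {}"
    then have t: "t \<in> {r..R}" "0 \<le> t" "t \<le> R" using r by auto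
    show "\<bar>t powr \<theta> * tail (f n) t powr p\<bar> \<le> R powr \<theta> * M powr p" for n
      using t tail_nonneg[OF t(1), of n] tail_le[OF t(1), of n] p_pos
      by (auto simp: abs_mult intro!: mult_mono powr_mono2)
    show "(\<lambda>n. t powr \<theta> * tail (f n) t powr p) \<longlonglongrightarrow> t powr \<theta> * tail g t powr p"
      using tail_nonneg[OF t(1)] p_pos by (intro tendsto_mult tendsto_const tendsto_powr' tail_lim t) auto
  qed
  moreover have ratio_lim: "(\<lambda>n. ratio (f n) t) \<longlonglongrightarrow> ratio g t" if t: "t \<in> {r..R}" for t
    unfolding ratio_def using t r \<phi>_ge_1[of t] by (intro tendsto_divide tail_lim tendsto_const) auto
  moreover have bdry_lim: "(\<lambda>n. bdry (f n) t) \<longlonglongrightarrow> bdry g t" if t: "t \<in> {r..R}" for t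
  proof -
    have "0 \<le> ratio (f n) t" for n
      using t r \<phi>_ge_1[of t] tail_nonneg[OF t, of n] by (simp add: ratio_def)
    then show ?thesis
      unfolding bdry_def using p_pos by (intro tendsto_mult tendsto_const tendsto_powr' ratio_lim t) auto
  qed
  ultimately have ex_lim: "(\<lambda>n. excess (f n) r s) \<longlonglongrightarrow> excess g r s"
    unfolding excess_def using r by (intro tendsto_intros) auto
  have "0 \<le> excess g r s"
    using ex_lim bound by (intro LIMSEQ_le_const) (auto simp: increment_bound_def)
  moreover have "ratio g r - ratio g s \<le> k powr p / p * excess g r s + k powr (- q) / q * clock r s" if k: "0 < k" for k
  proof (rule LIMSEQ_le)
    show "(\<lambda>n. ratio (f n) r - ratio (f n) s) \<longlonglongrightarrow> ratio g r - ratio g s"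
      using r by (intro tendsto_diff ratio_lim) auto
    show "(\<lambda>n. k powr p / p * excess (f n) r s + k powr (- q) / q * clock r s)
        \<longlonglongrightarrow> k powr p / p * excess g r s + k powr (- q) / q * clock r s"
      by (intro tendsto_add tendsto_mult tendsto_const ex_lim)
  qed (use bound k in \<open>auto simp: increment_bound_def\<close>)
  ultimately show ?thesis by (simp add: increment_bound_def)
qed

text \<open>A measurable function is almost everywhere a limit of continuous ones. Clamping these
  from above by \<open>M\<close> and from below by \<open>1 / Suc n\<close> makes them positive and
  uniformly bounded, as the continuous case and the limit lemma demand.\<close>

lemma increment_bound_bounded:
  assumes r: "0 < r" "r < s" "s \<le> R" and g: "g \<in> borel_measurable borel" and bd: "\<And>t. 0 \<le> g t \<and> g t \<le> M"
  shows "increment_bound g r s"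
proof -
  have "g measurable_on {r..R}"
    using g by (intro lebesgue_measurable_imp_measurable_on measurable_completion) auto
  then obtain N G where N: "negligible N" and G: "\<And>n. continuous_on UNIV (G n)"
    and lim: "\<And>x. x \<notin> N \<Longrightarrow> (\<lambda>n. G n x) \<longlonglongrightarrow> (if x \<in> {r..R} then g x else 0)"
    unfolding measurable_on_def by blast
  define f where "f = (\<lambda>n t. max (1 / Suc n) (min M (G n t)))"
  have M: "0 \<le> M" using bd[of 0] by linarith
  have fc: "continuous_on {r..R} (f n)" for n
    unfolding f_def
    by (intro continuous_on_max continuous_on_min continuous_on_const continuous_on_subset[OF G]) auto
  have f_pos: "0 < f n t" for n t
    by (simp add: f_def less_max_iff_disj)
  have f_le: "f n t \<le> M + 1" for n t
    using M by (auto simp: f_def field_simps)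
  have f_lim: "(\<lambda>n. f n t) \<longlonglongrightarrow> g t" if "t \<in> {r..R} - N" for t
  proof -
    have "(\<lambda>n. f n t) \<longlonglongrightarrow> max 0 (min M (g t))"
      unfolding f_def using lim[of t] that
      by (intro tendsto_max tendsto_min tendsto_const) (auto intro: LIMSEQ_Suc lim_inverse_n' simp: LIMSEQ_inverse_real_of_nat inverse_eq_divide[symmetric] simp del: of_nat_Suc)
    then show ?thesis using bd[of t] by simp
  qed
  show ?thesis
  proof (rule increment_bound_limit[OF r _ _ _ _ _ N])
    show "increment_bound (f n) r s" for n
      unfolding increment_bound_def
      by (intro conjI allI impI increment_bound_continuous[OF r fc f_pos])
    show "f n integrable_on {r..R}" for n
      by (intro integrable_continuous_real fc)
    have cc: "continuous_on {r..R} (\<lambda>t. t powr (p - 1) * u t powr p)"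
      if "continuous_on {r..R} u" "\<And>t. 0 < u t" for u :: "real \<Rightarrow> real"
      using that r p_pos by (intro continuous_intros continuous_on_powr') (auto intro: less_imp_le)
    show "(\<lambda>t. t powr (p - 1) * f n t powr p) integrable_on {r..R}" for n
      by (intro integrable_continuous_real cc fc f_pos)
    show "(\<lambda>_. M + 1) integrable_on {r..R}" by (rule integrable_const_ivl)
    show "(\<lambda>t. t powr (p - 1) * (M + 1) powr p) integrable_on {r..R}"
      using M by (intro integrable_continuous_real cc) auto
    show "0 \<le> f n t \<and> f n t \<le> M + 1" for n t
      using f_le f_pos[of n t] by (simp add: less_imp_le)
  qed (rule f_lim)
qed

theorem increment_bound_holds:
  assumes r: "0 < r" "r < s" "s \<le> R" and g: "g \<in> borel_measurable borel" "\<And>t. 0 \<le> g t"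
    and int: "g integrable_on {r..R}" "(\<lambda>t. t powr (p - 1) * g t powr p) integrable_on {r..R}"
  shows "increment_bound g r s"
proof (rule increment_bound_limit[OF r])
  let ?f = "\<lambda>n t. min (g t) (real n)"
  note [measurable] = g(1)
  show "increment_bound (?f n) r s" for n
    using g by (intro increment_bound_bounded[OF r, of _ "real n"]) auto
  show "?f n integrable_on {r..R}" for n
    using g by (intro borel_integrable_on_bounded[OF _ int(1)]) auto
  show "(\<lambda>t. t powr (p - 1) * ?f n t powr p) integrable_on {r..R}" for n
    using g p_pos by (intro borel_integrable_on_bounded[OF _ int(2)])
      (auto simp: abs_mult intro!: mult_left_mono powr_mono2)
  show "negligible ({} :: real set)" by simp
  show "0 \<le> ?f n t \<and> ?f n t \<le> g t" for n t using g by auto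
  show "(\<lambda>n. ?f n t) \<longlonglongrightarrow> g t" for t
  proof (rule tendsto_eventually)
    obtain m where "g t \<le> real m" using real_arch_simple by blast
    then show "\<forall>\<^sub>F n in sequentially. ?f n t = g t"
      by (auto simp: eventually_sequentially intro!: exI[of _ m])
  qed
qed (use int in auto)

end

section \<open>Moser's argument\<close>

lemma nn_integral_inverse_Icc:
  fixes x y :: real
  assumes "0 < x" "x \<le> y"
  shows "(\<integral>\<^sup>+t. indicator {x..y} t * ennreal (1 / t) \<partial>lborel) = ennreal (ln (y / x))"
proof -
  have "((\<lambda>t. 1 / t) has_integral ln y - ln x) {x..y}"
    using assms by (intro fundamental_theorem_of_calculus)
      (auto intro!: derivative_eq_intros simp: has_real_derivative_iff_has_vector_derivative[symmetric])
  from nn_integral_has_integral_lebesgue'[OF _ this]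
  have "(\<integral>\<^sup>+t. ennreal (1 / t) * indicator {x..y} t \<partial>lborel) = ennreal (ln y - ln x)"
    using assms by simp
  then show ?thesis using assms by (simp add: mult.commute ln_div)
qed

text \<open>The last hypothesis says that \<open>{r. F r \<le> l}\<close> is covered by an interval at \<open>R\<close> and one further
  interval, both of \<open>dr / r\<close>-length \<open>O(l)\<close>.\<close>

lemma nn_integral_exp_neg_le:
  fixes f F :: "real \<Rightarrow> real" and D X Y :: "real"
  assumes R: "0 < R" and D: "0 \<le> D" and f: "\<And>r. r \<in> {0<..<R} \<Longrightarrow> f r \<le> D * (exp (- F r) / r)" and F0: "\<And>r. r \<in> {0<..<R} \<Longrightarrow> 0 \<le> F r" and XY: "0 \<le> X" "0 \<le> Y"
    and cl: "\<And>l r s. 1 \<le> l \<Longrightarrow> r \<in> {0<..<R} \<Longrightarrow> s \<in> {0<..<R} \<Longrightarrow> r < s \<Longrightarrow> F r \<le> l \<Longrightarrow> F s \<le> l \<Longrightarrow>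
        ln (R / s) \<le> X * l \<or> ln (s / r) \<le> Y * l"
  shows "(\<integral>\<^sup>+r. indicator {0<..<R} r * ennreal (f r) \<partial>lborel)
    \<le> ennreal D * (\<Sum>n. ennreal (exp (- real n) * ((X + 2 * Y) * Suc n)))"
proof -
  have le_exp: "z \<le> exp y" if "0 < z" "ln z \<le> y" for y z :: real
    using that exp_le_cancel_iff[of "ln z" y] by simp
  have scale: "z * exp (- y * l) \<le> r" if "0 < r" "z / r \<le> exp (y * l)" for z r y l :: real
    using that by (simp add: exp_minus field_simps)
  have "\<exists>x. \<forall>r\<in>{0<..<R}. F r \<le> Suc n \<longrightarrow> 0 < x \<and>
      (r \<in> {R * exp (- X * Suc n)..R} \<or> r \<in> {x * exp (- Y * Suc n)..x * exp (Y * Suc n)})" for n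
  proof -
    let ?l = "real (Suc n)"
    have toX: "r \<in> {R * exp (- X * ?l)..R}" if "r \<in> {0<..<R}" "ln (R / r) \<le> X * ?l" for r
    proof -
      have "R / r \<le> exp (X * ?l)" using that R by (intro le_exp) auto
      then show ?thesis using that scale[of r R X ?l] by (simp del: of_nat_Suc)
    qed
    show ?thesis
    proof (cases "\<exists>x\<in>{0<..<R}. F x \<le> ?l \<and> X * ?l < ln (R / x)")
      \<comment> \<open>A point \<open>x\<close> of the sublevel set outside the interval at
        \<open>R\<close> becomes the centre of the second interval: by \<open>cl\<close>, every
        other point of the set is near \<open>R\<close> or logarithmically near
        \<open>x\<close>.\<close>
      case True
      then obtain x where x: "x \<in> {0<..<R}" "F x \<le> ?l" "X * ?l < ln (R / x)" by blast
      show ?thesis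
      proof (rule exI[of _ x], intro ballI impI conjI)
        show "0 < x" using x by simp
        fix r assume r: "r \<in> {0<..<R}" "F r \<le> real (Suc n)"
        have "ln (R / r) \<le> X * ?l \<or> r \<in> {x * exp (- Y * ?l)..x * exp (Y * ?l)}"
        proof (cases r x rule: linorder_cases)
          case less
          then have "ln (x / r) \<le> Y * ?l" using cl[of ?l r x] x r by force
          then have "x / r \<le> exp (Y * ?l)"
            using x r by (intro le_exp) auto
          then have "x * exp (- Y * ?l) \<le> r" using r by (intro scale) auto
          moreover have "x \<le> x * exp (Y * ?l)" using x XY by simp
          ultimately show ?thesis using less by simp
        next
          case equal
          then show ?thesis using x XY by simp
        next
          case greater
          consider "ln (R / r) \<le> X * ?l" | "ln (r / x) \<le> Y * ?l"
            using cl[of ?l x r] x r greater by force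
          then show ?thesis
          proof cases
            case 2
            then have "r / x \<le> exp (Y * ?l)"
              using x r by (intro le_exp) auto
            then have "r \<le> x * exp (Y * ?l)" using x by (simp add: field_simps)
            moreover have "x * exp (- Y * ?l) \<le> x" using x XY by simp
            ultimately show ?thesis using greater by simp
          qed simp
        qed
        then show "r \<in> {R * exp (- X * Suc n)..R} \<or> r \<in> {x * exp (- Y * Suc n)..x * exp (Y * Suc n)}"
          using toX[OF r(1)] by blast
      qed
    next
      case False
      show ?thesis
      proof (rule exI[of _ 1], intro ballI impI conjI disjI1)
        fix r assume r: "r \<in> {0<..<R}" "F r \<le> real (Suc n)"
        with False have "ln (R / r) \<le> X * ?l" by force
        then show "r \<in> {R * exp (- X * Suc n)..R}" using toX[OF r(1)] by blast
      qed simp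
    qed
  qed
  then obtain x where x: "\<And>n r. r \<in> {0<..<R} \<Longrightarrow> F r \<le> Suc n \<Longrightarrow> 0 < x n \<and>
      (r \<in> {R * exp (- X * Suc n)..R} \<or> r \<in> {x n * exp (- Y * Suc n)..x n * exp (Y * Suc n)})"
    by metis
  \<comment> \<open>For an empty sublevel set nothing is known about \<open>x n\<close>; the default
    1 keeps the second interval well formed.\<close>
  define y where "y = (\<lambda>n. if 0 < x n then x n else 1)"
  have y: "0 < y n" for n by (simp add: y_def)
  define I where "I = (\<lambda>n. {R * exp (- X * Suc n)..R})"
  define J where "J = (\<lambda>n. {y n * exp (- Y * Suc n)..y n * exp (Y * Suc n)})"
  let ?u = "\<lambda>n r. ennreal (exp (- real n)) * (indicator (I n) r * ennreal (1 / r) + indicator (J n) r * ennreal (1 / r))"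
  have "(\<integral>\<^sup>+r. indicator {0<..<R} r * ennreal (f r) \<partial>lborel) \<le> (\<integral>\<^sup>+r. ennreal D * (\<Sum>n. ?u n r) \<partial>lborel)"
  proof (rule nn_integral_mono)
    fix r :: real
    show "indicator {0<..<R} r * ennreal (f r) \<le> ennreal D * (\<Sum>n. ?u n r)"
    proof (cases "r \<in> {0<..<R}")
      case True
      \<comment> \<open>Layers by the integer part of \<open>F\<close>. The exponential is estimated
        at \<open>n\<close> and the covering is used at \<open>n + 1\<close>, which is at least 1 as
        \<open>cl\<close> demands.\<close>
      define n where "n = nat \<lfloor>F r\<rfloor>"
      have n: "real n \<le> F r" "F r \<le> Suc n"
        using F0[OF True] by (auto simp: n_def) linarith
      have mem: "r \<in> I n \<or> r \<in> J n"
        using x[OF True n(2)] by (auto simp: I_def J_def y_def)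
      have "ennreal (exp (- F r) / r) \<le> ennreal (exp (- real n) * (1 / r))"
        using n True by (intro ennreal_leI) (simp add: divide_right_mono)
      also have "\<dots> = ennreal (exp (- real n)) * ennreal (1 / r)"
        using True by (intro ennreal_mult) auto
      also have "\<dots> \<le> ?u n r"
        using mem by (intro mult_left_mono) (auto simp: add_increasing add_increasing2)
      also have "\<dots> \<le> (\<Sum>n. ?u n r)"
        using sum_le_suminf[OF summableI, of "{n}" "\<lambda>n. ?u n r"] by simp
      finally have *: "ennreal (exp (- F r) / r) \<le> (\<Sum>n. ?u n r)" .
      have "ennreal (f r) \<le> ennreal (D * (exp (- F r) / r))"
        using f[OF True] by (rule ennreal_leI)
      also have "\<dots> = ennreal D * ennreal (exp (- F r) / r)"
        using D True by (intro ennreal_mult) auto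
      also have "\<dots> \<le> ennreal D * (\<Sum>n. ?u n r)"
        by (rule mult_left_mono[OF *]) simp
      finally show ?thesis using True by simp
    qed simp
  qed
  also have "\<dots> = ennreal D * (\<integral>\<^sup>+r. (\<Sum>n. ?u n r) \<partial>lborel)"
    by (intro nn_integral_cmult) (auto simp: I_def J_def)
  also have "(\<integral>\<^sup>+r. (\<Sum>n. ?u n r) \<partial>lborel) = (\<Sum>n. \<integral>\<^sup>+r. ?u n r \<partial>lborel)"
    by (intro nn_integral_suminf) (auto simp: I_def J_def)
  also have "\<dots> = (\<Sum>n. ennreal (exp (- real n) * ((X + 2 * Y) * Suc n)))"
  proof (rule suminf_cong)
    fix n
    have "(\<integral>\<^sup>+r. ?u n r \<partial>lborel) = ennreal (exp (- real n)) *
      ((\<integral>\<^sup>+r. indicator (I n) r * ennreal (1 / r) \<partial>lborel) + (\<integral>\<^sup>+r. indicator (J n) r * ennreal (1 / r) \<partial>lborel))"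
      by (simp add: nn_integral_cmult nn_integral_add I_def J_def)
    also have "(\<integral>\<^sup>+r. indicator (I n) r * ennreal (1 / r) \<partial>lborel) = ennreal (X * Suc n)"
    proof -
      have "R * exp (- X * Suc n) \<le> R" using R XY by simp
      moreover have "ln (R / (R * exp (- X * Suc n))) = X * Suc n"
        using R by (simp add: ln_div ln_mult)
      ultimately show ?thesis
        using R unfolding I_def by (subst nn_integral_inverse_Icc) auto
    qed
    also have "(\<integral>\<^sup>+r. indicator (J n) r * ennreal (1 / r) \<partial>lborel) = ennreal (2 * Y * Suc n)"
    proof -
      have "y n * exp (- Y * Suc n) \<le> y n * exp (Y * Suc n)"
        using y[of n] XY by (intro mult_left_mono) (auto simp: mult_nonneg_nonneg)
      moreover have "ln (y n * exp (Y * Suc n) / (y n * exp (- Y * Suc n))) = 2 * Y * Suc n"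
        using y[of n] by (simp add: ln_div ln_mult)
      ultimately show ?thesis
        using y[of n] unfolding J_def by (subst nn_integral_inverse_Icc) auto
    qed
    also have "ennreal (exp (- real n)) * (ennreal (X * Suc n) + ennreal (2 * Y * Suc n))
       = ennreal (exp (- real n) * ((X + 2 * Y) * Suc n))"
      using XY by (simp add: ennreal_plus[symmetric] ennreal_mult[symmetric] distrib_right del: ennreal_plus of_nat_Suc)
    finally show "(\<integral>\<^sup>+r. ?u n r \<partial>lborel) = ennreal (exp (- real n) * ((X + 2 * Y) * Suc n))" .
  qed
  finally show ?thesis .
qed

lemma exp_series_finite:
  fixes K :: real
  assumes "0 \<le> K"
  shows "(\<Sum>n. ennreal (exp (- real n) * (K * Suc n))) < \<infinity>"
proof -
  have "(\<lambda>n. real (Suc n) * exp (- 1) ^ n) sums (1 / (1 - exp (- 1))\<^sup>2)"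
    by (rule geometric_deriv_sums) simp
  then have "summable (\<lambda>n. K * (real (Suc n) * exp (- 1) ^ n))"
    by (intro summable_mult) (rule sums_summable)
  moreover have "(\<lambda>n. K * (real (Suc n) * exp (- 1) ^ n)) = (\<lambda>n. exp (- real n) * (K * Suc n))"
    by (simp add: fun_eq_iff exp_of_nat_mult[symmetric])
  ultimately have "summable (\<lambda>n. exp (- real n) * (K * Suc n))" by (simp only:)
  then have "(\<Sum>n. ennreal (exp (- real n) * (K * Suc n))) \<noteq> top"
    using assms by (intro ennreal_suminf_neq_top) auto
  then show ?thesis by (simp add: less_top)
qed

section \<open>Comparison of the clock with the logarithm\<close>

context ground_state
begin

lemma clock_combine:
  assumes "0 < r" "r < s" "s \<le> R"
  shows "clock r R = clock r s + clock s R"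
  unfolding clock_def
  by (rule Henstock_Kurzweil_Integration.integral_combine[symmetric])
    (use assms in \<open>auto intro!: integrable_continuous_real clock_integrand_continuous\<close>)

lemma \<phi>_le_0: "r \<in> {0..R} \<Longrightarrow> \<phi> r \<le> \<phi> 0"
  and \<phi>_0_diff: "r \<in> {0..R} \<Longrightarrow> \<phi> 0 - \<phi> r = integral {0..r} (slope \<phi>)"
proof -
  assume r: "r \<in> {0..R}"
  have i: "slope \<phi> integrable_on {0..R}"
    by (intro integrable_continuous_real slope_continuous[OF \<phi>_ok])
  have "integral {0..r} (slope \<phi>) + integral {r..R} (slope \<phi>) = integral {0..R} (slope \<phi>)"
    using r i by (intro Henstock_Kurzweil_Integration.integral_combine) auto
  moreover have "\<phi> r = 1 + integral {r..R} (slope \<phi>)" by (rule \<phi>_eq[OF r])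
  moreover have "\<phi> 0 = 1 + integral {0..R} (slope \<phi>)" using R by (intro \<phi>_eq) auto
  ultimately show eq: "\<phi> 0 - \<phi> r = integral {0..r} (slope \<phi>)" by linarith
  have "0 \<le> integral {0..r} (slope \<phi>)"
    using r by (intro integral_nonneg integrable_subinterval_real[OF i] slope_nonneg[OF \<phi>_ok]) auto
  with eq show "\<phi> r \<le> \<phi> 0" by linarith
qed

lemma clock_ge:
  assumes "0 < r" "r < s" "s \<le> R"
  shows "ln (s / r) \<le> \<phi> 0 powr q * clock r s"
proof -
  have 1: "((\<lambda>t. 1 / t) has_integral ln s - ln r) {r..s}"
    using assms by (intro fundamental_theorem_of_calculus)
      (auto intro!: derivative_eq_intros simp: has_real_derivative_iff_has_vector_derivative[symmetric])
  have 2: "((\<lambda>t. \<phi> 0 powr q * (\<phi> t powr (- q) / t)) has_integral \<phi> 0 powr q * clock r s) {r..s}"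
    unfolding clock_def using assms
    by (intro has_integral_mult_right integrable_integral integrable_continuous_real
        continuous_on_subset[OF clock_integrand_continuous[of r]]) auto
  have "ln s - ln r \<le> \<phi> 0 powr q * clock r s"
  proof (rule has_integral_le[OF 1 2])
    fix t assume "t \<in> {r..s}"
    then have t: "t \<in> {0..R}" "0 < t" using assms by auto
    have "\<phi> t powr q * \<phi> t powr (- q) = 1"
      using \<phi>_ge_1[OF t(1)] by (simp add: powr_minus_divide)
    moreover have "\<phi> t powr q * \<phi> t powr (- q) \<le> \<phi> 0 powr q * \<phi> t powr (- q)"
      using \<phi>_le_0[OF t(1)] \<phi>_ge_1[OF t(1)] q_props by (intro mult_right_mono powr_mono2) auto
    ultimately show "1 / t \<le> \<phi> 0 powr q * (\<phi> t powr (- q) / t)"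
      using t(2) by (simp add: divide_right_mono)
  qed
  then show ?thesis using assms by (simp add: ln_div)
qed

text \<open>As \<phi> differs from \<open>\<phi> 0\<close> by at most a multiple of
  \<open>t\<close>, the density of the rescaled clock exceeds \<open>1 / t\<close> by a bounded
  amount, which integrates to a constant. A correction of logarithmic size would change the critical
  exponent.\<close>

lemma clock_le:
  obtains C where "0 \<le> C" "\<And>r. r \<in> {0<..<R} \<Longrightarrow> \<phi> 0 powr q * clock r R \<le> ln (R / r) + C"
proof -
  have "bounded (slope \<phi> ` {0..R})"
    by (intro compact_imp_bounded compact_continuous_image slope_continuous[OF \<phi>_ok]) auto
  then obtain h where h: "\<And>t. t \<in> {0..R} \<Longrightarrow> slope \<phi> t \<le> h"
    by (fastforce simp: bounded_real abs_le_iff)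
  have h0: "0 \<le> h" using h[of 0] R by (simp add: slope_def)
  define K where "K = h * (\<phi> 0 + 1)"
  have \<phi>0: "1 \<le> \<phi> 0" using R by (intro \<phi>_ge_1) auto
  have K0: "0 \<le> K" using h0 \<phi>0 by (simp add: K_def)
  have pt: "\<phi> 0 powr q * \<phi> t powr (- q) \<le> 1 + K * t" if t: "t \<in> {0..R}" for t
  proof -
    define x where "x = \<phi> 0 / \<phi> t"
    have \<phi>t: "1 \<le> \<phi> t" "\<phi> t \<le> \<phi> 0" using \<phi>_ge_1 \<phi>_le_0 t by auto
    have x: "1 \<le> x" "x \<le> \<phi> 0"
      using \<phi>t mult_left_mono[of 1 "\<phi> t" "\<phi> 0"] by (auto simp: x_def pos_divide_le_eq)
    have "\<phi> 0 powr q * \<phi> t powr (- q) = x powr q"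
      using \<phi>t by (simp add: x_def powr_divide powr_minus_divide)
    \<comment> \<open>\<open>p \<ge> 2\<close> gives \<open>q \<le> 2\<close>, and the square then
      factors through \<open>x - 1\<close>.\<close>
    also have "\<dots> \<le> x powr 2"
      using x p by (intro powr_mono) (auto simp: field_simps)
    also have "\<dots> = 1 + (x - 1) * (x + 1)" using x by (simp add: power2_eq_square algebra_simps)
    also have "\<dots> \<le> 1 + (h * t) * (\<phi> 0 + 1)"
    proof (intro add_left_mono mult_mono)
      have "integral {0..t} (slope \<phi>) \<le> integral {0..t} (\<lambda>_. h)"
        using t h by (intro integral_le integrable_continuous_real continuous_on_subset[OF slope_continuous[OF \<phi>_ok]]) auto
      then have "\<phi> 0 - \<phi> t \<le> h * t" using \<phi>_0_diff[OF t] t by (simp add: mult.commute)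
      moreover have "(\<phi> 0 - \<phi> t) / \<phi> t \<le> \<phi> 0 - \<phi> t"
        using \<phi>t mult_left_mono[of 1 "\<phi> t" "\<phi> 0 - \<phi> t"] by (simp add: pos_divide_le_eq)
      moreover have "x - 1 = (\<phi> 0 - \<phi> t) / \<phi> t" using \<phi>t by (simp add: x_def diff_divide_distrib)
      ultimately show "x - 1 \<le> h * t" by linarith
    qed (use x h0 t in auto)
    finally show ?thesis by (simp add: K_def mult_ac)
  qed
  show thesis
  proof (rule that[of "K * R"])
    show "0 \<le> K * R" using K0 R by simp
    fix r assume r: "r \<in> {0<..<R}"
    have 1: "((\<lambda>t. 1 / t + K) has_integral (ln R - ln r) + K * (R - r)) {r..R}"
    proof (intro has_integral_add)
      show "((\<lambda>t. 1 / t) has_integral ln R - ln r) {r..R}"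
        using r by (intro fundamental_theorem_of_calculus)
          (auto intro!: derivative_eq_intros simp: has_real_derivative_iff_has_vector_derivative[symmetric])
      show "((\<lambda>t. K) has_integral K * (R - r)) {r..R}"
        using r has_integral_const_real[of K r R] by (simp add: mult.commute)
    qed
    have 2: "((\<lambda>t. \<phi> 0 powr q * (\<phi> t powr (- q) / t)) has_integral \<phi> 0 powr q * clock r R) {r..R}"
      unfolding clock_def using r
      by (intro has_integral_mult_right integrable_integral integrable_continuous_real clock_integrand_continuous) auto
    have "\<phi> 0 powr q * clock r R \<le> (ln R - ln r) + K * (R - r)"
    proof (rule has_integral_le[OF 2 1])
      fix t assume "t \<in> {r..R}"
      then have t: "t \<in> {0..R}" "0 < t" using r by auto
      have "\<phi> 0 powr q * \<phi> t powr (- q) / t \<le> (1 + K * t) / t"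
        using pt[OF t(1)] t(2) by (intro divide_right_mono) auto
      then show "\<phi> 0 powr q * (\<phi> t powr (- q) / t) \<le> 1 / t + K"
        using t(2) by (simp add: add_divide_distrib)
    qed
    also have "\<dots> \<le> ln (R / r) + K * R"
      using r K0 R by (simp add: ln_div algebra_simps)
    finally show "\<phi> 0 powr q * clock r R \<le> ln (R / r) + K * R" .
  qed
qed

end

section \<open>Uniform bound for the exponential integral\<close>

context ground_state
begin

lemma powr_inverse_q: "0 \<le> x \<Longrightarrow> (x powr (1 / q)) powr q = x"
  using p by (simp add: powr_powr)

lemma tail_props:
  assumes g: "\<And>t. 0 \<le> g t" "\<And>r. r \<in> {0<..<R} \<Longrightarrow> g integrable_on {r..R}" and r: "r \<in> {0<..<R}"
  shows "continuous_on {r..R} (tail g)" "t \<in> {r..R} \<Longrightarrow> 0 \<le> tail g t" "tail g R = 0"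
    "(\<lambda>t. t powr \<theta> * tail g t powr p) integrable_on {r..R}"
proof -
  show c: "continuous_on {r..R} (tail g)"
    unfolding tail_def by (intro indefinite_integral_continuous_1' g(2) r)
  show nn: "0 \<le> tail g t" if "t \<in> {r..R}" for t
    unfolding tail_def using that by (intro integral_nonneg integrable_subinterval_real[OF g(2)[OF r]] g(1)) auto
  show "tail g R = 0" by (simp add: tail_def)
  show "(\<lambda>t. t powr \<theta> * tail g t powr p) integrable_on {r..R}"
    using nn c p_pos r by (intro integrable_continuous_real continuous_on_powr_times) auto
qed

lemma excess_combine:
  assumes g: "\<And>t. 0 \<le> g t" "\<And>r. r \<in> {0<..<R} \<Longrightarrow> g integrable_on {r..R}"
    and gp: "\<And>r. r \<in> {0<..<R} \<Longrightarrow> (\<lambda>t. t powr (p - 1) * g t powr p) integrable_on {r..R}"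
    and r: "0 < r" "r < s" "s < R"
  shows "excess g r R = excess g r s + excess g s R"
proof -
  have r': "r \<in> {0<..<R}" using r by simp
  have "integral {r..R} (\<lambda>t. t powr (p - 1) * g t powr p)
      = integral {r..s} (\<lambda>t. t powr (p - 1) * g t powr p) + integral {s..R} (\<lambda>t. t powr (p - 1) * g t powr p)"
    using r by (intro Henstock_Kurzweil_Integration.integral_combine[symmetric] gp[OF r']) auto
  moreover have "integral {r..R} (\<lambda>t. t powr \<theta> * tail g t powr p)
      = integral {r..s} (\<lambda>t. t powr \<theta> * tail g t powr p) + integral {s..R} (\<lambda>t. t powr \<theta> * tail g t powr p)"
    using r by (intro Henstock_Kurzweil_Integration.integral_combine[symmetric] tail_props(4)[OF g r']) auto
  ultimately show ?thesis
    unfolding excess_def by (simp add: algebra_simps)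
qed

text \<open>In the proof \<open>S\<close> is time, counted from \<open>R\<close> towards 0, and
  \<open>Z\<close> is the rescaled \<open>z\<close>. The energy budget of one makes
  \<open>F = S - Z powr q\<close> nonnegative. The weight \<open>r powr \<theta>\<close> meets
  \<open>(R / r) powr (\<theta> + 1)\<close> from the clock, leaving \<open>exp (- F r) / r\<close>
  up to a constant, and Moser's estimate bounds the sublevel sets of \<open>F\<close>. The constant
  \<open>C\<close> is fixed before \<open>g\<close>, hence uniform.\<close>

theorem exponential_integral_bound:
  assumes a: "0 < a" and b: "0 \<le> b"
  obtains C :: ennreal where "C < \<infinity>"
    "\<And>g. g \<in> borel_measurable borel \<Longrightarrow> (\<And>t. 0 \<le> g t) \<Longrightarrow>
      (\<And>r. r \<in> {0<..<R} \<Longrightarrow> g integrable_on {r..R}) \<Longrightarrow>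
      (\<And>r. r \<in> {0<..<R} \<Longrightarrow> (\<lambda>t. t powr (p - 1) * g t powr p) integrable_on {r..R}) \<Longrightarrow>
      (\<And>r. r \<in> {0<..<R} \<Longrightarrow> a * excess g r R \<le> 1) \<Longrightarrow>
      (\<integral>\<^sup>+r. indicator {0<..<R} r *
         ennreal (b * r powr \<theta> * exp ((\<theta> + 1) * a powr (1 / (p - 1)) * tail g r powr q)) \<partial>lborel) \<le> C"
proof -
  define M where "M = (p - 1) * 2 powr (p - 1)"
  define L where "L = \<phi> 0"
  \<comment> \<open>The two alternatives of Moser's estimate, an early time or a short time span,
    divided by \<open>\<theta> + 1\<close> to pass from \<open>S\<close> to logarithms.\<close>
  define X Y where "X = 2 * M / (\<theta> + 1)" and "Y = 4 * (1 + M) / (\<theta> + 1)"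
  obtain C0 where C0: "0 \<le> C0" "\<And>r. r \<in> {0<..<R} \<Longrightarrow> L powr q * clock r R \<le> ln (R / r) + C0"
    using clock_le unfolding L_def by blast
  define D' where "D' = exp ((\<theta> + 1) * C0) * R powr (\<theta> + 1)"
  define D where "D = b * D'"
  define C where "C = ennreal D * (\<Sum>n. ennreal (exp (- real n) * ((X + 2 * Y) * Suc n)))"
  have M0: "0 \<le> M" using p_pos by (simp add: M_def)
  have XY: "0 \<le> X" "0 \<le> Y" using M0 p_pos by (auto simp: X_def Y_def)
  have L1: "1 \<le> L" unfolding L_def using R by (intro \<phi>_ge_1) auto
  have "C < \<infinity>"
  proof -
    have "(\<Sum>n. ennreal (exp (- real n) * ((X + 2 * Y) * Suc n))) < \<infinity>"
      using XY by (intro exp_series_finite) auto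
    then show ?thesis
      unfolding C_def infinity_ennreal_def by (simp only: ennreal_mult_less_top ennreal_less_top simp_thms)
  qed
  moreover have "(\<integral>\<^sup>+r. indicator {0<..<R} r *
         ennreal (b * r powr \<theta> * exp ((\<theta> + 1) * a powr (1 / (p - 1)) * tail g r powr q)) \<partial>lborel) \<le> C"
    if g: "g \<in> borel_measurable borel" "\<And>t. 0 \<le> g t" "\<And>r. r \<in> {0<..<R} \<Longrightarrow> g integrable_on {r..R}"
      and gp: "\<And>r. r \<in> {0<..<R} \<Longrightarrow> (\<lambda>t. t powr (p - 1) * g t powr p) integrable_on {r..R}"
      and ex: "\<And>r. r \<in> {0<..<R} \<Longrightarrow> a * excess g r R \<le> 1" for g
  proof -
    \<comment> \<open>Chosen so that \<open>B powr q\<close> is the exponent constant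
      \<open>(\<theta> + 1) * a powr (1 / (p - 1))\<close> times \<open>L powr q\<close>, the factor
      that also rescales the clock in \<open>S\<close>.\<close>
    define B where "B = (\<theta> + 1) powr (1 / q) * a powr (1 / p) * L"
    define Z where "Z = (\<lambda>r. B * ratio g r)"
    define S where "S = (\<lambda>r. (\<theta> + 1) * (L powr q * clock r R))"
    define F where "F = (\<lambda>r. S r - Z r powr q)"
    have B0: "0 < B" using a L1 p_pos by (simp add: B_def)
    have bound: "increment_bound g r s" if "0 < r" "r < s" "s \<le> R" for r s
      using that g gp by (intro increment_bound_holds) auto
    have clock_pos: "0 < clock r s" if "0 < r" "r < s" "s \<le> R" for r s
    proof -
      have "0 < ln (s / r)" using that by simp
      then have "0 < \<phi> 0 powr q * clock r s" using clock_ge[OF that] by linarith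
      then show ?thesis using L1 by (simp add: L_def zero_less_mult_iff)
    qed
    have inc: "Z r - Z s \<le> (a * excess g r s) powr (1 / p) * ((\<theta> + 1) * (L powr q * clock r s)) powr (1 / q)"
      if rs: "0 < r" "r < s" "s \<le> R" for r s
    proof -
      have e0: "0 \<le> excess g r s" using bound[OF rs] by (simp add: increment_bound_def)
      have "ratio g r - ratio g s \<le> excess g r s powr (1 / p) * clock r s powr (1 / q)"
        using bound[OF rs] clock_pos[OF rs] p q_props
        by (intro powr_product_le_of_young) (auto simp: increment_bound_def)
      then have "B * (ratio g r - ratio g s) \<le> B * (excess g r s powr (1 / p) * clock r s powr (1 / q))"
        using B0 by (intro mult_left_mono) auto
      also have "\<dots> = (a * excess g r s) powr (1 / p) * ((\<theta> + 1) * (L powr q * clock r s)) powr (1 / q)"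
      proof -
        have "((\<theta> + 1) * (L powr q * clock r s)) powr (1 / q)
            = (\<theta> + 1) powr (1 / q) * (L * clock r s powr (1 / q))"
          using p_pos L1 clock_pos[OF rs] q_props(3) by (simp add: powr_mult powr_powr)
        moreover have "(a * excess g r s) powr (1 / p) = a powr (1 / p) * excess g r s powr (1 / p)"
          using a e0 by (simp add: powr_mult)
        ultimately show ?thesis by (simp add: B_def mult_ac)
      qed
      finally show ?thesis by (simp add: Z_def right_diff_distrib)
    qed
    have Z_R: "Z R = 0" by (simp add: Z_def ratio_def tail_def)
    have Z0: "0 \<le> Z r" if r: "r \<in> {0<..<R}" for r
      using tail_props(2)[OF g(2,3) r, of r] r \<phi>_nonneg[of r] B0 by (simp add: Z_def ratio_def)
    have e_pos: "0 \<le> excess g r s" if "0 < r" "r < s" "s \<le> R" for r s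
      using bound[OF that] by (simp add: increment_bound_def)
    have F0: "0 \<le> F r" if r: "r \<in> {0<..<R}" for r
    proof -
      have rR: "0 < r" "r < R" "R \<le> R" using r by auto
      have S0: "0 \<le> S r" using clock_pos[OF rR] p_pos by (simp add: S_def)
      have "Z r \<le> (a * excess g r R) powr (1 / p) * S r powr (1 / q)"
        using inc[OF rR] Z_R by (simp add: S_def)
      also have "\<dots> \<le> 1 * S r powr (1 / q)"
        using ex[OF r] a e_pos[OF rR] p_pos by (intro mult_right_mono powr_le1) auto
      finally have "Z r powr q \<le> (S r powr (1 / q)) powr q"
        using Z0[OF r] q_props by (intro powr_mono2) auto
      also have "\<dots> = S r" by (rule powr_inverse_q[OF S0])
      finally show ?thesis by (simp add: F_def)
    qed
    have cl: "ln (R / s) \<le> X * l \<or> ln (s / r) \<le> Y * l"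
      if l: "1 \<le> l" and r: "r \<in> {0<..<R}" and s: "s \<in> {0<..<R}" and rs: "r < s" and F: "F r \<le> l" "F s \<le> l" for l r s
    proof (cases "2 * M * l \<le> S s")
      case False
      have "ln (R / s) \<le> L powr q * clock s R"
        unfolding L_def using s by (intro clock_ge) auto
      then have "(\<theta> + 1) * ln (R / s) \<le> S s"
        unfolding S_def using p_pos by (intro mult_left_mono) auto
      then have "(\<theta> + 1) * ln (R / s) \<le> 2 * M * l" using False by linarith
      then have "ln (R / s) \<le> X * l"
        using p_pos by (simp add: X_def pos_le_divide_eq mult.commute)
      then show ?thesis ..
    next
      case True
      have rs': "0 < r" "r < s" "s \<le> R" and sR: "0 < s" "s < R" "R \<le> R" using r s rs by auto
      have Sd: "S r - S s = (\<theta> + 1) * (L powr q * clock r s)"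
        using clock_combine[OF rs'] by (simp add: S_def algebra_simps)
      have d0: "0 \<le> (\<theta> + 1) * (L powr q * clock r s)"
        using clock_pos[OF rs'] p_pos by simp
      \<comment> \<open>Time runs inwards, so the larger radius \<open>s\<close> is the earlier
        point and provides the data with index 1.\<close>
      have "S r - S s \<le> 4 * (1 + M) * l"
        unfolding M_def
      proof (rule moser_two_points[where ?z1.0 = "Z s" and ?z2.0 = "Z r"
            and ?P1.0 = "a * excess g s R" and ?P2.0 = "a * excess g r s"])
        show "S s \<le> S r" using Sd d0 by simp
        show "0 \<le> a * excess g s R" "0 \<le> a * excess g r s" using a e_pos[OF sR] e_pos[OF rs'] by auto
        show "a * excess g s R + a * excess g r s \<le> 1"
          using ex[OF r] excess_combine[OF g(2,3) gp, of r s] rs' sR by (simp add: algebra_simps)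
        show "Z s \<le> (a * excess g s R) powr (1 / p) * S s powr (1 / q)"
          using inc[OF sR] Z_R by (simp add: S_def)
        show "Z r \<le> Z s + (a * excess g r s) powr (1 / p) * (S r - S s) powr (1 / q)"
          using inc[OF rs'] Sd by simp
        show "S s - Z s powr q \<le> l" "S r - Z r powr q \<le> l" using F by (auto simp: F_def)
        show "2 * ((p - 1) * 2 powr (p - 1)) * l \<le> S s" using True by (simp add: M_def)
      qed (use p l Z0[OF r] Z0[OF s] in auto)
      moreover have "(\<theta> + 1) * ln (s / r) \<le> S r - S s"
        unfolding Sd L_def using clock_ge[OF rs'] p_pos by (intro mult_left_mono) auto
      ultimately have "(\<theta> + 1) * ln (s / r) \<le> 4 * (1 + M) * l" by linarith
      then have "ln (s / r) \<le> Y * l"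
        using p_pos by (simp add: Y_def pos_le_divide_eq mult.commute)
      then show ?thesis ..
    qed
    have pt: "b * r powr \<theta> * exp ((\<theta> + 1) * a powr (1 / (p - 1)) * tail g r powr q) \<le> D * (exp (- F r) / r)"
      if r: "r \<in> {0<..<R}" for r
    proof -
      have \<phi>: "1 \<le> \<phi> r" "\<phi> r \<le> L" unfolding L_def using r by (auto intro: \<phi>_ge_1 \<phi>_le_0)
      have t0: "0 \<le> tail g r" using tail_props(2)[OF g(2,3) r, of r] r by simp
      \<comment> \<open>The substitution is undone with \<open>\<phi> r \<le> L\<close>; this factor
        \<open>L\<close> is the one built into \<open>B\<close>.\<close>
      have "tail g r \<le> L * ratio g r"
        using \<phi> t0 mult_right_mono[OF \<phi>(2) t0] by (simp add: ratio_def pos_le_divide_eq mult.commute)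
      then have "tail g r powr q \<le> (L * ratio g r) powr q"
        using t0 q_props by (intro powr_mono2) auto
      then have "(\<theta> + 1) * a powr (1 / (p - 1)) * tail g r powr q \<le> (\<theta> + 1) * a powr (1 / (p - 1)) * (L * ratio g r) powr q"
        using p_pos by (intro mult_left_mono) auto
      also have "\<dots> = Z r powr q"
      proof -
        have "0 \<le> ratio g r" using t0 \<phi> by (simp add: ratio_def)
        moreover have "1 / p * q = 1 / (p - 1)" using p_pos by simp
        ultimately show ?thesis
          using p_pos q_props(3) a L1 by (simp add: Z_def B_def powr_mult powr_powr mult_ac)
      qed
      also have "\<dots> = S r - F r" by (simp add: F_def)
      also have "\<dots> \<le> (\<theta> + 1) * (ln (R / r) + C0) - F r"
        unfolding S_def using C0(2)[OF r] p_pos by (intro diff_right_mono mult_left_mono) auto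
      finally have "exp ((\<theta> + 1) * a powr (1 / (p - 1)) * tail g r powr q) \<le> exp ((\<theta> + 1) * (ln (R / r) + C0) - F r)"
        by simp
      also have "\<dots> = exp ((\<theta> + 1) * C0) * (R / r) powr (\<theta> + 1) * exp (- F r)"
        using r by (simp add: powr_def exp_add[symmetric] algebra_simps exp_diff)
      finally have "r powr \<theta> * exp ((\<theta> + 1) * a powr (1 / (p - 1)) * tail g r powr q)
        \<le> r powr \<theta> * (exp ((\<theta> + 1) * C0) * (R / r) powr (\<theta> + 1) * exp (- F r))"
        by (intro mult_left_mono) auto
      also have "\<dots> = D' * (exp (- F r) / r)"
        using r by (simp add: D'_def powr_divide powr_add field_simps)
      finally show ?thesis
        using b mult_left_mono[of _ _ b] by (fastforce simp: D_def mult.assoc)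
    qed
    have "(\<integral>\<^sup>+r. indicator {0<..<R} r *
         ennreal (b * r powr \<theta> * exp ((\<theta> + 1) * a powr (1 / (p - 1)) * tail g r powr q)) \<partial>lborel)
       \<le> C"
      unfolding C_def
      by (intro nn_integral_exp_neg_le[where F = F] R F0 XY cl pt) (use b in \<open>auto simp: D_def D'_def\<close>)
    then show ?thesis .
  qed
  ultimately show thesis by (rule that)
qed

end

section \<open>The function space\<close>

lemma omega_pos: "0 < s \<Longrightarrow> 0 < omega s"
  by (simp add: omega_def rGamma_inverse_Gamma Gamma_real_pos)

lemma Lpn_altdef:
  "0 < s \<Longrightarrow> Lpn s p R g = (\<integral>\<^sup>+r. ennreal (indicator {0<..<R} r * (omega s * r powr s * \<bar>g r\<bar> powr p)) \<partial>lborel)"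
  unfolding Lpn_def lam_int_def
  by (intro nn_integral_cong) (auto simp: indicator_def ennreal_mult' omega_pos less_imp_le)

lemma Lpn_continuous:
  fixes f :: "real \<Rightarrow> real"
  assumes s: "0 < s" and p: "0 < p" and R: "0 < R" and f: "continuous_on {0..R} f"
    and nn: "\<And>r. r \<in> {0..R} \<Longrightarrow> 0 \<le> f r" and g: "\<And>r. r \<in> {0<..<R} \<Longrightarrow> \<bar>g r\<bar> = f r"
  shows "Lpn s p R g = ennreal (omega s * integral {0..R} (\<lambda>r. r powr s * f r powr p))"
proof -
  have int: "(\<lambda>r. r powr s * f r powr p) integrable_on {0..R}"
    using s p f nn by (intro integrable_continuous_real continuous_intros continuous_on_powr') auto
  have "((\<lambda>r. omega s * (r powr s * f r powr p)) has_integral omega s * integral {0..R} (\<lambda>r. r powr s * f r powr p)) {0..R}"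
    by (intro has_integral_mult_right integrable_integral int)
  then have *: "(\<integral>\<^sup>+r. ennreal (omega s * (r powr s * f r powr p)) * indicator {0..R} r \<partial>lborel)
      = ennreal (omega s * integral {0..R} (\<lambda>r. r powr s * f r powr p))"
    using omega_pos[OF s] by (intro nn_integral_has_integral_lebesgue') auto
  have "AE r in lborel. ennreal (indicator {0<..<R} r * (omega s * r powr s * \<bar>g r\<bar> powr p))
      = ennreal (omega s * (r powr s * f r powr p)) * indicator {0..R} r"
    using AE_lborel_singleton[of 0] AE_lborel_singleton[of R]
    by eventually_elim (auto simp: indicator_def g mult.assoc)
  then have "Lpn s p R g = (\<integral>\<^sup>+r. ennreal (omega s * (r powr s * f r powr p)) * indicator {0..R} r \<partial>lborel)"
    unfolding Lpn_altdef[OF s]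
    by (intro nn_integral_cong_AE)
  with * show ?thesis by simp
qed

lemma Xgen_subset_Xsp: "Xgen p R \<alpha> \<theta> \<subseteq> Xsp p R \<alpha> \<theta>"
proof safe
  fix u v assume uv: "(u, v) \<in> Xgen p R \<alpha> \<theta>"
  then have "inLp \<theta> p R u" "inLp \<alpha> p R v" by (auto simp: Xgen_def)
  moreover have "Lpn s p R (\<lambda>r. f r - f r) = 0" for s and f :: "real \<Rightarrow> real"
    by (simp add: Lpn_def lam_int_def)
  ultimately show "(u, v) \<in> Xsp p R \<alpha> \<theta>"
    using uv unfolding Xsp_def by (auto intro!: exI[of _ "\<lambda>_. (u, v)"])
qed

lemma abs_cont_on_lipschitz:
  assumes L: "0 \<le> L" and le: "\<And>x y. a \<le> x \<Longrightarrow> x \<le> y \<Longrightarrow> y \<le> b \<Longrightarrow> \<bar>f y - f x\<bar> \<le> L * (y - x)"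
  shows "abs_cont_on a b f"
  unfolding abs_cont_on_def
proof (intro allI impI)
  fix \<epsilon> :: real assume \<epsilon>: "0 < \<epsilon>"
  show "\<exists>\<delta>>0. \<forall>n (xs::nat \<Rightarrow> real) ys.
       (\<forall>i<n. a \<le> xs i \<and> xs i \<le> ys i \<and> ys i \<le> b) \<and>
       (\<forall>i<n. \<forall>j<n. i \<noteq> j \<longrightarrow> ys i \<le> xs j \<or> ys j \<le> xs i) \<and>
       (\<Sum>i<n. ys i - xs i) < \<delta>
       \<longrightarrow> (\<Sum>i<n. \<bar>f (ys i) - f (xs i)\<bar>) < \<epsilon>"
  proof (intro exI[of _ "\<epsilon> / (L + 1)"] conjI allI impI)
    show "0 < \<epsilon> / (L + 1)" using \<epsilon> L by simp
    fix n :: nat and xs ys :: "nat \<Rightarrow> real"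
    assume *: "(\<forall>i<n. a \<le> xs i \<and> xs i \<le> ys i \<and> ys i \<le> b) \<and>
       (\<forall>i<n. \<forall>j<n. i \<noteq> j \<longrightarrow> ys i \<le> xs j \<or> ys j \<le> xs i) \<and> (\<Sum>i<n. ys i - xs i) < \<epsilon> / (L + 1)"
    have nn: "0 \<le> (\<Sum>i<n. ys i - xs i)" using * by (intro sum_nonneg) auto
    have "(\<Sum>i<n. \<bar>f (ys i) - f (xs i)\<bar>) \<le> (\<Sum>i<n. L * (ys i - xs i))"
      using * by (intro sum_mono le) auto
    also have "\<dots> \<le> (L + 1) * (\<Sum>i<n. ys i - xs i)"
      using nn by (simp add: sum_distrib_left[symmetric] mult_right_mono)
    also have "\<dots> < \<epsilon>" using * L by (simp add: field_simps)
    finally show "(\<Sum>i<n. \<bar>f (ys i) - f (xs i)\<bar>) < \<epsilon>" .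
  qed
qed

text \<open>Provides the competitors for \<open>lambda1\<close> that yield the Poincare inequality
  of the locale. The indicator secures Borel measurability on the whole line and changes nothing
  inside the interval.\<close>

lemma tail_in_Xgen:
  fixes \<psi> :: "real \<Rightarrow> real"
  assumes R: "0 < R" and p: "0 < p" and \<alpha>: "0 < \<alpha>" and \<theta>: "0 < \<theta>" and \<psi>: "continuous_on {0..R} \<psi>"
    and nn: "\<And>r. r \<in> {0..R} \<Longrightarrow> 0 \<le> \<psi> r"
  shows "(\<lambda>r. indicator {0<..<R} r * integral {r..R} \<psi>, \<lambda>r. indicator {0<..<R} r * - \<psi> r) \<in> Xgen p R \<alpha> \<theta>"
proof -
  let ?w = "\<lambda>r. integral {r..R} \<psi>"
  let ?u = "\<lambda>r. indicator {0<..<R} r * ?w r" and ?v = "\<lambda>r. indicator {0<..<R} r * - \<psi> r"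
  have int: "\<psi> integrable_on {a..b}" if "0 \<le> a" "b \<le> R" for a b
    using that by (intro integrable_continuous_real continuous_on_subset[OF \<psi>]) auto
  have w: "continuous_on {0..R} ?w"
    using R by (intro indefinite_integral_continuous_1' int) auto
  have w0: "0 \<le> ?w r" if "r \<in> {0..R}" for r
    using that nn by (intro integral_nonneg int) auto
  have "bounded (\<psi> ` {0..R})"
    by (intro compact_imp_bounded compact_continuous_image \<psi>) auto
  then obtain L where L: "\<And>t. t \<in> {0..R} \<Longrightarrow> \<psi> t \<le> L"
    by (fastforce simp: bounded_real abs_le_iff)
  have L0: "0 \<le> L" using L[of 0] nn[of 0] R by auto
  have "AC_loc R ?u"
    unfolding AC_loc_def
  proof (intro allI impI abs_cont_on_lipschitz[OF L0])
    fix a b x y assume *: "0 < a \<and> a \<le> b \<and> b < R" "a \<le> x" "x \<le> y" "y \<le> b"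
    have "?w x = integral {x..y} \<psi> + ?w y"
      using * by (intro Henstock_Kurzweil_Integration.integral_combine[symmetric] int) auto
    moreover have "integral {x..y} \<psi> \<le> integral {x..y} (\<lambda>_. L)"
      using * L by (intro integral_le int) auto
    moreover have "0 \<le> integral {x..y} \<psi>" using * nn by (intro integral_nonneg int) auto
    ultimately show "\<bar>?u y - ?u x\<bar> \<le> L * (y - x)"
      using * by (simp add: mult.commute)
  qed
  moreover have "(?u \<longlongrightarrow> 0) (at_left R)"
  proof -
    have "(?w \<longlongrightarrow> ?w R) (at R within {0..R})"
      by (rule w[unfolded continuous_on_def, rule_format]) (use R in simp)
    then have "(?w \<longlongrightarrow> 0) (at_left R)"
      using R by (simp add: at_within_Icc_at_left)
    moreover have "\<forall>\<^sub>F r in at_left R. ?w r = ?u r"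
      using eventually_at_left_real[OF R] by eventually_elim simp
    ultimately show ?thesis by (rule Lim_transform_eventually)
  qed
  moreover have "(?u has_real_derivative ?v r) (at r)" if r: "r \<in> {0<..<R}" for r
  proof -
    have "(?w has_real_derivative - \<psi> r) (at r within {0..R})"
      using integral_has_vector_derivative'[OF \<psi>, of r] r
      by (simp add: has_real_derivative_iff_has_vector_derivative)
    then have "(?w has_real_derivative ?v r) (at r)"
      using at_within_Icc_at[of 0 r R] r by simp
    then show ?thesis
      by (rule has_field_derivative_transform_within_open[of _ _ _ "{0<..<R}"]) (use r in auto)
  qed
  moreover have "inLp \<theta> p R ?u"
  proof -
    have "?u \<in> borel_measurable borel"
      using borel_measurable_continuous_on_indicator[of "{0<..<R}" ?w] continuous_on_subset[OF w, of "{0<..<R}"]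
      by (simp add: real_scaleR_def subset_eq)
    moreover have "Lpn \<theta> p R ?u = ennreal (omega \<theta> * integral {0..R} (\<lambda>r. r powr \<theta> * ?w r powr p))"
      using w0 by (intro Lpn_continuous \<theta> p R w) auto
    ultimately show ?thesis by (simp add: inLp_def)
  qed
  moreover have "inLp \<alpha> p R ?v"
  proof -
    have "?v \<in> borel_measurable borel"
      using borel_measurable_continuous_on_indicator[of "{0<..<R}" "\<lambda>r. - \<psi> r"]
        continuous_on_minus[OF continuous_on_subset[OF \<psi>, of "{0<..<R}"]]
      by (simp add: real_scaleR_def subset_eq)
    moreover have "Lpn \<alpha> p R ?v = ennreal (omega \<alpha> * integral {0..R} (\<lambda>r. r powr \<alpha> * \<psi> r powr p))"
      using nn by (intro Lpn_continuous \<alpha> p R \<psi>) auto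
    ultimately show ?thesis by (simp add: inLp_def)
  qed
  ultimately show ?thesis by (simp add: Xgen_def)
qed

text \<open>Multiplying the quotient back in \<open>ennreal\<close> is legitimate when the norm of
  \<open>u\<close> is nonzero and finite; for norm zero the claim is trivial.\<close>

lemma lambda1_le:
  assumes uv: "(u, v) \<in> Xsp p R \<alpha> \<theta>" and k: "ennreal k \<le> lambda1 p R \<alpha> \<theta>"
  shows "ennreal k * Lpn \<theta> p R u \<le> Lpn \<alpha> p R v"
proof (cases "Lpn \<theta> p R u = 0")
  case False
  have fin: "Lpn \<theta> p R u < top" using uv by (simp add: Xsp_def inLp_def)
  have "lambda1 p R \<alpha> \<theta> \<le> Lpn \<alpha> p R v / Lpn \<theta> p R u"
    unfolding lambda1_def using uv False by (intro INF_lower2[of "(u, v)"]) auto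
  with k have "ennreal k \<le> Lpn \<alpha> p R v / Lpn \<theta> p R u" by simp
  then have "ennreal k * Lpn \<theta> p R u \<le> Lpn \<alpha> p R v / Lpn \<theta> p R u * Lpn \<theta> p R u"
    by (rule mult_right_mono) simp
  also have "\<dots> = Lpn \<alpha> p R v"
    using False fin by (simp add: ennreal_divide_times ennreal_divide_self ennreal_times_divide[symmetric] mult_divide_eq_ennreal)
  finally show ?thesis .
qed simp

text \<open>The fundamental theorem on \<open>{r..s}\<close>, followed by \<open>s\<close> tending
  to \<open>R\<close>, where \<open>u\<close> vanishes. With an extended integral on the right, a
  derivative that is not integrable near \<open>R\<close> falls under the trivial case.\<close>

lemma Xgen_abs_le:
  assumes uv: "(u, v) \<in> Xgen p R \<alpha> \<theta>" and r: "0 < r" "r < R"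
  shows "ennreal \<bar>u r\<bar> \<le> (\<integral>\<^sup>+t. indicator {r<..<R} t * ennreal \<bar>v t\<bar> \<partial>lborel)" (is "_ \<le> ?T")
proof (cases "?T < \<infinity>")
  case True
  have v [measurable]: "v \<in> borel_measurable borel"
    using uv by (simp add: Xgen_def inLp_def)
  have "AE x in lborel. x \<in> {0<..<R} \<longrightarrow> (u has_real_derivative v x) (at x)"
    using uv by (simp add: Xgen_def)
  then obtain N where N: "{x \<in> space lborel. \<not> (x \<in> {0<..<R} \<longrightarrow> (u has_real_derivative v x) (at x))} \<subseteq> N"
      "emeasure lborel N = 0" "N \<in> sets lborel"
    by (rule AE_E)
  have neg: "negligible N"
    using N by (auto simp: negligible_iff_null_sets intro: null_sets_completionI)
  have le: "ennreal \<bar>u s - u r\<bar> \<le> ?T" if s: "s \<in> {r<..<R}" for s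
  proof -
    define f where "f = (\<lambda>t. indicator {r<..<s} t * v t)"
    have ac: "abs_cont_on r s u"
      using uv r s by (auto simp: Xgen_def AC_loc_def)
    have "(v has_integral u s - u r) {r..s}"
    proof (rule abs_cont_on_has_integral[OF _ ac neg])
      fix x assume "x \<in> {r<..<s} - N"
      then have "x \<in> {0<..<R}" "x \<notin> N" using r s by auto
      then show "(u has_real_derivative v x) (at x)" using N(1) by auto
    qed (use s in auto)
    then have "(v has_integral u s - u r) {r<..<s}"
      using has_integral_open_interval[of v "u s - u r" r s] by (simp add: box_real)
    moreover have "f = (\<lambda>t. if t \<in> {r<..<s} then v t else 0)"
      by (auto simp: f_def indicator_def)
    ultimately have f1: "(f has_integral u s - u r) UNIV"
      by (simp only: has_integral_restrict_UNIV)
    have fT: "(\<integral>\<^sup>+t. ennreal (norm (f t)) \<partial>lborel) \<le> ?T"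
      using s by (intro nn_integral_mono) (auto simp: f_def indicator_def)
    \<comment> \<open>Finiteness of the bound gives absolute integrability, which identifies the
      gauge integral with the Lebesgue integral.\<close>
    have "integrable lborel f"
      using fT True by (intro integrableI_bounded) (auto simp: f_def)
    then have "integral\<^sup>L lborel f = u s - u r"
      and "ennreal (norm (integral\<^sup>L lborel f)) \<le> (\<integral>\<^sup>+t. ennreal (norm (f t)) \<partial>lborel)"
      using has_integral_unique[OF has_integral_integral_lborel f1] integral_norm_bound_ennreal[of lborel f]
      by blast+
    then show ?thesis using fT by (auto intro: order_trans)
  qed
  define T where "T = enn2real ?T"
  have T: "?T = ennreal T" "0 \<le> T" using True by (auto simp: T_def less_top)
  have "((\<lambda>s. \<bar>u s - u r\<bar>) \<longlongrightarrow> \<bar>0 - u r\<bar>) (at_left R)"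
    using uv by (intro tendsto_intros) (simp add: Xgen_def)
  moreover have "\<forall>\<^sub>F s in at_left R. \<bar>u s - u r\<bar> \<le> T"
    using eventually_at_left_real[OF r(2)]
  proof eventually_elim
    case (elim s)
    then show ?case using le[of s] T by simp
  qed
  ultimately have "\<bar>0 - u r\<bar> \<le> T"
    by (rule tendsto_upperbound) (simp add: trivial_limit_at_left_real)
  then show ?thesis using T by (simp add: ennreal_leI)
qed (simp add: not_less top_unique)

text \<open>Away from 0 the weight is bounded below, and \<open>\<bar>x\<bar> \<le> \<eta> + \<eta>
  powr (1 - p) * \<bar>x\<bar> powr p\<close> takes the place of Hoelder. As \<eta> is free, norm
  convergence implies convergence in mean on \<open>{e<..<R}\<close>.\<close>

lemma nn_integral_le_Lpn:
  assumes p: "1 \<le> p" and s: "0 < s" and e: "0 < e" "e < R" and \<eta>: "0 < \<eta>" and h [measurable]: "h \<in> borel_measurable borel"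
  shows "(\<integral>\<^sup>+r. indicator {e<..<R} r * ennreal \<bar>h r\<bar> \<partial>lborel)
    \<le> ennreal (\<eta> * R) + ennreal (\<eta> powr (1 - p) / (omega s * e powr s)) * Lpn s p R h"
proof -
  define K where "K = \<eta> powr (1 - p) / (omega s * e powr s)"
  have K: "0 \<le> K" using omega_pos[OF s] by (simp add: K_def)
  have le: "\<bar>x\<bar> \<le> \<eta> + \<eta> powr (1 - p) * \<bar>x\<bar> powr p" for x :: real
  proof (cases "\<bar>x\<bar> \<le> \<eta>")
    case False
    then have x: "0 < \<bar>x\<bar>" "1 \<le> \<bar>x\<bar> / \<eta>" using \<eta> by auto
    have "\<eta> powr (1 - p) * \<bar>x\<bar> powr p = \<bar>x\<bar> * (\<bar>x\<bar> / \<eta>) powr (p - 1)"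
      using x \<eta> by (simp add: powr_divide powr_diff)
    moreover have "1 \<le> (\<bar>x\<bar> / \<eta>) powr (p - 1)" using x p by (intro ge_one_powr_ge_zero) auto
    then have "\<bar>x\<bar> * 1 \<le> \<bar>x\<bar> * (\<bar>x\<bar> / \<eta>) powr (p - 1)" by (intro mult_left_mono) auto
    ultimately show ?thesis using \<eta> by linarith
  qed (use \<eta> in \<open>simp add: add_increasing2\<close>)
  have "(\<integral>\<^sup>+r. indicator {e<..<R} r * ennreal \<bar>h r\<bar> \<partial>lborel)
    \<le> (\<integral>\<^sup>+r. ennreal \<eta> * indicator {0..R} r + ennreal K * ennreal (indicator {0<..<R} r * (omega s * r powr s * \<bar>h r\<bar> powr p)) \<partial>lborel)"
  proof (rule nn_integral_mono)
    fix r
    show "indicator {e<..<R} r * ennreal \<bar>h r\<bar>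
      \<le> ennreal \<eta> * indicator {0..R} r + ennreal K * ennreal (indicator {0<..<R} r * (omega s * r powr s * \<bar>h r\<bar> powr p))"
    proof (cases "r \<in> {e<..<R}")
      case True
      have "1 \<le> r powr s / e powr s"
        using True e s by (simp add: powr_mono2)
      then have "\<eta> powr (1 - p) * \<bar>h r\<bar> powr p * 1 \<le> \<eta> powr (1 - p) * \<bar>h r\<bar> powr p * (r powr s / e powr s)"
        by (intro mult_left_mono) auto
      also have "\<dots> = K * (omega s * r powr s * \<bar>h r\<bar> powr p)"
        using omega_pos[OF s] e by (simp add: K_def)
      finally have "\<bar>h r\<bar> \<le> \<eta> + K * (omega s * r powr s * \<bar>h r\<bar> powr p)"
        using le[of "h r"] by linarith
      then have "ennreal \<bar>h r\<bar> \<le> ennreal (\<eta> + K * (omega s * r powr s * \<bar>h r\<bar> powr p))"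
        by (rule ennreal_leI)
      also have "\<dots> = ennreal \<eta> + ennreal K * ennreal (omega s * r powr s * \<bar>h r\<bar> powr p)"
        using \<eta> K omega_pos[OF s] by (simp add: ennreal_plus ennreal_mult)
      finally show ?thesis using True e by simp
    qed simp
  qed
  also have "\<dots> = ennreal \<eta> * (\<integral>\<^sup>+r. indicator {0..R} r \<partial>lborel)
     + ennreal K * (\<integral>\<^sup>+r. ennreal (indicator {0<..<R} r * (omega s * r powr s * \<bar>h r\<bar> powr p)) \<partial>lborel)"
    by (simp add: nn_integral_add nn_integral_cmult del: nn_integral_indicator)
  also have "(\<integral>\<^sup>+r. indicator {0..R} r \<partial>lborel) = ennreal R"
    using e by simp
  also have "ennreal \<eta> * ennreal R = ennreal (\<eta> * R)"
    using \<eta> e by (simp add: ennreal_mult)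
  finally show ?thesis
    unfolding Lpn_altdef[OF s] K_def .
qed

text \<open>The pointwise bound passes to the closure without choosing an almost everywhere
  convergent subsequence: the positive part of its defect has an integral below every positive
  number.\<close>

lemma Xsp_abs_le:
  assumes uv: "(u, v) \<in> Xsp p R \<alpha> \<theta>" and p: "1 \<le> p" and \<alpha>: "0 < \<alpha>" and \<theta>: "0 < \<theta>" and R: "0 < R"
  shows "AE r in lborel. r \<in> {0<..<R} \<longrightarrow> ennreal \<bar>u r\<bar> \<le> (\<integral>\<^sup>+t. indicator {r<..<R} t * ennreal \<bar>v t\<bar> \<partial>lborel)"
proof -
  have u [measurable]: "u \<in> borel_measurable borel" and v [measurable]: "v \<in> borel_measurable borel"
    using uv by (auto simp: Xsp_def inLp_def)
  obtain w where w: "\<And>n. w n \<in> Xgen p R \<alpha> \<theta>"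
    and lim_u: "(\<lambda>n. Lpn \<theta> p R (\<lambda>r. fst (w n) r - u r)) \<longlonglongrightarrow> 0"
    and lim_v: "(\<lambda>n. Lpn \<alpha> p R (\<lambda>r. snd (w n) r - v r)) \<longlonglongrightarrow> 0"
    using uv by (auto simp: Xsp_def)
  define un vn where "un = (\<lambda>n. fst (w n))" and "vn = (\<lambda>n. snd (w n))"
  have wn: "(un n, vn n) \<in> Xgen p R \<alpha> \<theta>" for n using w by (simp add: un_def vn_def)
  have un [measurable]: "un n \<in> borel_measurable borel" and vn [measurable]: "vn n \<in> borel_measurable borel" for n
    using wn[of n] by (auto simp: Xgen_def inLp_def)
  define T where "T = (\<lambda>(f :: real \<Rightarrow> real) r. \<integral>\<^sup>+t. indicator {r<..<R} t * ennreal \<bar>f t\<bar> \<partial>lborel)"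
  have T_meas [measurable]: "(\<lambda>r. T v r) \<in> borel_measurable borel"
  proof -
    have "(\<lambda>r. \<integral>\<^sup>+t. (if r < t \<and> t < R then ennreal \<bar>v t\<bar> else 0) \<partial>lborel) \<in> borel_measurable borel"
      by measurable
    moreover have "(\<integral>\<^sup>+t. (if r < t \<and> t < R then ennreal \<bar>v t\<bar> else 0) \<partial>lborel) = T v r" for r
      unfolding T_def by (intro nn_integral_cong) (auto simp: indicator_def)
    ultimately show ?thesis by simp
  qed
  have loc: "AE r in lborel. r \<in> {e<..<R} \<longrightarrow> ennreal \<bar>u r\<bar> \<le> T v r" if e: "0 < e" "e < R" for e
  proof -
    \<comment> \<open>Subtraction in \<open>ennreal\<close> is truncated, so on the interval
      \<open>d\<close> vanishes exactly where the bound holds, including points with infinite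
      \<open>T v r\<close>.\<close>
    define d where "d = (\<lambda>r. indicator {e<..<R} r * (ennreal \<bar>u r\<bar> - T v r))"
    have d_meas [measurable]: "d \<in> borel_measurable borel" unfolding d_def by measurable
    define X Y where "X = (\<lambda>n. \<integral>\<^sup>+r. indicator {e<..<R} r * ennreal \<bar>un n r - u r\<bar> \<partial>lborel)"
      and "Y = (\<lambda>n. \<integral>\<^sup>+r. indicator {e<..<R} r * ennreal \<bar>vn n r - v r\<bar> \<partial>lborel)"
    have dXY: "(\<integral>\<^sup>+r. d r \<partial>lborel) \<le> X n + Y n * ennreal R" for n
    proof -
      have "(\<integral>\<^sup>+r. d r \<partial>lborel) \<le> (\<integral>\<^sup>+r. indicator {e<..<R} r * ennreal \<bar>un n r - u r\<bar> + Y n * indicator {0..R} r \<partial>lborel)"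
      proof (rule nn_integral_mono)
        fix r
        show "d r \<le> indicator {e<..<R} r * ennreal \<bar>un n r - u r\<bar> + Y n * indicator {0..R} r"
        proof (cases "r \<in> {e<..<R}")
          case True
          have "T (vn n) r \<le> (\<integral>\<^sup>+t. indicator {r<..<R} t * ennreal \<bar>v t\<bar> + indicator {e<..<R} t * ennreal \<bar>vn n t - v t\<bar> \<partial>lborel)"
            unfolding T_def
          proof (rule nn_integral_mono)
            fix t
            have "ennreal \<bar>vn n t\<bar> \<le> ennreal (\<bar>v t\<bar> + \<bar>vn n t - v t\<bar>)" by (intro ennreal_leI) linarith
            then have *: "ennreal \<bar>vn n t\<bar> \<le> ennreal \<bar>v t\<bar> + ennreal \<bar>vn n t - v t\<bar>" by (simp add: ennreal_plus)
            show "indicator {r<..<R} t * ennreal \<bar>vn n t\<bar>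
              \<le> indicator {r<..<R} t * ennreal \<bar>v t\<bar> + indicator {e<..<R} t * ennreal \<bar>vn n t - v t\<bar>"
              using * True by (cases "t \<in> {r<..<R}") auto
          qed
          also have "\<dots> = T v r + Y n"
            unfolding T_def Y_def by (intro nn_integral_add) measurable
          finally have TY: "T (vn n) r \<le> T v r + Y n" .
          have "ennreal \<bar>u r\<bar> \<le> ennreal (\<bar>un n r\<bar> + \<bar>un n r - u r\<bar>)" by (intro ennreal_leI) linarith
          also have "\<dots> = ennreal \<bar>un n r\<bar> + ennreal \<bar>un n r - u r\<bar>" by (simp add: ennreal_plus)
          also have "ennreal \<bar>un n r\<bar> \<le> T (vn n) r"
            unfolding T_def using True e by (intro Xgen_abs_le[OF wn]) auto
          also have "T (vn n) r \<le> T v r + Y n" by (rule TY)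
          finally have "ennreal \<bar>u r\<bar> \<le> T v r + (ennreal \<bar>un n r - u r\<bar> + Y n)"
            by (simp add: ac_simps)
          then have "ennreal \<bar>u r\<bar> - T v r \<le> ennreal \<bar>un n r - u r\<bar> + Y n"
            by (simp add: ennreal_minus_le_iff)
          then show ?thesis using True e by (simp add: d_def)
        qed (simp add: d_def)
      qed
      also have "\<dots> = X n + Y n * (\<integral>\<^sup>+r. indicator {0..R} r \<partial>lborel)"
        unfolding X_def by (simp add: nn_integral_add nn_integral_cmult del: nn_integral_indicator)
      also have "(\<integral>\<^sup>+r. indicator {0..R} r \<partial>lborel) = ennreal R" using R by simp
      finally show ?thesis .
    qed
    \<comment> \<open>First \<open>n\<close> tends to infinity with \<eta> fixed, and only later
      \<eta> tends to 0; in this order the growth of \<open>K1\<close> and \<open>K2\<close> for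
      small \<eta> does no harm.\<close>
    have d_le: "(\<integral>\<^sup>+r. d r \<partial>lborel) \<le> ennreal (\<eta> * (R + R * R))" if \<eta>: "0 < \<eta>" for \<eta>
    proof -
      define K1 K2 where "K1 = ennreal (\<eta> powr (1 - p) / (omega \<theta> * e powr \<theta>))"
        and "K2 = ennreal (\<eta> powr (1 - p) / (omega \<alpha> * e powr \<alpha>))"
      define B where "B = (\<lambda>n. (ennreal (\<eta> * R) + K1 * Lpn \<theta> p R (\<lambda>r. un n r - u r))
        + (ennreal (\<eta> * R) + K2 * Lpn \<alpha> p R (\<lambda>r. vn n r - v r)) * ennreal R)"
      have "(\<integral>\<^sup>+r. d r \<partial>lborel) \<le> B n" for n
      proof -
        have "X n \<le> ennreal (\<eta> * R) + K1 * Lpn \<theta> p R (\<lambda>r. un n r - u r)"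
          unfolding X_def K1_def by (rule nn_integral_le_Lpn[OF p \<theta> e \<eta>]) measurable
        moreover have "Y n \<le> ennreal (\<eta> * R) + K2 * Lpn \<alpha> p R (\<lambda>r. vn n r - v r)"
          unfolding Y_def K2_def by (rule nn_integral_le_Lpn[OF p \<alpha> e \<eta>]) measurable
        ultimately have "X n + Y n * ennreal R \<le> B n"
          unfolding B_def by (intro add_mono mult_right_mono) auto
        with dXY[of n] show ?thesis by (rule order_trans)
      qed
      moreover have "B \<longlonglongrightarrow> (ennreal (\<eta> * R) + K1 * 0) + (ennreal (\<eta> * R) + K2 * 0) * ennreal R"
        unfolding B_def un_def vn_def
        by (intro tendsto_add tendsto_const ennreal_tendsto_cmult lim_u lim_v tendsto_mult_ennreal) (auto simp: K1_def K2_def)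
      ultimately have "(\<integral>\<^sup>+r. d r \<partial>lborel) \<le> (ennreal (\<eta> * R) + K1 * 0) + (ennreal (\<eta> * R) + K2 * 0) * ennreal R"
        by (intro LIMSEQ_le_const) auto
      also have "\<dots> = ennreal (\<eta> * (R + R * R))"
        using \<eta> R by (simp add: ennreal_plus[symmetric] ennreal_mult[symmetric] algebra_simps del: ennreal_plus)
      finally show ?thesis .
    qed
    have "(\<lambda>n. ennreal (1 / Suc n * (R + R * R))) \<longlonglongrightarrow> ennreal (0 * (R + R * R))"
      by (intro tendsto_ennrealI tendsto_mult tendsto_const LIMSEQ_Suc lim_1_over_n)
    then have "(\<integral>\<^sup>+r. d r \<partial>lborel) \<le> ennreal (0 * (R + R * R))"
      by (rule LIMSEQ_le_const) (intro exI[of _ 0] allI impI d_le, simp)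
    then have "(\<integral>\<^sup>+r. d r \<partial>lborel) = 0" by simp
    then have "AE r in lborel. d r = 0"
      by (subst (asm) nn_integral_0_iff_AE) auto
    then show ?thesis
      by eventually_elim (auto simp: d_def diff_eq_0_iff_ennreal)
  qed
  \<comment> \<open>A countable exhaustion of the interval; the shift by 2 keeps the left ends
    strictly below \<open>R\<close>.\<close>
  have "AE r in lborel. \<forall>n::nat. r \<in> {R / (n + 2)<..<R} \<longrightarrow> ennreal \<bar>u r\<bar> \<le> T v r"
    unfolding AE_all_countable using R by (intro allI loc) (auto simp: field_simps add_pos_nonneg)
  then show ?thesis
  proof eventually_elim
    case (elim r)
    show ?case
    proof
      assume r: "r \<in> {0<..<R}"
      obtain n :: nat where "R / r < real n" using reals_Archimedean2 by blast
      then have "R / (real n + 2) < r" using r R by (simp add: field_simps)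
      then show "ennreal \<bar>u r\<bar> \<le> (\<integral>\<^sup>+t. indicator {r<..<R} t * ennreal \<bar>v t\<bar> \<partial>lborel)"
        using elim[rule_format, of n] r unfolding T_def by simp
    qed
  qed
qed

section \<open>The Trudinger--Moser bound\<close>

lemma Lpn_integral_le:
  assumes s: "0 < s" and v [measurable]: "v \<in> borel_measurable borel" and A: "Lpn s p R v = ennreal A" "0 \<le> A"
    and r: "0 < r" "r < R"
  shows "(\<lambda>t. t powr s * \<bar>v t\<bar> powr p) integrable_on {r..R}"
    and "omega s * integral {r..R} (\<lambda>t. t powr s * \<bar>v t\<bar> powr p) \<le> A"
proof -
  let ?h = "\<lambda>t. t powr s * \<bar>v t\<bar> powr p"
  define f where "f = (\<lambda>t. indicator {r<..<R} t * ?h t)"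
  have "(\<integral>\<^sup>+t. ennreal (omega s * f t) \<partial>lborel) \<le> Lpn s p R v"
    unfolding Lpn_altdef[OF s] using r omega_pos[OF s]
    by (intro nn_integral_mono ennreal_leI) (auto simp: f_def indicator_def)
  then have le: "(\<integral>\<^sup>+t. ennreal (omega s * f t) \<partial>lborel) \<le> ennreal A" using A by simp
  have f0: "0 \<le> omega s * f t" for t
    using omega_pos[OF s] by (simp add: f_def)
  have fin: "(\<integral>\<^sup>+t. ennreal (omega s * f t) \<partial>lborel) < \<infinity>"
    using le by (rule order.strict_trans1) simp
  have m: "(\<lambda>t. omega s * f t) \<in> borel_measurable borel" unfolding f_def by measurable
  have i: "(\<lambda>t. omega s * f t) integrable_on UNIV"
    by (rule nn_integral_integrable_on[OF m f0 fin])
  have "ennreal (integral UNIV (\<lambda>t. omega s * f t)) \<le> ennreal A"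
    using nn_integral_lborel_eq_integral[OF m f0 fin] le by simp
  then have I: "integral UNIV (\<lambda>t. omega s * f t) \<le> A"
    using A(2) integral_nonneg[OF i] f0 by (simp add: ennreal_le_iff)
  have "f = (\<lambda>t. if t \<in> {r<..<R} then ?h t else 0)" by (auto simp: f_def indicator_def)
  then have *: "f integrable_on UNIV \<longleftrightarrow> ?h integrable_on {r<..<R}" "integral UNIV f = integral {r<..<R} ?h"
    by (simp_all only: integrable_restrict_UNIV integral_restrict_UNIV)
  have fi: "f integrable_on UNIV"
    using integrable_on_cmult_left[OF i, of "1 / omega s"] omega_pos[OF s] by simp
  then show "?h integrable_on {r..R}"
    using * integrable_on_open_interval[of ?h r R] by (simp add: box_real)
  have "integral UNIV (\<lambda>t. omega s * f t) = omega s * integral {r..R} ?h"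
    using * integral_open_interval[of r R ?h] by (simp add: box_real)
  then show "omega s * integral {r..R} ?h \<le> A" using I by (simp only:)
qed

context ground_state
begin

text \<open>Depending on whether \<open>t * g t\<close> exceeds one, \<open>g t\<close> is bounded
  by \<open>t powr (p - 1) * g t powr p\<close> or by \<open>1 / t\<close>. So the tail grows at
  most logarithmically, which the positive power of \<open>r\<close> outweighs. The purpose is to
  make the potential on (0, r) at most a multiple of \<open>r\<close>.\<close>

lemma tail_powr_bounded:
  assumes g: "\<And>t. 0 \<le> g t" "\<And>r. r \<in> {0<..<R} \<Longrightarrow> g integrable_on {r..R}"
    and gp: "\<And>r. r \<in> {0<..<R} \<Longrightarrow> (\<lambda>t. t powr (p - 1) * g t powr p) integrable_on {r..R}"
    and A: "\<And>r. r \<in> {0<..<R} \<Longrightarrow> integral {r..R} (\<lambda>t. t powr (p - 1) * g t powr p) \<le> A"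
    and r: "r \<in> {0<..<R}"
  shows "r powr \<theta> * tail g r powr p \<le> (A + p / \<theta>) powr p * R powr \<theta>"
proof -
  have r0: "0 < r" "r < R" using r by auto
  have A0: "0 \<le> A"
    using integral_nonneg[OF gp[OF r]] A[OF r] by (force intro: order_trans)
  have 1: "((\<lambda>t. t powr (p - 1) * g t powr p + 1 / t) has_integral
      integral {r..R} (\<lambda>t. t powr (p - 1) * g t powr p) + (ln R - ln r)) {r..R}"
    using r0 by (intro has_integral_add integrable_integral gp r fundamental_theorem_of_calculus)
      (auto intro!: derivative_eq_intros simp: has_real_derivative_iff_has_vector_derivative[symmetric])
  have "tail g r \<le> integral {r..R} (\<lambda>t. t powr (p - 1) * g t powr p) + (ln R - ln r)"
    unfolding tail_def
  proof (rule has_integral_le[OF integrable_integral[OF g(2)[OF r]] 1])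
    fix t assume "t \<in> {r..R}"
    then have t: "0 < t" using r0 by simp
    show "g t \<le> t powr (p - 1) * g t powr p + 1 / t"
    proof (cases "t * g t \<le> 1")
      case True
      then have "g t \<le> 1 / t" using t by (simp add: field_simps)
      then show ?thesis by (simp add: add_increasing)
    next
      case False
      then have "g t * 1 \<le> g t * (t * g t) powr (p - 1)"
        using g(1)[of t] p by (intro mult_left_mono ge_one_powr_ge_zero) auto
      also have "\<dots> = t powr (p - 1) * g t powr p"
        using t g(1)[of t] powr_mult_base[of "g t" "p - 1"] by (simp add: powr_mult)
      finally show ?thesis using t by (simp add: add_increasing2)
    qed
  qed
  also have "\<dots> \<le> A + ln (R / r)" using A[OF r] r0 by (simp add: ln_div)
  also have "\<dots> \<le> (A + p / \<theta>) * (R / r) powr (\<theta> / p)"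
  proof -
    have x: "1 \<le> R / r" using r0 by simp
    have "ln (R / r) \<le> (R / r) powr (\<theta> / p) / (\<theta> / p)"
      using x p_pos by (intro ln_powr_bound) auto
    moreover have "A * 1 \<le> A * (R / r) powr (\<theta> / p)"
      using x A0 p_pos by (intro mult_left_mono ge_one_powr_ge_zero) auto
    ultimately show ?thesis by (simp add: distrib_right mult.commute)
  qed
  finally have "tail g r powr p \<le> ((A + p / \<theta>) * (R / r) powr (\<theta> / p)) powr p"
    using tail_props(2)[OF g r, of r] r0 p_pos by (intro powr_mono2) auto
  also have "\<dots> = (A + p / \<theta>) powr p * (R powr \<theta> / r powr \<theta>)"
    using A0 p_pos r0 by (simp add: powr_mult powr_powr powr_divide)
  finally have "r powr \<theta> * tail g r powr p \<le> r powr \<theta> * ((A + p / \<theta>) powr p * (R powr \<theta> / r powr \<theta>))"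
    by (intro mult_left_mono) auto
  then show ?thesis using r0 by simp
qed

text \<open>Nonnegativity on \<open>{x..r}\<close> and additivity move the left end down to
  \<open>x\<close>. The boundary term there is nonnegative and enters with a minus sign, and the
  error \<open>c * K * x\<close> vanishes as \<open>x\<close> tends to 0.\<close>

lemma excess_le:
  assumes g: "g \<in> borel_measurable borel" "\<And>t. 0 \<le> g t" "\<And>r. r \<in> {0<..<R} \<Longrightarrow> g integrable_on {r..R}"
    and gp: "\<And>r. r \<in> {0<..<R} \<Longrightarrow> (\<lambda>t. t powr (p - 1) * g t powr p) integrable_on {r..R}"
    and A: "\<And>r. r \<in> {0<..<R} \<Longrightarrow> integral {r..R} (\<lambda>t. t powr (p - 1) * g t powr p) \<le> A"
    and B: "\<And>r. r \<in> {0<..<R} \<Longrightarrow> A - c * (integral {r..R} (\<lambda>t. t powr \<theta> * tail g t powr p) + K * r) \<le> B"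
    and r: "r \<in> {0<..<R}"
  shows "excess g r R \<le> B"
proof (rule tendsto_lowerbound)
  show "((\<lambda>x. B + c * K * x) \<longlongrightarrow> B) (at_right 0)"
    by (auto intro!: tendsto_eq_intros)
  have "\<forall>\<^sub>F x in at_right 0. x \<in> {0<..<r}"
    using r by (intro eventually_at_right_real) simp
  then show "\<forall>\<^sub>F x in at_right 0. excess g r R \<le> B + c * K * x"
  proof eventually_elim
    case x: (elim x)
    then have xR: "x \<in> {0<..<R}" using r by auto
    have "0 \<le> excess g x r"
      using increment_bound_holds[of x r g] g gp[OF xR] x xR r by (simp add: increment_bound_def)
    then have "excess g r R \<le> excess g x R"
      using excess_combine[OF g(2,3) gp, of x r] x r by simp
    also have "\<dots> \<le> A - c * integral {x..R} (\<lambda>t. t powr \<theta> * tail g t powr p)"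
    proof -
      have "0 \<le> bdry g x"
        using mass_nonneg[OF \<phi>_ok, of x] \<phi>_nonneg[of x] xR by (simp add: bdry_def)
      moreover have "bdry g R = 0"
        by (simp add: bdry_def ratio_def tail_def)
      ultimately show ?thesis using A[OF xR] by (simp add: excess_def)
    qed
    also have "\<dots> \<le> B + c * K * x"
      using B[OF xR] by (simp add: algebra_simps)
    finally show ?case .
  qed
qed (simp add: trivial_limit_at_right_real)

end

theorem theorem1p1:
  fixes p R \<theta> \<nu> :: real
  assumes "p \<ge> 2" and "0 < R" and "\<theta> \<ge> p - 1"
    and "0 \<le> \<nu>" and "ennreal \<nu> < lambda1 p R (p - 1) \<theta>"
  shows "(SUP uv \<in> {uv \<in> Xsp p R (p - 1) \<theta>. Hnu p R (p - 1) \<theta> \<nu> (fst uv) (snd uv) \<le> 1}.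
            lam_int \<theta> R (\<lambda>r. ennreal (exp (mu (p - 1) \<theta> * \<bar>fst uv r\<bar> powr (p / (p - 1))))))
         < \<infinity>"
proof -
  define a b where "a = omega (p - 1)" and "b = omega \<theta>"
  have pos: "0 < p" "0 < p - 1" "0 < \<theta>" using assms by auto
  have ab: "0 < a" "0 < b" using pos by (auto simp: a_def b_def intro: omega_pos)
  \<comment> \<open>A value strictly in between preserves the gap that bounds the iteration; lying
    below another extended real, it is finite.\<close>
  obtain x where x: "ennreal \<nu> < x" "x < lambda1 p R (p - 1) \<theta>"
    using dense[OF assms(5)] by blast
  then obtain \<kappa> where \<kappa>: "x = ennreal \<kappa>" "0 \<le> \<kappa>"
    by (cases x) (auto simp: top.not_eq_extremum)
  have \<nu>\<kappa>: "\<nu> < \<kappa>" using x(1) \<kappa> assms(4) by (simp add: ennreal_less_iff)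
  have \<kappa>_le: "ennreal \<kappa> \<le> lambda1 p R (p - 1) \<theta>" using x(2) \<kappa> by simp
  interpret subcritical_weight p R \<theta> "\<nu> * b / a" "\<kappa> * b / a"
  proof
    fix \<psi> :: "real \<Rightarrow> real" assume \<psi>: "continuous_on {0..R} \<psi>" "\<And>r. r \<in> {0..R} \<Longrightarrow> 0 \<le> \<psi> r"
    let ?w = "\<lambda>r. integral {r..R} \<psi>"
    let ?u = "\<lambda>r. indicator {0<..<R} r * ?w r" and ?v = "\<lambda>r. indicator {0<..<R} r * - \<psi> r"
    have int: "\<psi> integrable_on {r..R}" if "0 \<le> r" for r
      using that by (intro integrable_continuous_real continuous_on_subset[OF \<psi>(1)]) auto
    have w: "continuous_on {0..R} ?w" by (intro indefinite_integral_continuous_1' int) simp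
    have w0: "0 \<le> ?w r" if "r \<in> {0..R}" for r using that \<psi>(2) by (intro integral_nonneg int) auto
    have "(?u, ?v) \<in> Xsp p R (p - 1) \<theta>"
      using tail_in_Xgen[OF assms(2) pos \<psi>] Xgen_subset_Xsp by blast
    then have "ennreal \<kappa> * Lpn \<theta> p R ?u \<le> Lpn (p - 1) p R ?v"
      by (rule lambda1_le[OF _ \<kappa>_le])
    moreover have "Lpn \<theta> p R ?u = ennreal (b * integral {0..R} (\<lambda>r. r powr \<theta> * ?w r powr p))"
      unfolding b_def using w0 by (intro Lpn_continuous pos assms(2) w) auto
    moreover have "Lpn (p - 1) p R ?v = ennreal (a * integral {0..R} (\<lambda>r. r powr (p - 1) * \<psi> r powr p))"
      unfolding a_def using \<psi>(2) by (intro Lpn_continuous pos assms(2) \<psi>(1)) auto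
    moreover have "0 \<le> integral {0..R} (\<lambda>r. r powr (p - 1) * \<psi> r powr p)"
      using \<psi> pos by (intro integral_nonneg integrable_continuous_real continuous_intros continuous_on_powr') auto
    moreover have "0 \<le> integral {0..R} (\<lambda>r. r powr \<theta> * ?w r powr p)"
      using w w0 pos by (intro integral_nonneg integrable_continuous_real continuous_intros continuous_on_powr') auto
    ultimately have "\<kappa> * (b * integral {0..R} (\<lambda>r. r powr \<theta> * ?w r powr p)) \<le> a * integral {0..R} (\<lambda>r. r powr (p - 1) * \<psi> r powr p)"
      using ab \<kappa>(2) by (simp add: ennreal_mult[symmetric])
    then show "\<kappa> * b / a * integral {0..R} (\<lambda>r. r powr \<theta> * ?w r powr p) \<le> integral {0..R} (\<lambda>r. r powr (p - 1) * \<psi> r powr p)"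
      using ab by (simp add: field_simps)
  qed (use assms ab \<nu>\<kappa> in \<open>auto simp: divide_strict_right_mono\<close>)
  obtain \<phi> where \<phi>: "continuous_on {0..R} \<phi>" "\<And>r. r \<in> {0..R} \<Longrightarrow> 1 \<le> \<phi> r"
    "\<And>r. r \<in> {0..R} \<Longrightarrow> \<phi> r = 1 + integral {r..R} (slope \<phi>)"
    using exists_ground_state by blast
  interpret ground_state p R \<theta> "\<nu> * b / a" "\<kappa> * b / a" \<phi>
    by unfold_locales (fact \<phi>)+
  obtain C :: ennreal where C: "C < \<infinity>"
    "\<And>g. g \<in> borel_measurable borel \<Longrightarrow> (\<And>t. 0 \<le> g t) \<Longrightarrow>
      (\<And>r. r \<in> {0<..<R} \<Longrightarrow> g integrable_on {r..R}) \<Longrightarrow>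
      (\<And>r. r \<in> {0<..<R} \<Longrightarrow> (\<lambda>t. t powr (p - 1) * g t powr p) integrable_on {r..R}) \<Longrightarrow>
      (\<And>r. r \<in> {0<..<R} \<Longrightarrow> a * excess g r R \<le> 1) \<Longrightarrow>
      (\<integral>\<^sup>+r. indicator {0<..<R} r *
         ennreal (b * r powr \<theta> * exp ((\<theta> + 1) * a powr (1 / (p - 1)) * tail g r powr q)) \<partial>lborel) \<le> C"
    by (rule exponential_integral_bound[OF ab(1) less_imp_le[OF ab(2)]]) blast
  have "lam_int \<theta> R (\<lambda>r. ennreal (exp (mu (p - 1) \<theta> * \<bar>u r\<bar> powr q))) \<le> C"
    if uv: "(u, v) \<in> Xsp p R (p - 1) \<theta>" and H: "Hnu p R (p - 1) \<theta> \<nu> u v \<le> 1" for u v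
  proof -
    define A B where "A = enn2real (Lpn (p - 1) p R v)" and "B = enn2real (Lpn \<theta> p R u)"
    have v [measurable]: "v \<in> borel_measurable borel" using uv by (simp add: Xsp_def inLp_def)
    have A: "Lpn (p - 1) p R v = ennreal A" "0 \<le> A" and B: "Lpn \<theta> p R u = ennreal B" "0 \<le> B"
      using uv by (auto simp: A_def B_def Xsp_def inLp_def less_top)
    have "(A - \<nu> * B) powr (1 / p) \<le> 1" using H by (simp add: Hnu_def A_def B_def)
    \<comment> \<open>Excluding a base above one also covers a negative
      \<open>A - \<nu> * B\<close>, whatever value \<open>powr\<close> takes there.\<close>
    moreover have "1 < (A - \<nu> * B) powr (1 / p)" if "1 < A - \<nu> * B"
      using that pos by (intro gr_one_powr) auto
    ultimately have AB: "A - \<nu> * B \<le> 1" by linarith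
    define g where "g = (\<lambda>t. \<bar>v t\<bar>)"
    have g [measurable]: "g \<in> borel_measurable borel" unfolding g_def by measurable
    have g0: "0 \<le> g t" for t by (simp add: g_def)
    have gp: "(\<lambda>t. t powr (p - 1) * g t powr p) integrable_on {r..R}"
      and gA: "integral {r..R} (\<lambda>t. t powr (p - 1) * g t powr p) \<le> A / a" if r: "r \<in> {0<..<R}" for r
      using Lpn_integral_le[OF pos(2) v A, of r] r ab(1) by (auto simp: g_def a_def field_simps)
    \<comment> \<open>Integrability away from 0: \<open>g \<le> 1 + g powr p\<close>, and the weight
      is at least \<open>r powr (p - 1)\<close>.\<close>
    have gi: "g integrable_on {r..R}" if r: "r \<in> {0<..<R}" for r
    proof (rule borel_integrable_on_bounded[OF g])
      show "(\<lambda>t. 1 + 1 / r powr (p - 1) * (t powr (p - 1) * g t powr p)) integrable_on {r..R}"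
        by (intro integrable_add integrable_on_mult_right gp r integrable_const_ivl)
      fix t assume t: "t \<in> {r..R}"
      have "g t \<le> 1 + g t powr p"
      proof (cases "g t \<le> 1")
        case False
        then have "g t powr 1 \<le> g t powr p" using assms(1) by (intro powr_mono) auto
        then show ?thesis using False by simp
      qed (simp add: add_increasing2)
      moreover have "g t powr p * r powr (p - 1) \<le> g t powr p * t powr (p - 1)"
        using t r pos by (intro mult_left_mono powr_mono2) auto
      then have "g t powr p \<le> 1 / r powr (p - 1) * (t powr (p - 1) * g t powr p)"
        using r by (simp add: pos_le_divide_eq mult.commute)
      ultimately show "\<bar>g t\<bar> \<le> 1 + 1 / r powr (p - 1) * (t powr (p - 1) * g t powr p)"
        using g0[of t] by linarith
    qed
    have T: "(\<integral>\<^sup>+t. indicator {r<..<R} t * ennreal \<bar>v t\<bar> \<partial>lborel) = ennreal (tail g r)" if r: "r \<in> {0<..<R}" for r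
    proof -
      have "(g has_integral tail g r) {r<..<R}"
        using integrable_integral[OF gi[OF r]] has_integral_open_interval[of g "tail g r" r R]
        by (simp add: tail_def box_real)
      then have "(\<integral>\<^sup>+t. ennreal (g t) * indicator {r<..<R} t \<partial>lborel) = ennreal (tail g r)"
        by (intro nn_integral_has_integral_lebesgue' g0)
      then show ?thesis by (simp add: g_def mult.commute)
    qed
    have u_le: "AE r in lborel. r \<in> {0<..<R} \<longrightarrow> \<bar>u r\<bar> \<le> tail g r"
    proof -
      have "AE r in lborel. r \<in> {0<..<R} \<longrightarrow> ennreal \<bar>u r\<bar> \<le> (\<integral>\<^sup>+t. indicator {r<..<R} t * ennreal \<bar>v t\<bar> \<partial>lborel)"
        using assms(1) by (intro Xsp_abs_le[OF uv _ pos(2,3) assms(2)]) auto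
      then show ?thesis
      proof eventually_elim
        case (elim r)
        show ?case
        proof
          assume r: "r \<in> {0<..<R}"
          have "0 \<le> tail g r" using tail_props(2)[OF g0 gi r, of r] r by simp
          then show "\<bar>u r\<bar> \<le> tail g r" using elim r T[OF r] by simp
        qed
      qed
    qed
    define K where "K = (A / a + p / \<theta>) powr p * R powr \<theta>"
    have K: "r powr \<theta> * tail g r powr p \<le> K" if r: "r \<in> {0<..<R}" for r
      unfolding K_def by (rule tail_powr_bounded[OF g0 gi gp gA r])
    have K0: "0 \<le> K" by (simp add: K_def)
    \<comment> \<open>Since \<open>B\<close> enters the functional with the factor
      \<open>- \<nu>\<close>, it may be enlarged: \<open>u\<close> is replaced by the tail of
      \<open>\<bar>v\<bar>\<close>, and the part over (0, r) is estimated by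
      \<open>K * r\<close>.\<close>
    have B_le: "B \<le> b * (integral {r..R} (\<lambda>t. t powr \<theta> * tail g t powr p) + K * r)" if r: "r \<in> {0<..<R}" for r
    proof -
      let ?I = "integral {r..R} (\<lambda>t. t powr \<theta> * tail g t powr p)"
      define h where "h = (\<lambda>t. if t < r then K else t powr \<theta> * tail g t powr p)"
      have I0: "0 \<le> ?I" by (intro integral_nonneg tail_props(4)[OF g0 gi r]) auto
      have h0: "0 \<le> h t" for t using K0 by (simp add: h_def)
      have "((\<lambda>t. b * h t) has_integral b * (K * r + ?I)) {0..R}"
      proof (intro has_integral_mult_right has_integral_combine[of 0 r R])
        have "((\<lambda>t. K) has_integral K * r) {0..r}"
          using has_integral_const_real[of K 0 r] r by (simp add: mult.commute)
        then show "(h has_integral K * r) {0..r}"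
          by (rule has_integral_spike_finite[of "{r}", rotated 2]) (auto simp: h_def)
        have "((\<lambda>t. t powr \<theta> * tail g t powr p) has_integral ?I) {r..R}"
          by (intro integrable_integral tail_props(4)[OF g0 gi r])
        then show "(h has_integral ?I) {r..R}"
          by (rule has_integral_eq[rotated]) (auto simp: h_def)
      qed (use r in auto)
      then have hI: "(\<integral>\<^sup>+t. ennreal (b * h t) * indicator {0..R} t \<partial>lborel) = ennreal (b * (K * r + ?I))"
        using ab h0 by (intro nn_integral_has_integral_lebesgue') auto
      have "ennreal B \<le> (\<integral>\<^sup>+t. ennreal (b * h t) * indicator {0..R} t \<partial>lborel)"
        unfolding B(1)[symmetric] Lpn_altdef[OF pos(3)]
      proof (rule nn_integral_mono_AE)
        show "AE t in lborel. ennreal (indicator {0<..<R} t * (omega \<theta> * t powr \<theta> * \<bar>u t\<bar> powr p)) \<le> ennreal (b * h t) * indicator {0..R} t"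
          using u_le
        proof eventually_elim
          case (elim t)
          show ?case
          proof (cases "t \<in> {0<..<R}")
            case True
            have "t powr \<theta> * \<bar>u t\<bar> powr p \<le> t powr \<theta> * tail g t powr p"
              using elim True pos by (intro mult_left_mono powr_mono2) auto
            also have "\<dots> \<le> h t" using K[OF True] by (simp add: h_def)
            finally have "b * (t powr \<theta> * \<bar>u t\<bar> powr p) \<le> b * h t" using ab by (intro mult_left_mono) auto
            then show ?thesis using True by (simp add: b_def mult.assoc ennreal_leI)
          qed simp
        qed
      qed
      also note hI
      finally show ?thesis
        using ab K0 I0 r by (simp add: add.commute)
    qed
    have ex: "a * excess g r R \<le> 1" if r: "r \<in> {0<..<R}" for r
    proof -
      have "excess g r R \<le> 1 / a"
      proof (rule excess_le[OF g g0 gi gp gA _ r])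
        fix r assume r: "r \<in> {0<..<R}"
        have "\<nu> * B \<le> \<nu> * (b * (integral {r..R} (\<lambda>t. t powr \<theta> * tail g t powr p) + K * r))"
          using B_le[OF r] assms(4) by (rule mult_left_mono)
        then have "A - \<nu> * b * (integral {r..R} (\<lambda>t. t powr \<theta> * tail g t powr p) + K * r) \<le> 1"
          using AB by (simp add: mult.assoc)
        then have "(A - \<nu> * b * (integral {r..R} (\<lambda>t. t powr \<theta> * tail g t powr p) + K * r)) / a \<le> 1 / a"
          using ab by (intro divide_right_mono) auto
        then show "A / a - \<nu> * b / a * (integral {r..R} (\<lambda>t. t powr \<theta> * tail g t powr p) + K * r) \<le> 1 / a"
          by (simp add: diff_divide_distrib)
      qed
      then show ?thesis using ab by (simp add: field_simps)
    qed
    have "lam_int \<theta> R (\<lambda>r. ennreal (exp (mu (p - 1) \<theta> * \<bar>u r\<bar> powr q)))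
      \<le> (\<integral>\<^sup>+r. indicator {0<..<R} r *
         ennreal (b * r powr \<theta> * exp ((\<theta> + 1) * a powr (1 / (p - 1)) * tail g r powr q)) \<partial>lborel)"
      unfolding lam_int_def
    proof (rule nn_integral_mono_AE)
      show "AE r in lborel. indicator {0<..<R} r * ennreal (omega \<theta> * r powr \<theta>) * ennreal (exp (mu (p - 1) \<theta> * \<bar>u r\<bar> powr q))
        \<le> indicator {0<..<R} r * ennreal (b * r powr \<theta> * exp ((\<theta> + 1) * a powr (1 / (p - 1)) * tail g r powr q))"
        using u_le
      proof eventually_elim
        case (elim r)
        show ?case
        proof (cases "r \<in> {0<..<R}")
          case True
          have "\<bar>u r\<bar> powr q \<le> tail g r powr q"
            using elim True q_props by (intro powr_mono2) auto
          then have "mu (p - 1) \<theta> * \<bar>u r\<bar> powr q \<le> (\<theta> + 1) * a powr (1 / (p - 1)) * tail g r powr q"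
            unfolding mu_def a_def using pos by (intro mult_left_mono) auto
          then have "b * r powr \<theta> * exp (mu (p - 1) \<theta> * \<bar>u r\<bar> powr q)
            \<le> b * r powr \<theta> * exp ((\<theta> + 1) * a powr (1 / (p - 1)) * tail g r powr q)"
            using ab by (intro mult_left_mono) auto
          then show ?thesis
            using True ab by (simp add: b_def[symmetric] ennreal_mult[symmetric] ennreal_leI)
        qed simp
      qed
    qed
    also have "\<dots> \<le> C" by (rule C(2)[OF g g0 gi gp ex])
    finally show ?thesis .
  qed
  then have "(SUP uv \<in> {uv \<in> Xsp p R (p - 1) \<theta>. Hnu p R (p - 1) \<theta> \<nu> (fst uv) (snd uv) \<le> 1}.
            lam_int \<theta> R (\<lambda>r. ennreal (exp (mu (p - 1) \<theta> * \<bar>fst uv r\<bar> powr (p / (p - 1)))))) \<le> C"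
    by (intro SUP_least) auto
  then show ?thesis using C(1) by (rule order.strict_trans1)
qed

end
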